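(* Let $f\colon[0,1]\to[0,1]$ be defined by - $f(x)=x+18x^3$ for $x\in[0,1/3]$, - $f(x)=x+72(x-\tfrac12)^3$ for $x\in(1/3,2/3)$, - $f(x)=x+18(x-1)^3$ for $x\in[2/3,1]$. Then for every closed connected subset $\mathcal C\subset\mathcal S$, $$\dim_{\rm H}\{x\in[0,1]\colon\mathcal V(x)=\pi\mathcal C\}=1 .$$ In particular, $\dim_{\rm H}\{x\colon e_n(x)\to\nu_{\bar p}\}=1$ for every $\bar p\in\mathcal S$.
   Context: The map $f$ has neutral fixed points $\xi_1=0$, $\xi_2=1/2$, $\xi_3=1$. $e_n(x)=\frac1n\sum_{k=0}^{n-1}\delta_{f^kx}$ is the $n$th empirical measure, and $\mathcal V(x)$ is the set of weak$*$ limit points of $(e_n(x))_n$. Let $\mathcal S=\{\bar p\in[0,1]^3\colon p_1+p_2+p_3=1\}$, and let $\pi(\bar p)=\nu_{\bar p}=\sum_{j=1}^3p_j\delta_{\xi_j}$. *)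

theory Defs
  imports "HOL-Probability.Probability"
begin

definition fmap :: "real \<Rightarrow> real" where
  "fmap x = (if x \<le> 1/3 then x + 18 * x^3
             else if x < 2/3 then x + 72 * (x - 1/2)^3
             else x + 18 * (x - 1)^3)"

text \<open>Integral of a test function g against the n-th empirical measure of x.\<close>
definition emp_avg :: "(real \<Rightarrow> real) \<Rightarrow> nat \<Rightarrow> real \<Rightarrow> real" where
  "emp_avg g n x = (1 / real n) * (\<Sum>k<n. g ((fmap ^^ k) x))"

text \<open>Borel probability measures on [0,1], represented as Borel probability
  measures on the real line concentrated on [0,1].\<close>
definition prob_meas01 :: "real measure \<Rightarrow> bool" where
  "prob_meas01 \<mu> \<longleftrightarrow> prob_space \<mu> \<and> sets \<mu> = sets borel \<and> emeasure \<mu> {0..1} = 1"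

text \<open>Weak* limit points of (e_n(x))_n: test functions are the continuous
  functions (continuous real functions on the line restrict to all of C[0,1]).\<close>
definition Vset :: "real \<Rightarrow> real measure set" where
  "Vset x = {\<mu>. prob_meas01 \<mu> \<and>
     (\<exists>r. strict_mono r \<and>
        (\<forall>g. continuous_on UNIV g \<longrightarrow>
            (\<lambda>k. emp_avg g (r k) x) \<longlonglongrightarrow> integral\<^sup>L \<mu> g))}"

definition emp_conv :: "real \<Rightarrow> real measure \<Rightarrow> bool" where
  "emp_conv x \<mu> \<longleftrightarrow> (\<forall>g. continuous_on UNIV g \<longrightarrow>
            (\<lambda>n. emp_avg g n x) \<longlonglongrightarrow> integral\<^sup>L \<mu> g)"

definition simplexS :: "(real \<times> real \<times> real) set" where
  "simplexS = {(p1, p2, p3). 0 \<le> p1 \<and> p1 \<le> 1 \<and> 0 \<le> p2 \<and> p2 \<le> 1 \<and>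
                             0 \<le> p3 \<and> p3 \<le> 1 \<and> p1 + p2 + p3 = 1}"

definition nu :: "real \<times> real \<times> real \<Rightarrow> real measure" where
  "nu p = measure_of UNIV (sets borel)
     (\<lambda>A. ennreal (fst p) * indicator A 0
        + ennreal (fst (snd p)) * indicator A (1/2)
        + ennreal (snd (snd p)) * indicator A 1)"

definition hterm :: "real \<Rightarrow> real set \<Rightarrow> ennreal" where
  "hterm s U = (if U = {} then 0 else if s = 0 then 1 else ennreal (diameter U powr s))"

definition hausdorff_pre :: "real \<Rightarrow> real \<Rightarrow> real set \<Rightarrow> ennreal" where
  "hausdorff_pre s \<delta> A = (INF U \<in> {U :: nat \<Rightarrow> real set.
        A \<subseteq> (\<Union>i. U i) \<and> (\<forall>i. bounded (U i) \<and> diameter (U i) \<le> \<delta>)}.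
        (\<Sum>i. hterm s (U i)))"

definition hausdorff_measure :: "real \<Rightarrow> real set \<Rightarrow> ennreal" where
  "hausdorff_measure s A = (SUP \<delta> \<in> {0<..}. hausdorff_pre s \<delta> A)"

definition hausdorff_dim :: "real set \<Rightarrow> real" where
  "hausdorff_dim A = Inf {s. 0 \<le> s \<and> hausdorff_measure s A = 0}"

end

theory Submission
  imports Defs
begin

text \<open>
  The map has three increasing full branches, so points are coded by sequences over three symbols.
  A long run of one symbol keeps the orbit near the corresponding neutral fixed point, but it shrinks
  the cylinder only polynomially in the length of the run, because the fixed points are neutral.
  All other words are built from blocks \<open>j...jk\<close> with \<open>k \<noteq> j\<close> and bounded run length: these contract
  uniformly, concatenations of them have bounded distortion, and they omit only a small
  proportion of every cylinder.

  At stage \<open>i\<close> of a code choose \<open>i\<close> free blocks and then insert runs of total length about \<open>i\<^sup>2\<close> with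
  prescribed frequencies \<open>q i\<close> of the three symbols. The inserted runs dominate the time, so the
  empirical measures follow the averages of \<open>q\<close> with weights \<open>i\<^sup>2\<close>; letting \<open>q\<close> move slowly through
  \<open>C\<close> along finer and finer chains makes \<open>C\<close> the limit set. On the other hand the free blocks contract
  the stage \<open>i\<close> cylinders by a factor exponential in \<open>i\<close>, which dominates the polynomial loss caused
  by the insertions, so the product measure on the free choices has local dimension close to 1 and
  the mass distribution principle applies.
\<close>

section \<open>The cubic map and its inverse\<close>

text \<open>The stage sizes balance three demands. The free blocks of stage \<open>i\<close> take
  time O(i), so runs of total length about \<open>i\<^sup>2\<close> swamp them. One such stage is
  still negligible against the roughly i^3/3 steps before it, so the averages cannot swing while a
  stage is in progress, and the order of the three runs inside it is immaterial. Finally, an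
  inserted word breaks bounded distortion, so every stage costs a factor \<open>KD\<close> besides a
  power of \<open>i\<close>. With boundedly many free blocks per stage the product of these losses
  would outgrow the contraction; stages with 1, 2, 3, ... free blocks contract by 2^(-(1 + 2 + ... +
  i)), and the losses become harmless. Blocks of bounded run length leave out some length, so no
  bound \<open>N\<close> is fixed once and for all. To exceed a dimension \<open>s < 1\<close> put
  \<beta> = 1 - s, ask that each block keep at least the fraction \<eta> = 2^(-\<beta>/4) of the
  length, and take \<open>N\<close> accordingly. The frequencies \<open>q\<close> do not depend on
  \<open>s\<close>, so all these code spaces map into the same target set.\<close>

definition cub :: "real \<Rightarrow> real" where
  "cub u = u + 18 * u ^ 3"

definition icub :: "real \<Rightarrow> real" where
  "icub = inv cub"

definition cslope :: "real \<Rightarrow> real \<Rightarrow> real" where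
  "cslope a b = 1 + 18 * (a\<^sup>2 + a * b + b\<^sup>2)"

lemma cub_diff: "cub b - cub a = cslope a b * (b - a)"
  unfolding cub_def cslope_def by (simp add: power2_eq_square power3_eq_cube algebra_simps)

lemma cslope_ge_1: "cslope a b \<ge> 1"
proof -
  have "a\<^sup>2 + a * b + b\<^sup>2 = (a + b / 2)\<^sup>2 + 3 / 4 * b\<^sup>2"
    by (simp add: power2_eq_square algebra_simps)
  then show ?thesis unfolding cslope_def by simp
qed

lemma cub_less_iff [simp]: "cub a < cub b \<longleftrightarrow> a < b"
proof -
  have "cslope a b > 0" using cslope_ge_1[of a b] by linarith
  then have "0 < cslope a b * (b - a) \<longleftrightarrow> a < b" by (simp add: zero_less_mult_iff)
  then show ?thesis using cub_diff[of b a] by linarith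
qed

lemma bij_cub: "bij cub"
proof (rule bijI)
  show "inj cub"
    by (rule injI) (metis cub_less_iff linorder_neq_iff)
  have "\<exists>x. y = cub x" for y
  proof -
    have "\<exists>x\<ge>-\<bar>y\<bar>. x \<le> \<bar>y\<bar> \<and> cub x = y"
    proof (rule IVT')
      have "\<bar>y\<bar> ^ 3 \<ge> 0" "(- \<bar>y\<bar>) ^ 3 = - (\<bar>y\<bar> ^ 3)" by simp_all
      then show "cub (- \<bar>y\<bar>) \<le> y" "y \<le> cub \<bar>y\<bar>"
        unfolding cub_def by linarith+
      show "continuous_on {- \<bar>y\<bar>..\<bar>y\<bar>} cub"
        unfolding cub_def by (intro continuous_intros)
    qed auto
    then show ?thesis by blast
  qed
  then show "surj cub" unfolding surj_def by blast
qed

lemma cub_icub [simp]: "cub (icub y) = y"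
  unfolding icub_def using bij_cub by (simp add: bij_is_surj surj_f_inv_f)

lemma icub_cub [simp]: "icub (cub y) = y"
  unfolding icub_def using bij_cub by (simp add: bij_is_inj)

lemma icub_less_iff [simp]: "icub a < icub b \<longleftrightarrow> a < b"
  by (metis cub_icub cub_less_iff)

lemma icub_le_iff [simp]: "icub a \<le> icub b \<longleftrightarrow> a \<le> b"
  by (meson icub_less_iff linorder_not_le)

lemma icub_minus [simp]: "icub (- y) = - icub y"
proof -
  have "cub (- icub y) = - cub (icub y)" unfolding cub_def by simp
  then show ?thesis by (metis cub_icub icub_cub)
qed

lemma icub_0 [simp]: "icub 0 = 0" and icub_1 [simp]: "icub 1 = 1/3"
proof -
  have "cub 0 = 0" "cub (1/3) = 1" unfolding cub_def by (auto simp: power3_eq_cube)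
  then show "icub 0 = 0" "icub 1 = 1/3" by (metis icub_cub)+
qed

lemma icub_diff: "icub b - icub a = (b - a) / cslope (icub a) (icub b)"
  using cub_diff[of "icub b" "icub a"] cslope_ge_1[of "icub a" "icub b"]
  by (simp add: field_simps)

lemma icub_le: "y \<ge> 0 \<Longrightarrow> icub y \<le> y"
  using icub_le_iff[of 0 y] cub_icub[of y] unfolding cub_def
  by (smt (verit) icub_0 zero_le_power)

text \<open>Put \<open>u = icub v\<close> and \<open>s = 18 * u\<^sup>2\<close>. For v > 0, 1/u^2 -
  1/v^2 = 18 (2 + s) / (1 + s)^2, which decreases in \<open>s\<close> and equals 8 at
  \<open>s = 2\<close>, that is at u = 1/3, v = 1. Hence the inverse square grows by at least 8 per
  backward step, and backward orbits decay like n^(-1/2) or faster.\<close>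

lemma icub_sq_le:
  assumes "0 \<le> v" "v \<le> 1" "c > 0" "v\<^sup>2 \<le> 1 / c"
  shows "(icub v)\<^sup>2 \<le> 1 / (c + 8)"
proof -
  define u where "u = icub v"
  define s where "s = 18 * u\<^sup>2"
  have u: "0 \<le> u" "u \<le> 1/3"
    using assms icub_le_iff[of 0 v] icub_le_iff[of v 1] by (auto simp: u_def simp del: icub_le_iff)
  have v: "v = u * (1 + s)"
    using cub_icub[of v] unfolding cub_def u_def[symmetric] s_def
    by (simp add: algebra_simps power2_eq_square power3_eq_cube)
  have "u * u \<le> 1/3 * (1/3)" using u by (intro mult_mono) auto
  then have s: "0 \<le> s" "s \<le> 2" unfolding s_def by (auto simp: power2_eq_square)
  have 1: "c * (u\<^sup>2 * (1 + s)\<^sup>2) \<le> 1"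
    using assms(3,4) unfolding v power_mult_distrib by (simp add: pos_le_divide_eq mult.commute)
  have "(2 - s) * (4 * s + 7) \<ge> 0" using s by simp
  then have "4 * (1 + s)\<^sup>2 \<le> 9 * (2 + s)"
    by (simp add: algebra_simps power2_eq_square)
  then have "s * (4 * (1 + s)\<^sup>2) \<le> s * (9 * (2 + s))"
    using s(1) by (intro mult_left_mono) auto
  then have "8 * u\<^sup>2 * (1 + s)\<^sup>2 \<le> (1 + s)\<^sup>2 - 1"
    unfolding s_def[symmetric] by (simp add: s_def algebra_simps power2_eq_square)
  with 1 have "(c + 8) * u\<^sup>2 * (1 + s)\<^sup>2 \<le> 1 * (1 + s)\<^sup>2"
    by (simp add: algebra_simps)
  moreover have "(1 + s)\<^sup>2 > 0" using s by simp
  ultimately have "(c + 8) * u\<^sup>2 \<le> 1"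
    using mult_le_cancel_right_pos[of "(1 + s)\<^sup>2" "(c + 8) * u\<^sup>2" 1] by blast
  then show ?thesis using assms(3) unfolding u_def by (simp add: field_simps)
qed

lemma icub_pow_minus [simp]: "(icub ^^ n) (- a) = - (icub ^^ n) a"
  by (induction n) auto

lemma icub_pow_le_iff [simp]: "(icub ^^ n) a \<le> (icub ^^ n) b \<longleftrightarrow> a \<le> b"
  by (induction n) auto

lemma icub_pow_0 [simp]: "(icub ^^ n) 0 = 0"
  by (induction n) auto

lemma icub_pow_1_bounds: "0 \<le> (icub ^^ n) 1" "(icub ^^ n) 1 \<le> 1"
proof -
  show "0 \<le> (icub ^^ n) 1" using icub_pow_le_iff[of n 0 1] by (simp del: icub_pow_le_iff)
  show "(icub ^^ n) 1 \<le> 1"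
  proof (induction n)
    case (Suc n)
    then show ?case using icub_le_iff[of "(icub ^^ n) 1" 1] by (simp del: icub_le_iff)
  qed simp
qed

lemma icub_pow_1_sq_le: "((icub ^^ n) 1)\<^sup>2 \<le> 1 / (8 * n + 1)"
proof (induction n)
  case (Suc n)
  have "(icub ((icub ^^ n) 1))\<^sup>2 \<le> 1 / ((8 * real n + 1) + 8)"
    by (rule icub_sq_le) (use Suc icub_pow_1_bounds in auto)
  then show ?case by (simp add: algebra_simps)
qed auto

lemma icub_pow_abs_le: "\<bar>a\<bar> \<le> 1 \<Longrightarrow> \<bar>(icub ^^ n) a\<bar> \<le> (icub ^^ n) 1"
  using icub_pow_le_iff[of n a 1] icub_pow_le_iff[of n "-1" a] by (auto simp del: icub_pow_le_iff)

lemma icub_pow_1_tendsto: "(\<lambda>n. (icub ^^ n) 1) \<longlonglongrightarrow> 0"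
proof -
  have "(\<lambda>n. sqrt (1 / (8 * real n + 1))) \<longlonglongrightarrow> 0" by real_asymp
  moreover have "(icub ^^ n) 1 \<le> sqrt (1 / (8 * real n + 1))" for n
    using icub_pow_1_sq_le[of n] by (rule real_le_rsqrt)
  ultimately have "\<forall>n. 0 \<le> (icub ^^ n) 1 \<and> (icub ^^ n) 1 \<le> sqrt (1 / (8 * real n + 1))"
    and "(\<lambda>n. sqrt (1 / (8 * real n + 1))) \<longlonglongrightarrow> 0"
    using icub_pow_1_bounds(1) by blast+
  then show ?thesis
    by (rule_tac tendsto_sandwich[where f = "\<lambda>_. 0" and h = "\<lambda>n. sqrt (1 / (8 * real n + 1))"]) simp_all
qed

lemma cslope_le:
  assumes "\<bar>a\<bar> \<le> e" "\<bar>b\<bar> \<le> e"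
  shows "cslope a b \<le> 1 + 54 * e\<^sup>2"
proof -
  have "a\<^sup>2 \<le> e\<^sup>2" "b\<^sup>2 \<le> e\<^sup>2"
    using assms by (auto intro: abs_le_square_iff[THEN iffD1])
  moreover have "a * b \<le> e * e" 
    using assms abs_ge_self[of "a * b"] mult_mono[of "\<bar>a\<bar>" e "\<bar>b\<bar>" e] by (simp add: abs_mult)
  ultimately show ?thesis unfolding cslope_def by (simp add: power2_eq_square)
qed

text \<open>The difference quotient of step \<open>n + 1\<close> is at most 1 + 54/(8n + 9) \<le> 1
  + 7/(n + 1) \<le> ((n + 2)/(n + 1))^7, and these bounds telescope. The exponent 7 is 54/8 rounded
  up.\<close>

lemma icub_pow_diff_ge:
  assumes "-1 \<le> a" "a \<le> b" "b \<le> 1"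
  shows "(icub ^^ n) b - (icub ^^ n) a \<ge> (b - a) / (n + 1) ^ 7"
proof (induction n)
  case (Suc n)
  define A where "A = (icub ^^ n) a"
  define B where "B = (icub ^^ n) b"
  have AB: "\<bar>icub A\<bar> \<le> (icub ^^ Suc n) 1" "\<bar>icub B\<bar> \<le> (icub ^^ Suc n) 1"
    unfolding A_def B_def
    using icub_pow_abs_le[of a "Suc n"] icub_pow_abs_le[of b "Suc n"] assms by auto
  have "cslope (icub A) (icub B) \<le> 1 + 54 * ((icub ^^ Suc n) 1)\<^sup>2"
    by (rule cslope_le[OF AB])
  also have "\<dots> \<le> 1 + 54 * (1 / (8 * real (Suc n) + 1))"
    using icub_pow_1_sq_le[of "Suc n"] by (intro add_left_mono mult_left_mono) auto
  also have "\<dots> \<le> 1 + of_nat 7 * (1 / (n + 1))"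
    by (simp add: field_simps)
  also have "\<dots> \<le> (1 + 1 / (n + 1)) ^ 7"
    by (rule Bernoulli_inequality) (auto simp: field_simps)
  also have "\<dots> = ((n + 2) / (n + 1)) ^ 7"
    by (simp add: field_simps)
  finally have S: "cslope (icub A) (icub B) \<le> ((n + 2) / (n + 1)) ^ 7" .
  have "(b - a) / (real (Suc n) + 1) ^ 7 = ((b - a) / (n + 1) ^ 7) / ((n + 2) / (n + 1)) ^ 7"
    by (simp add: field_simps power_divide)
  also have "\<dots> \<le> (B - A) / ((n + 2) / (n + 1)) ^ 7"
    using Suc unfolding A_def B_def by (intro divide_right_mono) auto
  also have "\<dots> \<le> (B - A) / cslope (icub A) (icub B)"
    using S cslope_ge_1[of "icub A" "icub B"] assms unfolding A_def B_def
    by (intro divide_left_mono mult_pos_pos) (auto simp del: zero_less_power)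
  also have "\<dots> = icub B - icub A" by (rule icub_diff[symmetric])
  finally show ?case unfolding A_def B_def by simp
qed auto

lemma icub_third_ge: "u \<ge> 1/3 \<Longrightarrow> icub u \<ge> 1/6"
proof -
  assume "u \<ge> 1/3"
  then have "icub (cub (1/6)) \<le> icub u"
    unfolding icub_le_iff by (simp add: cub_def power3_eq_cube)
  then show ?thesis by simp
qed

lemma icub_third_diff_le:
  assumes "u \<ge> 1/3" "u \<le> w"
  shows "icub w - icub u \<le> (w - u) / 2"
proof -
  have "icub u \<ge> 1/6" "icub w \<ge> 1/6" using icub_third_ge assms by auto
  then have "icub u * icub u \<ge> 1/6 * (1/6)" "icub u * icub w \<ge> 1/6 * (1/6)"
    "icub w * icub w \<ge> 1/6 * (1/6)"
    by (intro mult_mono; simp)+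
  then have "cslope (icub u) (icub w) \<ge> 2"
    unfolding cslope_def by (auto simp: power2_eq_square)
  then show ?thesis using assms unfolding icub_diff by (intro divide_left_mono) auto
qed

lemma icub_diff_le: "a \<le> b \<Longrightarrow> icub b - icub a \<le> b - a"
  using cslope_ge_1[of "icub a" "icub b"] divide_left_mono[of 1 "cslope (icub a) (icub b)" "b - a"]
  unfolding icub_diff by simp

text \<open>Along the backward orbit towards the fixed point the interval \<open>[u, w]\<close> shrinks at least as
  fast as the adjacent fundamental domain \<open>[icub u, u]\<close>, and the fundamental domains telescope.\<close>

lemma icub_pow_diff_le_fundamental:
  assumes "0 < u" "u \<le> w"
  shows "(icub ^^ t) w - (icub ^^ t) u
    \<le> (w - u) / (u - icub u) * ((icub ^^ t) u - (icub ^^ Suc t) u)"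
proof (induction t)
  case 0
  have "icub u < u"
    using assms cub_icub[of u] icub_less_iff[of 0 u] unfolding cub_def by (smt (verit) icub_0 zero_less_power)
  then show ?case by simp
next
  case (Suc t)
  define U where "U = (icub ^^ t) u"
  define W where "W = (icub ^^ t) w"
  have U0: "0 \<le> U" using icub_pow_le_iff[of t 0 u] assms by (simp add: U_def del: icub_pow_le_iff)
  have UW: "U \<le> W" using assms by (simp add: U_def W_def)
  have o: "0 \<le> icub (icub U)" "icub (icub U) \<le> icub U" "icub U \<le> icub W"
    using U0 UW icub_le[of "icub U"] icub_le_iff[of 0 U] icub_le_iff[of 0 "icub U"]
    unfolding icub_0 by simp_all
  \<comment> \<open>\<open>[icub U, U]\<close> lies closer to the neutral point than
    \<open>[U, W]\<close>, and on the nonnegative side the difference quotient of \<open>cub\<close>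
    increases in both arguments.\<close>
  have S: "cslope (icub (icub U)) (icub U) \<le> cslope (icub U) (icub W)"
    unfolding cslope_def power2_eq_square using o
    by (intro add_left_mono mult_left_mono add_mono mult_mono) linarith+
  have "icub W - icub U = (W - U) / cslope (icub U) (icub W)" by (rule icub_diff)
  also have "\<dots> \<le> (W - U) / cslope (icub (icub U)) (icub U)"
    using S cslope_ge_1[of "icub (icub U)" "icub U"] UW
    by (intro divide_left_mono mult_pos_pos) auto
  also have "\<dots> \<le> ((w - u) / (u - icub u) * (U - icub U)) / cslope (icub (icub U)) (icub U)"
    using Suc cslope_ge_1[of "icub (icub U)" "icub U"] unfolding U_def W_def
    by (intro divide_right_mono) auto
  also have "\<dots> = (w - u) / (u - icub u) * (icub U - icub (icub U))"
    unfolding icub_diff[of U "icub U"] by simp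
  finally show ?case unfolding U_def W_def by simp
qed

text \<open>The bound is uniform in \<open>m\<close> because the fundamental domains sum to at most
  \<open>u\<close>. From \<open>u \<ge> 1/3\<close> follows v = icub u \<ge> 1/6, so u = v (1 + 18
  v^2) \<ge> (3/2) v: the first fundamental domain has at least a third of the length
  \<open>u\<close>, whence the factor 3.\<close>

lemma icub_pow_diff_sum_le:
  assumes "1/3 \<le> u" "u \<le> w"
  shows "(\<Sum>t\<le>m. (icub ^^ t) w - (icub ^^ t) u) \<le> 3 * (w - u)"
proof -
  define v where "v = icub u"
  have v: "v \<ge> 1/6" unfolding v_def using assms by (intro icub_third_ge)
  have uv: "u = v + 18 * v ^ 3" using cub_icub[of u] unfolding cub_def v_def by simp
  have "v * v \<ge> 1/6 * (1/6)" using v by (intro mult_mono) auto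
  then have "v * 1 \<le> v * (36 * (v * v))" using v by (intro mult_left_mono) auto
  then have le: "u \<le> 3 * (u - v)" unfolding uv by (simp add: power3_eq_cube)
  have "v > 0" using v by auto
  then have pos: "u - v > 0" unfolding uv by simp
  have "(\<Sum>t\<le>m. (icub ^^ t) w - (icub ^^ t) u)
      \<le> (\<Sum>t\<le>m. (w - u) / (u - v) * ((icub ^^ t) u - (icub ^^ Suc t) u))"
    unfolding v_def using assms by (intro sum_mono icub_pow_diff_le_fundamental) auto
  also have "\<dots> = (w - u) / (u - v) * (u - (icub ^^ Suc m) u)"
    unfolding sum_distrib_left[symmetric] sum_telescope[of "\<lambda>t. (icub ^^ t) u"] by simp
  also have "\<dots> \<le> (w - u) / (u - v) * u"
    using assms pos icub_pow_le_iff[of "Suc m" 0 u]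
    by (intro mult_left_mono divide_nonneg_pos) (auto simp del: icub_pow_le_iff funpow.simps)
  also have "\<dots> \<le> (w - u) / (u - v) * (3 * (u - v))"
    using le assms pos by (intro mult_left_mono divide_nonneg_pos) auto
  also have "\<dots> = 3 * (w - u)" using pos by (simp add: field_simps)
  finally show ?thesis .
qed

section \<open>Inverse branches, cylinders and bounded distortion\<close>

datatype sym = Lf | Md | Rt

lemma UNIV_sym: "UNIV = {Lf, Md, Rt}"
  by (auto intro: sym.exhaust)

instance sym :: finite
  by standard (simp add: UNIV_sym)

definition xi :: "sym \<Rightarrow> real" where
  "xi j = (case j of Lf \<Rightarrow> 0 | Md \<Rightarrow> 1/2 | Rt \<Rightarrow> 1)"

definition sc :: "sym \<Rightarrow> real" where
  "sc j = (case j of Lf \<Rightarrow> 1 | Md \<Rightarrow> 2 | Rt \<Rightarrow> 1)"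

text \<open>Extended to the whole line, the inverse branch at the fixed point \<open>xi j\<close> is conjugate to \<open>icub\<close> by an
  affine map; for the middle branch this uses \<open>72 = 18 * 2\<^sup>2\<close>.\<close>

definition br :: "sym \<Rightarrow> real \<Rightarrow> real" where
  "br j x = xi j + icub (sc j * (x - xi j)) / sc j"

lemma sc_bounds: "1 \<le> sc j" "sc j \<le> 2" "0 < sc j" "sc j \<noteq> 0"
  by (auto simp: sc_def split: sym.splits)

lemma br_less_iff [simp]: "br j x < br j y \<longleftrightarrow> x < y"
  using sc_bounds[of j] unfolding br_def by (simp add: divide_less_cancel)

lemma br_le_iff [simp]: "br j x \<le> br j y \<longleftrightarrow> x \<le> y"
  by (meson br_less_iff linorder_not_le)

lemma br_ends:
  "br Lf 0 = 0" "br Lf 1 = 1/3" "br Md 0 = 1/3" "br Md 1 = 2/3" "br Rt 0 = 2/3" "br Rt 1 = 1"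
  using icub_minus[of 1] by (simp_all add: br_def xi_def sc_def del: icub_minus)

lemma br_01: "0 \<le> br j 0" "br j 1 \<le> 1"
  by (cases j; simp add: br_ends)+

lemma br_neq_separated: "j \<noteq> k \<Longrightarrow> br j 1 \<le> br k 0 \<or> br k 1 \<le> br j 0"
  by (cases j; cases k; simp add: br_ends)

lemma br_surj: "\<exists>x. br j x = y"
proof
  show "br j (xi j + cub (sc j * (y - xi j)) / sc j) = y"
    using sc_bounds[of j] by (simp add: br_def)
qed

definition brslope :: "sym \<Rightarrow> real \<Rightarrow> real \<Rightarrow> real" where
  "brslope j x y = cslope (icub (sc j * (x - xi j))) (icub (sc j * (y - xi j)))"

lemma brslope_ge_1: "brslope j x y \<ge> 1"
  unfolding brslope_def by (rule cslope_ge_1)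

lemma br_diff: "br j y - br j x = (y - x) / brslope j x y"
proof -
  have "br j y - br j x = (icub (sc j * (y - xi j)) - icub (sc j * (x - xi j))) / sc j"
    unfolding br_def by (simp add: diff_divide_distrib)
  also have "\<dots> = (sc j * (y - xi j) - sc j * (x - xi j)) / brslope j x y / sc j"
    unfolding icub_diff brslope_def ..
  also have "sc j * (y - xi j) - sc j * (x - xi j) = sc j * (y - x)"
    by (simp add: algebra_simps)
  also have "sc j * (y - x) / brslope j x y / sc j = (y - x) / brslope j x y"
    using sc_bounds(4)[of j] by simp
  finally show ?thesis .
qed

lemma cslope_diff_le:
  assumes "{p, q, p', q'} \<subseteq> {A..B}" "\<bar>A\<bar> \<le> 1/3" "\<bar>B\<bar> \<le> 1/3"
  shows "cslope p q - cslope p' q' \<le> 36 * (B - A)"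
proof -
  define d where "d = 1/3 * (B - A)"
  have le: "a * (x - y) \<le> d" if "x \<in> {A..B}" "y \<in> {A..B}" "a \<in> {A..B}" for a x y
  proof -
    have "a * (x - y) \<le> \<bar>a\<bar> * \<bar>x - y\<bar>" by (metis abs_ge_self abs_mult)
    also have "\<dots> \<le> d" unfolding d_def using that assms by (intro mult_mono) auto
    finally show ?thesis .
  qed
  have "cslope p q - cslope p' q' = 18 * (p * (p - p') + p' * (p - p') + q * (p - p') + p' * (q - q')
    + q * (q - q') + q' * (q - q'))"
    unfolding cslope_def by (simp add: power2_eq_square algebra_simps)
  also have "\<dots> \<le> 18 * (d + d + d + d + d + d)"
    using assms(1) by (intro mult_left_mono add_mono le) auto
  also have "\<dots> = 36 * (B - A)" by (simp add: d_def field_simps)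
  finally show ?thesis .
qed

lemma abs_sc_xi_le: "x \<in> {0..1} \<Longrightarrow> \<bar>sc j * (x - xi j)\<bar> \<le> 1"
  by (auto simp: sc_def xi_def abs_if split: sym.splits)

lemma abs_icub_le: "\<bar>u\<bar> \<le> 1 \<Longrightarrow> \<bar>icub u\<bar> \<le> 1/3"
  using icub_pow_abs_le[of u 1] by simp

text \<open>Difference quotients are at least 1, so an additive Lipschitz estimate becomes a
  multiplicative one. The constant is 72 = 36 * 2, with 36 from \<open>cslope_diff_le\<close> and 2
  the largest value of \<open>sc\<close>.\<close>

lemma brslope_le_exp:
  assumes "{x, y, x', y'} \<subseteq> {a..b}" "{a..b} \<subseteq> {0..1}"
  shows "brslope j x y \<le> exp (72 * (br j b - br j a)) * brslope j x' y'"
proof -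
  define u where "u z = icub (sc j * (z - xi j))" for z
  have ab: "a \<in> {0..1}" "b \<in> {0..1}" "a \<le> b" using assms by auto
  have mono: "u z \<le> u z'" if "z \<le> z'" for z z'
    using that sc_bounds[of j] unfolding u_def by auto
  have "brslope j x y - brslope j x' y' \<le> 36 * (u b - u a)"
    unfolding brslope_def u_def[symmetric]
  proof (rule cslope_diff_le)
    show "{u x, u y, u x', u y'} \<subseteq> {u a..u b}" using assms(1) mono by auto
    show "\<bar>u a\<bar> \<le> 1/3" "\<bar>u b\<bar> \<le> 1/3"
      unfolding u_def using abs_icub_le[OF abs_sc_xi_le] ab by blast+
  qed
  also have "u b - u a = sc j * (br j b - br j a)"
    unfolding u_def br_def using sc_bounds[of j] by (simp add: field_simps)
  also have "36 * \<dots> \<le> 36 * (2 * (br j b - br j a))"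
    using sc_bounds[of j] ab by (intro mult_left_mono mult_right_mono) auto
  finally have "brslope j x y \<le> brslope j x' y' + 72 * (br j b - br j a)" by simp
  also have "\<dots> \<le> brslope j x' y' * (1 + 72 * (br j b - br j a))"
    using mult_right_mono[OF brslope_ge_1[of j x' y'], of "72 * (br j b - br j a)"] ab
    by (simp add: algebra_simps)
  also have "\<dots> \<le> brslope j x' y' * exp (72 * (br j b - br j a))"
    using brslope_ge_1[of j x' y'] by (intro mult_left_mono exp_ge_add_one_self) auto
  finally show ?thesis by (simp add: mult.commute)
qed

lemma brslope_le_7: "x \<in> {0..1} \<Longrightarrow> y \<in> {0..1} \<Longrightarrow> brslope j x y \<le> 7"
  unfolding brslope_def
  using cslope_le[OF abs_icub_le[OF abs_sc_xi_le[of x j]] abs_icub_le[OF abs_sc_xi_le[of y j]]]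
  by (simp add: power2_eq_square)

section \<open>Composed inverse branches, cylinder lengths and distortion\<close>

primrec psi :: "sym list \<Rightarrow> real \<Rightarrow> real" where
  "psi [] x = x"
| "psi (j # w) x = br j (psi w x)"

lemma psi_append [simp]: "psi (u @ v) x = psi u (psi v x)"
  by (induction u) auto

lemma psi_less_iff [simp]: "psi w x < psi w y \<longleftrightarrow> x < y"
  by (induction w) auto

lemma psi_le_iff [simp]: "psi w x \<le> psi w y \<longleftrightarrow> x \<le> y"
  by (induction w) auto

lemma psi_inj [simp]: "psi w x = psi w y \<longleftrightarrow> x = y"
  by (metis linorder_neq_iff psi_less_iff)

lemma psi_surj: "\<exists>x. psi w x = y"
proof (induction w arbitrary: y)
  case (Cons j w)
  then show ?case using br_surj[of j y] by (metis psi.simps(2))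
qed auto

lemma psi_01: "0 \<le> psi w 0" "psi w 1 \<le> 1"
proof (induction w)
  case (Cons j w)
  { case 1 then show ?case using Cons(1) br_01(1)[of j] br_le_iff[of j 0 "psi w 0"]
    by (simp del: br_le_iff) }
  { case 2 then show ?case using Cons(2) br_01(2)[of j] br_le_iff[of j "psi w 1" 1]
    by (simp del: br_le_iff) }
qed auto

lemma psi_in_01: "x \<in> {0..1} \<Longrightarrow> psi w x \<in> {0..1}"
  using psi_01[of w] psi_le_iff[of w 0 x] psi_le_iff[of w x 1] by (auto simp del: psi_le_iff)

definition clen :: "sym list \<Rightarrow> real" where
  "clen w = psi w 1 - psi w 0"

lemma clen_pos [simp]: "clen w > 0" and clen_nonneg [simp]: "clen w \<ge> 0"
  unfolding clen_def by auto

primrec dist_sum :: "sym list \<Rightarrow> real" where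
  "dist_sum [] = 0"
| "dist_sum (j # w) = clen (j # w) + dist_sum w"

text \<open>Working with difference quotients instead of derivatives, every letter of the word costs a factor
  \<open>exp (72 * d)\<close>, where \<open>d\<close> is the length of the cylinder of the suffix starting at that letter.\<close>

lemma distortion:
  assumes "{x, y, x', y'} \<subseteq> {0..1}" "x \<le> y" "x' \<le> y'"
  shows "(psi w y - psi w x) * (y' - x')
    \<le> exp (72 * dist_sum w) * ((psi w y' - psi w x') * (y - x))"
proof (induction w)
  case (Cons j w)
  define X where "X = psi w x"
  define Y where "Y = psi w y"
  define X' where "X' = psi w x'"
  define Y' where "Y' = psi w y'"
  have sub: "{X, Y, X', Y'} \<subseteq> {psi w 0..psi w 1}"
    using assms unfolding X_def Y_def X'_def Y'_def by auto
  have E: "brslope j X' Y' \<le> exp (72 * clen (j # w)) * brslope j X Y"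
    unfolding clen_def psi.simps
    by (rule brslope_le_exp) (use sub psi_01[of w] in auto)
  have pos: "brslope j X Y > 0" "brslope j X' Y' > 0"
    using brslope_ge_1[of j X Y] brslope_ge_1[of j X' Y'] by auto
  have "(br j Y - br j X) * (y' - x') = (Y - X) * (y' - x') / brslope j X Y"
    unfolding br_diff by simp
  also have "\<dots> \<le> exp (72 * dist_sum w) * ((Y' - X') * (y - x)) / brslope j X Y"
    using Cons pos unfolding X_def Y_def X'_def Y'_def by (intro divide_right_mono) auto
  also have "\<dots> \<le> exp (72 * dist_sum w) * ((Y' - X') * (y - x))
      / (brslope j X' Y' / exp (72 * clen (j # w)))"
  proof (intro divide_left_mono)
    show "brslope j X' Y' / exp (72 * clen (j # w)) \<le> brslope j X Y"
      using E by (simp add: field_simps)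
    show "0 \<le> exp (72 * dist_sum w) * ((Y' - X') * (y - x))"
      using assms unfolding X'_def Y'_def by simp
  qed (use pos in simp)
  also have "\<dots> = exp (72 * dist_sum (j # w)) * ((br j Y' - br j X') * (y - x))"
    unfolding br_diff[of j Y' X'] by (simp add: exp_add distrib_left mult_ac)
  finally show ?case unfolding X_def Y_def X'_def Y'_def by simp
qed auto

lemma psi_diff_le:
  assumes "0 \<le> x" "x \<le> y" "y \<le> 1"
  shows "psi w y - psi w x \<le> exp (72 * dist_sum w) * clen w * (y - x)"
  using distortion[of x y 0 1 w] assms by (simp add: clen_def mult_ac)

lemma psi_diff_ge:
  assumes "0 \<le> x" "x \<le> y" "y \<le> 1"
  shows "clen w * (y - x) \<le> exp (72 * dist_sum w) * (psi w y - psi w x)"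
  using distortion[of 0 1 x y w] assms by (simp add: clen_def mult_ac)

lemma psi_replicate:
  "psi (replicate n j) x = xi j + (icub ^^ n) (sc j * (x - xi j)) / sc j"
  using sc_bounds[of j] by (induction n) (auto simp: br_def)

lemma psi_replicate_diff:
  "psi (replicate n j) y - psi (replicate n j) x
    = ((icub ^^ n) (sc j * (y - xi j)) - (icub ^^ n) (sc j * (x - xi j))) / sc j"
  unfolding psi_replicate by (simp add: diff_divide_distrib)

lemma psi_replicate_near_xi:
  assumes "x \<in> {0..1}"
  shows "\<bar>psi (replicate n j) x - xi j\<bar> \<le> (icub ^^ n) 1"
proof -
  have "\<bar>(icub ^^ n) (sc j * (x - xi j))\<bar> / sc j \<le> (icub ^^ n) 1 / 1"
    using sc_bounds[of j] icub_pow_abs_le[OF abs_sc_xi_le[OF assms, of j], of n] icub_pow_1_bounds[of n]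
    by (intro frac_le) auto
  then show ?thesis using sc_bounds[of j] unfolding psi_replicate by (simp add: abs_divide)
qed

lemma psi_replicate_diff_ge:
  assumes "0 \<le> x" "x \<le> y" "y \<le> 1"
  shows "psi (replicate n j) y - psi (replicate n j) x \<ge> (y - x) / (n + 1) ^ 7"
proof -
  have "(sc j * (y - xi j) - sc j * (x - xi j)) / (n + 1) ^ 7
    \<le> (icub ^^ n) (sc j * (y - xi j)) - (icub ^^ n) (sc j * (x - xi j))"
    using abs_sc_xi_le[of x j] abs_sc_xi_le[of y j] assms sc_bounds[of j]
    by (intro icub_pow_diff_ge) auto
  then have "(sc j * (y - xi j) - sc j * (x - xi j)) / (n + 1) ^ 7 / sc j
    \<le> psi (replicate n j) y - psi (replicate n j) x"
    unfolding psi_replicate_diff using sc_bounds[of j] by (intro divide_right_mono) auto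
  also have "(sc j * (y - xi j) - sc j * (x - xi j)) / (n + 1) ^ 7 / sc j = (y - x) / (n + 1) ^ 7"
    using sc_bounds[of j] by (simp add: field_simps)
  finally show ?thesis .
qed

text \<open>In the coordinate centred at \<open>xi j\<close> every other branch lies on one side at
  distance at least 1/3; for \<open>Md\<close> the half width 1/6 of its branch is doubled by
  \<open>sc\<close>. Since \<open>icub\<close> is odd, the sign \<open>s\<close> reduces both sides
  to the positive one.\<close>

lemma sc_xi_away:
  assumes "k \<noteq> j"
  obtains s where "s \<in> {1, -1}" "\<And>x. x \<in> {0..1} \<Longrightarrow> s * (sc j * (br k x - xi j)) \<ge> 1/3"
proof -
  have in_k: "br k x \<in> {br k 0..br k 1}" if "x \<in> {0..1}" for x using that by simp
  show ?thesis
  proof (cases "xi j \<le> xi k")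
    case True
    have "1 * (sc j * (br k x - xi j)) \<ge> 1/3" if "x \<in> {0..1}" for x
      using in_k[OF that] True assms
      by (cases j; cases k) (auto simp: xi_def sc_def br_ends simp del: br_le_iff)
    then show ?thesis using that[of 1] by blast
  next
    case False
    have "-1 * (sc j * (br k x - xi j)) \<ge> 1/3" if "x \<in> {0..1}" for x
      using in_k[OF that] False assms
      by (cases j; cases k) (auto simp: xi_def sc_def br_ends simp del: br_le_iff)
    then show ?thesis using that[of "-1"] by blast
  qed
qed

text \<open>The branch \<open>k\<close> is applied before the run and puts everything at distance at
  least 1/3 from \<open>xi j\<close>, where the summation and halving estimates for
  \<open>icub\<close> hold. Both bounds are uniform in the run length, which lets blocks behave as
  in a uniformly expanding system.\<close>

lemma run_away_from_fixed_point:
  assumes "k \<noteq> j"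
  shows clen_run_sum: "(\<Sum>t\<le>m. clen (replicate t j @ k # v)) \<le> 3 * clen v"
    and clen_run_half: "clen (replicate (Suc m) j @ k # v) \<le> clen v / 2"
proof -
  obtain s where s: "s \<in> {1, -1}" "\<And>x. x \<in> {0..1} \<Longrightarrow> s * (sc j * (br k x - xi j)) \<ge> 1/3"
    using sc_xi_away[OF assms] by blast
  define h where "h x = s * (sc j * (br k (psi v x) - xi j))" for x
  \<comment> \<open>A reflection swaps the end points; \<open>p\<close> is the one whose image is
    nearer to \<open>xi j\<close>.\<close>
  define p where "p = (if s = 1 then 0 else 1 :: real)"
  have s01: "s = 1 \<or> s = -1" using s by auto
  have h3: "h p \<ge> 1/3" unfolding h_def p_def using s(2) psi_in_01[of _ v] by auto
  have hle: "h p \<le> h (1 - p)"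
    using s01 sc_bounds[of j] by (auto simp: h_def p_def)
  have len: "clen (replicate t j @ k # v) = ((icub ^^ t) (h (1 - p)) - (icub ^^ t) (h p)) / sc j" for t
  proof -
    define g where "g x = sc j * (br k (psi v x) - xi j)" for x
    have "clen (replicate t j @ k # v) = ((icub ^^ t) (g 1) - (icub ^^ t) (g 0)) / sc j"
      unfolding clen_def psi_append psi_replicate_diff g_def by simp
    moreover have "h = (\<lambda>x. s * g x)" by (simp add: h_def g_def fun_eq_iff)
    ultimately show ?thesis using s01 by (auto simp: p_def)
  qed
  have kv: "clen (k # v) \<le> clen v"
    using divide_left_mono[of 1 "brslope k (psi v 0) (psi v 1)" "clen v"] brslope_ge_1[of k "psi v 0" "psi v 1"]
    unfolding clen_def psi.simps br_diff by simp
  have len0: "(h (1 - p) - h p) / sc j = clen (k # v)" using len[of 0] by simp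
  have "(\<Sum>t\<le>m. clen (replicate t j @ k # v))
      = (\<Sum>t\<le>m. (icub ^^ t) (h (1 - p)) - (icub ^^ t) (h p)) / sc j"
    unfolding len by (simp add: sum_divide_distrib)
  also have "\<dots> \<le> 3 * (h (1 - p) - h p) / sc j"
    using icub_pow_diff_sum_le[OF h3 hle] sc_bounds[of j] by (intro divide_right_mono) auto
  also have "\<dots> = 3 * clen (k # v)" unfolding len0[symmetric] by simp
  also have "\<dots> \<le> 3 * clen v" using kv by simp
  finally show "(\<Sum>t\<le>m. clen (replicate t j @ k # v)) \<le> 3 * clen v" .
  have "clen (replicate (Suc m) j @ k # v) \<le> clen (replicate (Suc 0) j @ k # v)"
  proof (induction m)
    case (Suc m)
    have "clen (replicate (Suc (Suc m)) j @ k # v) \<le> clen (replicate (Suc m) j @ k # v)"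
      unfolding len using hle sc_bounds[of j] by (intro divide_right_mono) (auto intro!: icub_diff_le)
    then show ?case using Suc by linarith
  qed simp
  also have "\<dots> = (icub (h (1 - p)) - icub (h p)) / sc j" unfolding len by simp
  also have "\<dots> \<le> (h (1 - p) - h p) / 2 / sc j"
    using icub_third_diff_le[OF h3 hle] sc_bounds[of j] by (intro divide_right_mono) auto
  also have "\<dots> = clen (k # v) / 2" unfolding len0[symmetric] by simp
  also have "\<dots> \<le> clen v / 2" using kv by simp
  finally show "clen (replicate (Suc m) j @ k # v) \<le> clen v / 2" .
qed

section \<open>Free blocks: contraction, distortion, separation\<close>

type_synonym block = "sym \<times> nat \<times> sym"

text \<open>The block \<open>(j, m, k)\<close> stands for the word consisting of \<open>m + 1\<close> letters \<open>j\<close> followed by \<open>k\<close>.\<close>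

definition bword :: "block \<Rightarrow> sym list" where
  "bword b = (case b of (j, m, k) \<Rightarrow> replicate (Suc m) j @ [k])"

abbreviation bwords :: "block list \<Rightarrow> sym list" where
  "bwords bs \<equiv> concat (map bword bs)"

definition blocks :: "nat \<Rightarrow> block set" where
  "blocks N = (SIGMA j:UNIV. {..<N} \<times> (UNIV - {j}))"

lemma in_blocks: "(j, m, k) \<in> blocks N \<longleftrightarrow> m < N \<and> k \<noteq> j"
  by (auto simp: blocks_def)

lemma finite_blocks [simp]: "finite (blocks N)"
  by (simp add: blocks_def)

lemma dist_sum_replicate_append:
  "dist_sum (replicate n j @ v) = (\<Sum>t<n. clen (replicate (Suc t) j @ v)) + dist_sum v"
  by (induction n) (auto simp: replicate_append_same)

lemma clen_bword_append:
  assumes "b \<in> blocks N"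
  shows "clen (bword b @ v) \<le> clen v / 2" "dist_sum (bword b @ v) \<le> 3 * clen v + dist_sum v"
proof -
  obtain j m k where b: "b = (j, m, k)" "k \<noteq> j" using assms by (metis in_blocks prod_cases3)
  show "clen (bword b @ v) \<le> clen v / 2"
    using clen_run_half[OF b(2), of m v] by (simp add: b bword_def)
  have "dist_sum (bword b @ v) = (\<Sum>t<Suc m. clen (replicate (Suc t) j @ k # v)) + clen (k # v) + dist_sum v"
    unfolding b bword_def using dist_sum_replicate_append[of "Suc m" j "k # v"] by simp
  also have "\<dots> = (\<Sum>t\<le>Suc m. clen (replicate t j @ k # v)) + dist_sum v"
    unfolding lessThan_Suc_atMost sum.atMost_Suc_shift by simp
  also have "\<dots> \<le> 3 * clen v + dist_sum v"
    using clen_run_sum[OF b(2), where m="Suc m" and v=v] by linarith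
  finally show "dist_sum (bword b @ v) \<le> 3 * clen v + dist_sum v" .
qed

lemma clen_bwords_le: "set bs \<subseteq> blocks N \<Longrightarrow> clen (bwords bs) \<le> (1/2) ^ length bs"
proof (induction bs)
  case (Cons b bs)
  then show ?case using clen_bword_append(1)[of b N "bwords bs"] by auto
qed (simp add: clen_def)

text \<open>\<open>dist_sum + 6 * clen\<close> cannot increase when a block is put in front: the
  first term gains at most \<open>3 * clen v\<close>, and halving \<open>clen v\<close> takes at
  least as much from the second. The empty word starts at 6.\<close>

lemma dist_sum_bwords_le: "set bs \<subseteq> blocks N \<Longrightarrow> dist_sum (bwords bs) \<le> 6"
proof -
  assume "set bs \<subseteq> blocks N"
  then have "dist_sum (bwords bs) + 6 * clen (bwords bs) \<le> 6"
  proof (induction bs)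
    case (Cons b bs)
    then show ?case using clen_bword_append[of b N "bwords bs"] by auto
  qed (simp add: clen_def)
  then show ?thesis using clen_nonneg[of "bwords bs"] by linarith
qed

text \<open>432 = 72 * 6: the distortion exponent per unit of cylinder length times the bound 6 for
  the total length.\<close>

definition KD :: real where "KD = exp 432"

lemma KD_ge_1: "KD \<ge> 1" unfolding KD_def by simp

lemma bwords_psi_diff:
  assumes "set bs \<subseteq> blocks N" "0 \<le> x" "x \<le> y" "y \<le> 1"
  shows bwords_psi_diff_le: "psi (bwords bs) y - psi (bwords bs) x \<le> KD * clen (bwords bs) * (y - x)"
    and bwords_psi_diff_ge: "clen (bwords bs) * (y - x) \<le> KD * (psi (bwords bs) y - psi (bwords bs) x)"
proof -
  have K: "exp (72 * dist_sum (bwords bs)) \<le> KD"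
    unfolding KD_def using dist_sum_bwords_le[OF assms(1)] by simp
  show "psi (bwords bs) y - psi (bwords bs) x \<le> KD * clen (bwords bs) * (y - x)"
    using assms mult_right_mono[OF K, of "clen (bwords bs) * (y - x)"]
    by (intro order.trans[OF psi_diff_le]) (auto simp: mult_ac)
  show "clen (bwords bs) * (y - x) \<le> KD * (psi (bwords bs) y - psi (bwords bs) x)"
    using assms mult_right_mono[OF K, of "psi (bwords bs) y - psi (bwords bs) x"]
    by (intro order.trans[OF psi_diff_ge]) auto
qed

text \<open>No block word is a proper prefix of another, because the closing letter differs from the
  letter of the run. At the first disagreement the two words enter different branches, whose images
  do not overlap in the interior.\<close>

lemma bword_neq_split:
  assumes "b \<in> blocks N" "b' \<in> blocks N" "b \<noteq> b'"
  obtains c x u y v where "bword b = c @ x # u" "bword b' = c @ y # v" "x \<noteq> y"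
proof -
  have less: "\<exists>c x u y v. replicate (Suc m) j @ [k] = c @ x # u \<and> replicate (Suc m') j @ [k'] = c @ y # v \<and> x \<noteq> y"
    if "m < m'" "k \<noteq> j" for m m' :: nat and j k k' :: sym
  proof -
    have "m' = m + Suc (m' - Suc m)" using that by simp
    then have "replicate (Suc m') j = replicate (Suc m) j @ j # replicate (m' - Suc m) j"
      by (metis add_Suc replicate_Suc replicate_add)
    then show ?thesis using that(2) by (metis append_Cons append_assoc)
  qed
  obtain j m k where b: "b = (j, m, k)" "k \<noteq> j" using assms(1) by (metis in_blocks prod_cases3)
  obtain j' m' k' where b': "b' = (j', m', k')" "k' \<noteq> j'" using assms(2) by (metis in_blocks prod_cases3)
  have "\<exists>c x u y v. bword b = c @ x # u \<and> bword b' = c @ y # v \<and> x \<noteq> y"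
  proof (cases "j = j'")
    case False
    have "bword b = [] @ j # (replicate m j @ [k])" "bword b' = [] @ j' # (replicate m' j' @ [k'])"
      by (simp_all add: b b' bword_def)
    then show ?thesis using False by blast
  next
    case True
    consider "m < m'" | "m' < m" | "m = m'" by linarith
    then show ?thesis
    proof cases
      case 1
      then show ?thesis using less[OF 1 b(2)] True by (simp add: b b' bword_def)
    next
      case 2
      then show ?thesis using less[OF 2 b'(2), of k] True by (simp add: b b' bword_def) metis
    next
      case 3
      then have "k \<noteq> k'" using assms(3) True b b' by simp
      then show ?thesis using 3 True by (auto simp: b b' bword_def simp del: replicate_Suc)
    qed
  qed
  then show ?thesis using that by blast
qed

lemma bwords_separated:
  assumes "length bs = length bs'" "set bs \<subseteq> blocks N" "set bs' \<subseteq> blocks N" "bs \<noteq> bs'"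
  shows "psi (bwords bs) 1 \<le> psi (bwords bs') 0 \<or> psi (bwords bs') 1 \<le> psi (bwords bs) 0"
  using assms
proof (induction bs bs' rule: list_induct2)
  case (Cons b bs b' bs')
  show ?case
  proof (cases "b = b'")
    case True
    then show ?thesis using Cons by auto
  next
    case False
    have "b \<in> blocks N" "b' \<in> blocks N" using Cons.prems by auto
    then obtain c x u y v where s: "bword b = c @ x # u" "bword b' = c @ y # v" "x \<noteq> y"
      using False by (rule bword_neq_split)
    have *: "psi (c @ x # w) 1 \<le> psi (c @ y # w') 0"
      if "br x 1 \<le> br y 0" for x y w w'
    proof -
      have "br x (psi w 1) \<le> br x 1" using psi_01(2)[of w] by simp
      moreover have "br y 0 \<le> br y (psi w' 0)" using psi_01(1)[of w'] by simp
      ultimately show ?thesis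
        using that unfolding psi_append psi.simps psi_le_iff by linarith
    qed
    from br_neq_separated[OF s(3)] show ?thesis
      using *[of x y "u @ bwords bs" "v @ bwords bs'"] *[of y x "v @ bwords bs'" "u @ bwords bs"]
      by (auto simp: s)
  qed
qed simp

lemma clen_split: "clen w = (\<Sum>k\<in>UNIV. clen (w @ [k]))"
  by (simp add: UNIV_sym clen_def br_ends)

text \<open>A cylinder is cut according to where the run that starts after \<open>w\<close> breaks.
  Runs that break in time are blocks; the three that have not broken after \<open>N + 1\<close>
  letters are the remainder.\<close>

lemma clen_blocks_split:
  "clen w = (\<Sum>b\<in>blocks N. clen (w @ bword b)) + (\<Sum>j\<in>UNIV. clen (w @ replicate (Suc N) j))"
proof -
  have sum_blocks: "(\<Sum>b\<in>blocks N. clen (w @ bword b))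
      = (\<Sum>j\<in>UNIV. \<Sum>m<N. \<Sum>k\<in>UNIV - {j}. clen (w @ replicate (Suc m) j @ [k]))"
  proof -
    have "(\<Sum>j\<in>UNIV. \<Sum>p\<in>{..<N} \<times> (UNIV - {j}). clen (w @ bword (j, p)))
        = (\<Sum>(j, p)\<in>blocks N. clen (w @ bword (j, p)))"
      unfolding blocks_def by (rule sum.Sigma) auto
    then show ?thesis
      by (simp add: sum.cartesian_product bword_def case_prod_unfold)
  qed
  have "clen (w @ [j]) = (\<Sum>m<N. \<Sum>k\<in>UNIV - {j}. clen (w @ replicate (Suc m) j @ [k]))
      + clen (w @ replicate (Suc N) j)" for j
  proof (induction N)
    case (Suc N)
    have "clen (w @ replicate (Suc N) j)
        = (\<Sum>k\<in>UNIV. clen (w @ replicate (Suc N) j @ [k]))"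
      using clen_split[of "w @ replicate (Suc N) j"] by simp
    also have "\<dots> = (\<Sum>k\<in>UNIV - {j}. clen (w @ replicate (Suc N) j @ [k]))
        + clen (w @ replicate (Suc (Suc N)) j)"
      by (subst sum.remove[of _ j]) (auto simp: replicate_append_same)
    finally show ?case using Suc by simp
  qed simp
  then have "(\<Sum>j\<in>UNIV. clen (w @ [j])) = (\<Sum>j\<in>UNIV. (\<Sum>m<N. \<Sum>k\<in>UNIV - {j}. clen (w @ replicate (Suc m) j @ [k]))
      + clen (w @ replicate (Suc N) j))" by (intro sum.cong refl)
  then show ?thesis unfolding sum_blocks sum.distrib clen_split[symmetric] .
qed

section \<open>Length retained by block words\<close>

definition blists :: "nat \<Rightarrow> nat \<Rightarrow> block list set" where
  "blists N n = {bs. set bs \<subseteq> blocks N \<and> length bs = n}"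

lemma finite_blists [simp]: "finite (blists N n)"
  unfolding blists_def by (rule finite_lists_length_eq) simp

lemma blistsD: "bs \<in> blists N n \<Longrightarrow> set bs \<subseteq> blocks N" "bs \<in> blists N n \<Longrightarrow> length bs = n"
  by (auto simp: blists_def)

definition Zsum :: "nat \<Rightarrow> nat \<Rightarrow> real" where
  "Zsum N n = (\<Sum>bs\<in>blists N n. clen (bwords bs))"

text \<open>Bounded distortion limits each of the three remaining runs to a proportion
  \<open>2 * KD * (icub ^^ Suc N) 1\<close> of any block cylinder; three of them give the 6. So
  appending one more block keeps at least the fraction \<open>1 - \<kappa>\<close> of the
  length.\<close>

lemma Zsum_ge:
  assumes "6 * KD * (icub ^^ Suc N) 1 \<le> \<kappa>" "\<kappa> \<le> 1"
  shows "Zsum N n \<ge> (1 - \<kappa>) ^ n"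
proof (induction n)
  case 0
  have "blists N 0 = {[]}" by (auto simp: blists_def)
  then show ?case by (simp add: Zsum_def clen_def)
next
  case (Suc n)
  have step: "(\<Sum>b\<in>blocks N. clen (bwords bs @ bword b)) \<ge> (1 - \<kappa>) * clen (bwords bs)"
    if bs: "bs \<in> blists N n" for bs
  proof -
    have "clen (bwords bs @ replicate (Suc N) j) \<le> KD * clen (bwords bs) * (2 * (icub ^^ Suc N) 1)" for j
    proof -
      let ?p = "psi (replicate (Suc N) j)"
      have "clen (bwords bs @ replicate (Suc N) j) \<le> KD * clen (bwords bs) * (?p 1 - ?p 0)"
        unfolding clen_def[of "bwords bs @ replicate (Suc N) j"] psi_append
        using psi_01[of "replicate (Suc N) j"] by (intro bwords_psi_diff_le[OF blistsD(1)[OF bs]]) auto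
      also have "?p 1 - ?p 0 \<le> 2 * (icub ^^ Suc N) 1"
        using psi_replicate_near_xi[of 0 "Suc N" j] psi_replicate_near_xi[of 1 "Suc N" j]
        unfolding abs_le_iff by (simp del: replicate_Suc funpow.simps)
      finally show ?thesis using KD_ge_1 by (simp add: mult_left_mono)
    qed
    then have "(\<Sum>j\<in>UNIV. clen (bwords bs @ replicate (Suc N) j))
        \<le> (\<Sum>j\<in>(UNIV::sym set). KD * clen (bwords bs) * (2 * (icub ^^ Suc N) 1))"
      by (intro sum_mono)
    also have "\<dots> = clen (bwords bs) * (6 * KD * (icub ^^ Suc N) 1)"
      by (simp add: UNIV_sym)
    also have "\<dots> \<le> clen (bwords bs) * \<kappa>" using assms(1) by (intro mult_left_mono) auto
    finally show ?thesis using clen_blocks_split[of "bwords bs" N] by (simp add: algebra_simps)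
  qed
  have eq: "blists N (Suc n) = (\<lambda>(bs, b). bs @ [b]) ` (blists N n \<times> blocks N)"
  proof (intro equalityI subsetI)
    fix l assume l: "l \<in> blists N (Suc n)"
    then have "l \<noteq> []" by (auto simp: blists_def)
    then have "l = butlast l @ [last l]" "set (butlast l) \<subseteq> set l" "last l \<in> set l"
      by (auto dest: in_set_butlastD)
    then show "l \<in> (\<lambda>(bs, b). bs @ [b]) ` (blists N n \<times> blocks N)"
      using l by (intro image_eqI[of _ _ "(butlast l, last l)"]) (auto simp: blists_def)
  qed (auto simp: blists_def)
  have "(1 - \<kappa>) ^ Suc n \<le> (1 - \<kappa>) * Zsum N n"
    using Suc assms(2) by (simp add: mult_left_mono)
  also have "\<dots> = (\<Sum>bs\<in>blists N n. (1 - \<kappa>) * clen (bwords bs))"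
    unfolding Zsum_def by (simp add: sum_distrib_left)
  also have "\<dots> \<le> (\<Sum>bs\<in>blists N n. \<Sum>b\<in>blocks N. clen (bwords bs @ bword b))"
    by (intro sum_mono step)
  also have "\<dots> = Zsum N (Suc n)"
    unfolding Zsum_def eq
    by (subst sum.reindex) (auto simp: inj_on_def sum.cartesian_product intro!: sum.cong)
  finally show ?case .
qed

lemma exists_Zsum_ge:
  assumes "0 < (\<kappa>::real)" "\<kappa> \<le> 1"
  shows "\<exists>N>0. \<forall>n. Zsum N n \<ge> (1 - \<kappa>) ^ n"
proof -
  have "(\<lambda>n. 6 * KD * (icub ^^ n) 1) \<longlonglongrightarrow> 6 * KD * 0"
    by (intro tendsto_intros icub_pow_1_tendsto)
  then have "\<forall>\<^sub>F n in sequentially. 6 * KD * (icub ^^ n) 1 < \<kappa>"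
    using assms by (intro order_tendstoD(2)[where y="6 * KD * 0"]) auto
  then obtain M where "\<And>n. n \<ge> M \<Longrightarrow> 6 * KD * (icub ^^ n) 1 < \<kappa>"
    unfolding eventually_sequentially by blast
  then have "6 * KD * (icub ^^ (Suc (Suc M))) 1 < \<kappa>"
    by (metis Suc_n_not_le_n le_SucI nat_le_linear)
  then show ?thesis using Zsum_ge[of "Suc M" \<kappa>] assms by (intro exI[of _ "Suc M"]) auto
qed

section \<open>Codes with inserted words and their mass distribution\<close>

lemma sum_clen_separated_le:
  assumes S: "S \<subseteq> blists N n" and a: "\<And>w. w \<in> S \<Longrightarrow> a \<le> psi (bwords w) 0"
    and b: "\<And>w. w \<in> S \<Longrightarrow> psi (bwords w) 1 \<le> b" and "a \<le> b"
  shows "(\<Sum>w\<in>S. clen (bwords w)) \<le> b - a"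
proof -
  define I where "I w = {psi (bwords w) 0<..<psi (bwords w) 1}" for w
  have fin: "finite S" using S finite_blists finite_subset by blast
  have disj: "disjoint_family_on I S"
    unfolding disjoint_family_on_def
  proof (intro ballI impI)
    fix w w' assume "w \<in> S" "w' \<in> S" "w \<noteq> w'"
    then have "psi (bwords w) 1 \<le> psi (bwords w') 0 \<or> psi (bwords w') 1 \<le> psi (bwords w) 0"
      using S by (intro bwords_separated[of w w' N]) (auto simp: blists_def)
    then show "I w \<inter> I w' = {}" unfolding I_def by auto
  qed
  have "(\<Sum>w\<in>S. clen (bwords w)) = (\<Sum>w\<in>S. measure lborel (I w))"
    unfolding I_def clen_def by simp
  also have "\<dots> = measure lborel (\<Union>w\<in>S. I w)"
    by (rule measure_finite_Union[symmetric]) (use fin disj in \<open>auto simp: I_def[abs_def]\<close>)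
  also have "\<dots> \<le> measure lborel {a..b}"
  proof (rule measure_mono_fmeasurable)
    show "(\<Union>w\<in>S. I w) \<subseteq> {a..b}"
      unfolding I_def using a b by fastforce
    show "(\<Union>w\<in>S. I w) \<in> sets lborel" using fin by (auto simp: I_def)
    show "{a..b} \<in> fmeasurable lborel" by (intro fmeasurableI) (auto simp: emeasure_lborel_Icc_eq)
  qed
  also have "\<dots> = b - a" using assms(4) by simp
  finally show ?thesis .
qed

text \<open>\<open>\<theta> i\<close> is the price of inserting \<open>r i\<close>: it bounds from
  below both the contraction of the word and the distance of its cylinder from 0 and 1. Neutrality
  of the fixed points enters through \<open>subexp\<close>, which exponentially contracting runs of
  length \<open>i\<^sup>2\<close> would violate.\<close>

locale insertion =
  fixes r :: "nat \<Rightarrow> sym list" and \<theta> :: "nat \<Rightarrow> real"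
  assumes theta_pos: "0 < \<theta> i" and theta_le_1: "\<theta> i \<le> 1"
    and slope: "0 \<le> x \<Longrightarrow> x \<le> y \<Longrightarrow> y \<le> 1 \<Longrightarrow> \<theta> i * (y - x) \<le> psi (r i) y - psi (r i) x"
    and inner: "x \<in> {0..1} \<Longrightarrow> \<theta> i \<le> psi (r i) x \<and> psi (r i) x \<le> 1 - \<theta> i"
    and subexp: "0 < c \<Longrightarrow> c < 1 \<Longrightarrow> (\<lambda>i. c ^ i / \<theta> i) \<longlonglongrightarrow> 0"
begin

definition stage :: "(nat \<Rightarrow> block list) \<Rightarrow> nat \<Rightarrow> sym list" where
  "stage \<omega> i = bwords (\<omega> i) @ r i"

primrec pre :: "(nat \<Rightarrow> block list) \<Rightarrow> nat \<Rightarrow> sym list" where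
  "pre \<omega> 0 = []"
| "pre \<omega> (Suc l) = pre \<omega> l @ stage \<omega> l"

definition pt :: "(nat \<Rightarrow> block list) \<Rightarrow> real" where
  "pt \<omega> = Sup (range (\<lambda>l. psi (pre \<omega> l) 0))"

lemma pre_cong: "(\<And>l. l < i \<Longrightarrow> \<omega> l = \<omega>' l) \<Longrightarrow> pre \<omega> i = pre \<omega>' i"
  by (induction i) (auto simp: stage_def)

lemma psi_pre_mono: "l \<le> m \<Longrightarrow> psi (pre \<omega> l) 0 \<le> psi (pre \<omega> m) 0 \<and> psi (pre \<omega> m) 1 \<le> psi (pre \<omega> l) 1"
proof (induction rule: dec_induct)
  case (step n)
  then show ?case using psi_01[of "stage \<omega> n"] psi_le_iff[of "pre \<omega> n" 0 "psi (stage \<omega> n) 0"]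
      psi_le_iff[of "pre \<omega> n" "psi (stage \<omega> n) 1" 1] by (simp del: psi_le_iff)
qed simp

lemma psi_pre_le: "psi (pre \<omega> l) 0 \<le> psi (pre \<omega> m) 1"
proof -
  have "psi (pre \<omega> l) 0 \<le> psi (pre \<omega> (max l m)) 0" using psi_pre_mono by simp
  also have "\<dots> \<le> psi (pre \<omega> (max l m)) 1" by simp
  also have "\<dots> \<le> psi (pre \<omega> m) 1" using psi_pre_mono by simp
  finally show ?thesis .
qed

lemma pt_bounds: "psi (pre \<omega> l) 0 \<le> pt \<omega>" "pt \<omega> \<le> psi (pre \<omega> l) 1"
proof -
  have "bdd_above (range (\<lambda>l. psi (pre \<omega> l) 0))"
    using psi_pre_le[of \<omega> _ 0] by (auto intro!: bdd_aboveI)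
  then show "psi (pre \<omega> l) 0 \<le> pt \<omega>" unfolding pt_def by (intro cSup_upper) auto
  show "pt \<omega> \<le> psi (pre \<omega> l) 1"
    unfolding pt_def using psi_pre_le by (intro cSup_least) auto
qed

text \<open>The orbit point at the start of stage \<open>l\<close>, found by undoing the first
  \<open>l\<close> stages. The branches are extended to bijections of the line, so the chosen value
  is the only one.\<close>

definition tpt :: "(nat \<Rightarrow> block list) \<Rightarrow> nat \<Rightarrow> real" where
  "tpt \<omega> l = (SOME z. psi (pre \<omega> l) z = pt \<omega>)"

lemma psi_tpt: "psi (pre \<omega> l) (tpt \<omega> l) = pt \<omega>"
  unfolding tpt_def using psi_surj by (rule someI_ex)

lemma tpt_in_01: "tpt \<omega> l \<in> {0..1}"
  using pt_bounds[of \<omega> l] unfolding psi_tpt[of \<omega> l, symmetric] by simp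

lemma tpt_Suc: "tpt \<omega> l = psi (stage \<omega> l) (tpt \<omega> (Suc l))"
  using psi_tpt[of \<omega> l] psi_tpt[of \<omega> "Suc l"] by (metis pre.simps(2) psi_append psi_inj)

text \<open>Concatenations with inserted words need not have bounded distortion as a whole, so the
  estimate is made stage by stage and pays one \<open>KD\<close> for each. Being uniform in
  \<open>x\<close> and \<open>y\<close>, the estimates of the stages multiply.\<close>

lemma psi_pre_diff_ge:
  assumes "\<And>l. \<omega> l \<in> blists N l" "0 \<le> x" "x \<le> y" "y \<le> 1"
  shows "(\<Prod>l<i. clen (bwords (\<omega> l)) * \<theta> l / KD) * (y - x) \<le> psi (pre \<omega> i) y - psi (pre \<omega> i) x"
  using assms(2-4)
proof (induction i arbitrary: x y)
  case (Suc i)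
  define c where "c = clen (bwords (\<omega> i))"
  define X where "X = psi (r i) x"
  define Y where "Y = psi (r i) y"
  have XY: "0 \<le> X" "X \<le> Y" "Y \<le> 1"
    unfolding X_def Y_def using Suc.prems psi_in_01[of x "r i"] psi_in_01[of y "r i"] by auto
  have K: "KD > 0" using KD_ge_1 by simp
  have "c * \<theta> i / KD * (y - x) = c * (\<theta> i * (y - x)) / KD" by simp
  also have "\<dots> \<le> c * (Y - X) / KD"
    using slope[of x y i] Suc.prems K unfolding X_def Y_def c_def
    by (intro divide_right_mono mult_left_mono) auto
  also have "\<dots> \<le> KD * (psi (bwords (\<omega> i)) Y - psi (bwords (\<omega> i)) X) / KD"
    unfolding c_def using K by (intro divide_right_mono bwords_psi_diff_ge[OF blistsD(1)[OF assms(1)]] XY) auto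
  also have "\<dots> = psi (stage \<omega> i) y - psi (stage \<omega> i) x"
    using K unfolding X_def Y_def stage_def by simp
  finally have 1: "c * \<theta> i / KD * (y - x) \<le> psi (stage \<omega> i) y - psi (stage \<omega> i) x" .
  have "(\<Prod>l<Suc i. clen (bwords (\<omega> l)) * \<theta> l / KD) * (y - x)
      = (\<Prod>l<i. clen (bwords (\<omega> l)) * \<theta> l / KD) * (c * \<theta> i / KD * (y - x))"
    by (simp add: c_def)
  also have "\<dots> \<le> (\<Prod>l<i. clen (bwords (\<omega> l)) * \<theta> l / KD) * (psi (stage \<omega> i) y - psi (stage \<omega> i) x)"
    using K theta_pos by (intro mult_left_mono 1 prod_nonneg) (auto intro: less_imp_le)
  also have "\<dots> \<le> psi (pre \<omega> i) (psi (stage \<omega> i) y) - psi (pre \<omega> i) (psi (stage \<omega> i) x)"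
    using Suc.prems psi_in_01[of x "stage \<omega> i"] psi_in_01[of y "stage \<omega> i"] by (intro Suc.IH) auto
  finally show ?case by simp
qed simp

text \<open>The span of the two cylinders consists of the left one, the gap and the right one. By
  \<open>inner\<close> and bounded distortion the two points leave a proportion
  \<open>\<theta> i / KD\<close> of either cylinder between them, and the gap lies between them
  entirely.\<close>

lemma stage_separation:
  assumes wa: "wa \<in> blists N i" and wb: "wb \<in> blists N i" and x: "x \<in> {0..1}" and y: "y \<in> {0..1}"
    and sep: "psi (bwords wa) 1 \<le> psi (bwords wb) 0"
  shows "\<theta> i / KD * (psi (bwords wb) 1 - psi (bwords wa) 0)
    \<le> psi (bwords wb) (psi (r i) y) - psi (bwords wa) (psi (r i) x)"
proof -
  define X where "X = psi (r i) x"
  define Y where "Y = psi (r i) y"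
  have X: "\<theta> i \<le> 1 - X" "0 \<le> X" and Y: "\<theta> i \<le> Y" "Y \<le> 1"
    using inner[OF x, of i] inner[OF y, of i] theta_pos[of i] unfolding X_def Y_def by auto
  have K: "KD > 0" using KD_ge_1 by simp
  define t where "t = \<theta> i / KD"
  have t: "t \<ge> 0" "t \<le> 1"
    using K theta_pos[of i] theta_le_1[of i] KD_ge_1 unfolding t_def by (auto simp: field_simps)
  have "clen (bwords wa) * \<theta> i \<le> clen (bwords wa) * (1 - X)" using X by (intro mult_left_mono) auto
  also have "\<dots> \<le> KD * (psi (bwords wa) 1 - psi (bwords wa) X)"
    using X theta_pos[of i] by (intro bwords_psi_diff_ge[OF blistsD(1)[OF wa]]) auto
  finally have 1: "t * clen (bwords wa) \<le> psi (bwords wa) 1 - psi (bwords wa) X"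
    using K unfolding t_def by (simp add: field_simps)
  have "clen (bwords wb) * \<theta> i \<le> clen (bwords wb) * (Y - 0)" using Y by (intro mult_left_mono) auto
  also have "\<dots> \<le> KD * (psi (bwords wb) Y - psi (bwords wb) 0)"
    using Y theta_pos[of i] by (intro bwords_psi_diff_ge[OF blistsD(1)[OF wb]]) auto
  finally have 2: "t * clen (bwords wb) \<le> psi (bwords wb) Y - psi (bwords wb) 0"
    using K unfolding t_def by (simp add: field_simps)
  have 3: "t * (psi (bwords wb) 0 - psi (bwords wa) 1) \<le> 1 * (psi (bwords wb) 0 - psi (bwords wa) 1)"
    using t sep by (intro mult_right_mono) auto
  show ?thesis using 1 2 3 unfolding t_def[symmetric] clen_def X_def[symmetric] Y_def[symmetric]
    by (simp add: algebra_simps)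
qed

text \<open>Adjacent cylinders touch, but the inserted words keep all coded points a definite proportion away
  from the end points, so the points with extreme \<open>i\<close>-th choice are separated by a definite proportion
  of the length of all cylinders between them.\<close>

lemma cylinder_mass_le:
  assumes E: "\<And>\<omega> l. \<omega> \<in> E \<Longrightarrow> \<omega> l \<in> blists N l" and \<omega>0: "\<omega>0 \<in> E"
    and agree: "\<And>\<omega> l. \<omega> \<in> E \<Longrightarrow> l < i \<Longrightarrow> \<omega> l = \<omega>0 l"
    and differ: "\<exists>\<omega>\<in>E. \<omega> i \<noteq> \<omega>0 i"
    and d: "\<And>\<omega> \<omega>'. \<omega> \<in> E \<Longrightarrow> \<omega>' \<in> E \<Longrightarrow> \<bar>pt \<omega> - pt \<omega>'\<bar> \<le> d"
  shows "(\<Prod>l<i. clen (bwords (\<omega>0 l))) * (\<Sum>w\<in>(\<lambda>\<omega>. \<omega> i) ` E. clen (bwords w)) \<le> (\<Prod>l\<le>i. KD / \<theta> l) * d"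
proof -
  define S where "S = (\<lambda>\<omega>. \<omega> i) ` E"
  define lo where "lo w = psi (bwords w) 0" for w
  have S: "S \<subseteq> blists N i" unfolding S_def using E by auto
  have fin: "finite S" using S finite_blists finite_subset by blast
  have ne: "S \<noteq> {}" unfolding S_def using \<omega>0 by auto
  have sep: "psi (bwords w) 1 \<le> lo w' \<or> psi (bwords w') 1 \<le> lo w" if "w \<in> S" "w' \<in> S" "w \<noteq> w'" for w w'
    unfolding lo_def using that S by (intro bwords_separated[of w w' N]) (auto simp: blists_def)
  have lo_less: "lo w < psi (bwords w) 1" for w unfolding lo_def by simp
  obtain wa where wa: "wa \<in> S" "\<And>w. w \<in> S \<Longrightarrow> lo wa \<le> lo w"
    using fin ne by (metis arg_min_if_finite(1) arg_min_least)
  obtain wb where wb: "wb \<in> S" "\<And>w. w \<in> S \<Longrightarrow> lo w \<le> lo wb"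
    using arg_min_if_finite(1)[OF fin ne, of "\<lambda>w. - lo w"] arg_min_least[OF fin ne, of _ "\<lambda>w. - lo w"]
    by (metis neg_le_iff_le)
  have neq: "wa \<noteq> wb"
  proof
    assume eq: "wa = wb"
    have "w = wa" if "w \<in> S" for w
    proof (rule ccontr)
      assume "w \<noteq> wa"
      then show False
        using sep[OF that wa(1)] lo_less[of w] lo_less[of wa] wa(2)[OF that] wb(2)[OF that, folded eq]
        by linarith
    qed
    moreover obtain \<omega> where "\<omega> \<in> E" "\<omega> i \<noteq> \<omega>0 i" using differ by blast
    moreover have "\<omega> i \<in> S" "\<omega>0 i \<in> S" unfolding S_def using calculation(2) \<omega>0 by blast+
    ultimately show False by metis
  qed
  have ab: "psi (bwords wa) 1 \<le> lo wb"
    using sep[OF wa(1) wb(1) neq] lo_less[of wa] lo_less[of wb] wa(2)[OF wb(1)] by linarith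
  have up: "psi (bwords w) 1 \<le> psi (bwords wb) 1" if "w \<in> S" for w
  proof (cases "w = wb")
    case False
    then show ?thesis
      using sep[OF that wb(1) False] lo_less[of w] lo_less[of wb] wb(2)[OF that] by linarith
  qed simp
  obtain \<omega>a \<omega>b where oa: "\<omega>a \<in> E" "\<omega>a i = wa" and ob: "\<omega>b \<in> E" "\<omega>b i = wb"
    using wa(1) wb(1) unfolding S_def by blast
  have pre: "pre \<omega>a i = pre \<omega>0 i" "pre \<omega>b i = pre \<omega>0 i"
    using agree oa ob by (auto intro!: pre_cong)
  define ua where "ua = psi (bwords wa) (psi (r i) (tpt \<omega>a (Suc i)))"
  define ub where "ub = psi (bwords wb) (psi (r i) (tpt \<omega>b (Suc i)))"
  have pta: "pt \<omega>a = psi (pre \<omega>0 i) ua" "pt \<omega>b = psi (pre \<omega>0 i) ub"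
    using psi_tpt[of \<omega>a "Suc i"] psi_tpt[of \<omega>b "Suc i"] oa ob pre
    by (auto simp: ua_def ub_def stage_def)
  have u01: "ua \<in> {0..1}" "ub \<in> {0..1}"
    unfolding ua_def ub_def by (intro psi_in_01 tpt_in_01)+
  have gap: "\<theta> i / KD * (psi (bwords wb) 1 - lo wa) \<le> ub - ua"
    unfolding ua_def ub_def lo_def
    using S wa(1) wb(1) ab tpt_in_01 by (intro stage_separation[of _ N]) (auto simp: lo_def)
  have K: "KD > 0" using KD_ge_1 by simp
  have "lo wa \<le> lo wb" using wa(2) wb(1) by auto
  then have le: "lo wa \<le> psi (bwords wb) 1" using lo_less[of wb] by linarith
  then have "0 \<le> \<theta> i / KD * (psi (bwords wb) 1 - lo wa)"
    using K theta_pos[of i] by (intro mult_nonneg_nonneg) auto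
  then have uab: "ua \<le> ub" using gap by linarith
  have "(\<Sum>w\<in>S. clen (bwords w)) \<le> psi (bwords wb) 1 - lo wa"
    using S wa(2) up le by (intro sum_clen_separated_le) (auto simp: lo_def)
  also have "\<dots> \<le> KD / \<theta> i * (ub - ua)"
    using gap K theta_pos[of i] by (simp add: field_simps)
  finally have sum: "(\<Sum>w\<in>S. clen (bwords w)) \<le> KD / \<theta> i * (ub - ua)" .
  have "(\<Prod>l<i. clen (bwords (\<omega>0 l)) * \<theta> l / KD) * (ub - ua) \<le> psi (pre \<omega>0 i) ub - psi (pre \<omega>0 i) ua"
    using u01 uab by (intro psi_pre_diff_ge[of _ N] E[OF \<omega>0]) auto
  also have "\<dots> \<le> d" using d[OF ob(1) oa(1)] unfolding pta by linarith
  finally have dd: "(\<Prod>l<i. clen (bwords (\<omega>0 l)) * \<theta> l / KD) * (ub - ua) \<le> d" .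
  have split: "(\<Prod>l<i. clen (bwords (\<omega>0 l)))
      = (\<Prod>l<i. KD / \<theta> l) * (\<Prod>l<i. clen (bwords (\<omega>0 l)) * \<theta> l / KD)"
    using K theta_pos unfolding prod.distrib[symmetric]
    by (intro prod.cong refl) (simp add: less_imp_neq[symmetric])
  have "(\<Prod>l<i. clen (bwords (\<omega>0 l))) * (\<Sum>w\<in>S. clen (bwords w))
      \<le> (\<Prod>l<i. clen (bwords (\<omega>0 l))) * (KD / \<theta> i * (ub - ua))"
    by (intro mult_left_mono sum prod_nonneg) auto
  also have "\<dots> = (\<Prod>l\<le>i. KD / \<theta> l) * ((\<Prod>l<i. clen (bwords (\<omega>0 l)) * \<theta> l / KD) * (ub - ua))"
    unfolding split by (simp add: lessThan_Suc_atMost[symmetric] mult_ac)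
  also have "\<dots> \<le> (\<Prod>l\<le>i. KD / \<theta> l) * d"
    using dd K theta_pos by (intro mult_left_mono prod_nonneg) (auto intro: less_imp_le)
  finally show ?thesis unfolding S_def .
qed

section \<open>Product measure on codes and mass distribution\<close>

definition pmass :: "nat \<Rightarrow> nat \<Rightarrow> block list \<Rightarrow> real" where
  "pmass N i w = clen (bwords w) / Zsum N i"

definition Mst :: "nat \<Rightarrow> nat \<Rightarrow> block list measure" where
  "Mst N i = point_measure (blists N i) (\<lambda>w. ennreal (pmass N i w))"

definition codes :: "nat \<Rightarrow> (nat \<Rightarrow> block list) set" where
  "codes N = {\<omega>. \<forall>i. \<omega> i \<in> blists N i}"

definition Pm :: "nat \<Rightarrow> (nat \<Rightarrow> block list) measure" where
  "Pm N = PiM UNIV (Mst N)"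

lemma space_Pm: "space (Pm N) = codes N"
  by (auto simp: Pm_def Mst_def codes_def space_PiM space_point_measure PiE_def Pi_def)

end

locale weighted_insertion = insertion +
  fixes N :: nat and \<eta> :: real
  assumes Z: "\<And>n. Zsum N n \<ge> \<eta> ^ n" and eta: "1/2 < \<eta>" "\<eta> < 1"
begin

lemma Zsum_pos: "Zsum N n > 0"
  using Z[of n] eta zero_less_power[of \<eta> n] by linarith

lemma pmass_nonneg: "pmass N i w \<ge> 0"
  unfolding pmass_def using Zsum_pos[of i] by (intro divide_nonneg_pos) auto

lemma sum_pmass: "sum (pmass N i) (blists N i) = 1"
  unfolding pmass_def sum_divide_distrib[symmetric] using Zsum_pos[of i] by (simp add: Zsum_def)

lemma sum_pmass_le_1: "S \<subseteq> blists N i \<Longrightarrow> sum (pmass N i) S \<le> 1"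
  using sum_pmass[of i] pmass_nonneg by (metis finite_blists sum_mono2)

lemma pmass_le: "w \<in> blists N i \<Longrightarrow> pmass N i w \<le> (1 / (2 * \<eta>)) ^ i"
proof -
  assume w: "w \<in> blists N i"
  have "pmass N i w \<le> (1/2) ^ i / \<eta> ^ i"
    unfolding pmass_def using Z[of i] Zsum_pos[of i] eta clen_bwords_le[OF blistsD(1)[OF w]] blistsD(2)[OF w]
    by (intro frac_le) auto
  then show ?thesis by (simp add: power_divide power_mult_distrib)
qed

lemma emeasure_Mst: "S \<subseteq> blists N i \<Longrightarrow> emeasure (Mst N i) S = ennreal (sum (pmass N i) S)"
  unfolding Mst_def using pmass_nonneg
  by (subst emeasure_point_measure_finite) (auto simp: sum_ennreal)

lemma prob_space_Mst: "prob_space (Mst N i)"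
proof
  show "emeasure (Mst N i) (space (Mst N i)) = 1"
    using emeasure_Mst[of "blists N i" i] sum_pmass[of i] by (simp add: Mst_def space_point_measure)
qed

sublocale P: product_prob_space "Mst N" UNIV
  using prob_space_Mst
  by (intro product_prob_spaceI)

lemma cylinder:
  assumes "\<omega>0 \<in> codes N" "S \<subseteq> blists N i"
  defines "C \<equiv> {\<omega> \<in> codes N. (\<forall>l<i. \<omega> l = \<omega>0 l) \<and> \<omega> i \<in> S}"
  shows cylinder_sets: "C \<in> sets (Pm N)"
    and cylinder_emeasure: "emeasure (Pm N) C = ennreal ((\<Prod>l<i. pmass N l (\<omega>0 l)) * sum (pmass N i) S)"
proof -
  define X where "X l = (if l < i then {\<omega>0 l} else S)" for l
  have X: "X l \<in> sets (Mst N l)" if "l \<in> {..i}" for l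
    using assms that by (auto simp: X_def Mst_def sets_point_measure codes_def)
  have C: "C = P.emb UNIV {..i} (Pi\<^sub>E {..i} X)"
  proof -
    have "(\<forall>l<i. \<omega> l = \<omega>0 l) \<and> \<omega> i \<in> S \<longleftrightarrow> (\<forall>l\<in>{..i}. \<omega> l \<in> X l)" for \<omega>
      by (auto simp: X_def)
    then show ?thesis
      by (auto simp: C_def prod_emb_def codes_def space_point_measure Mst_def PiE_def Pi_def restrict_def extensional_def)
  qed
  show "C \<in> sets (Pm N)"
    unfolding C Pm_def using X by (intro sets_PiM_I) auto
  have "emeasure (Pm N) C = (\<Prod>l\<in>{..i}. emeasure (Mst N l) (X l))"
    unfolding C Pm_def using X by (intro P.emeasure_PiM_emb) auto
  also have "\<dots> = (\<Prod>l\<in>{..i}. ennreal (sum (pmass N l) (X l)))"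
    using assms by (intro prod.cong refl emeasure_Mst) (auto simp: X_def codes_def)
  also have "\<dots> = ennreal (\<Prod>l\<in>{..i}. sum (pmass N l) (X l))"
    by (intro prod_ennreal sum_nonneg pmass_nonneg)
  also have "(\<Prod>l\<in>{..i}. sum (pmass N l) (X l)) = (\<Prod>l<i. pmass N l (\<omega>0 l)) * sum (pmass N i) S"
    unfolding lessThan_Suc_atMost[symmetric] by (simp add: X_def)
  finally show "emeasure (Pm N) C = ennreal ((\<Prod>l<i. pmass N l (\<omega>0 l)) * sum (pmass N i) S)" .
qed

lemma prod_pmass_le:
  assumes "\<omega>0 \<in> codes N" "S \<subseteq> blists N i"
  shows "(\<Prod>l<i. pmass N l (\<omega>0 l)) * sum (pmass N i) S \<le> (\<Prod>l<i. (1 / (2 * \<eta>)) ^ l)"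
proof -
  have "(\<Prod>l<i. pmass N l (\<omega>0 l)) * sum (pmass N i) S \<le> (\<Prod>l<i. pmass N l (\<omega>0 l)) * 1"
    using sum_pmass_le_1[OF assms(2)] by (intro mult_left_mono prod_nonneg) (auto simp: pmass_nonneg)
  also have "\<dots> \<le> (\<Prod>l<i. (1 / (2 * \<eta>)) ^ l) * 1"
    using assms(1) pmass_nonneg by (intro mult_right_mono prod_mono) (auto simp: codes_def intro: pmass_le)
  finally show ?thesis by simp
qed

lemma small_cylinder:
  assumes "\<epsilon> > 0"
  shows "\<exists>i. (\<Prod>l<i. (1 / (2 * \<eta>)) ^ l) \<le> \<epsilon>"
proof -
  define q where "q = 1 / (2 * \<eta>)"
  have q: "0 < q" "q < 1" unfolding q_def using eta by auto
  obtain n where n: "q ^ n < \<epsilon>" using real_arch_pow_inv[OF assms q(2)] by blast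
  have "(\<Prod>l<Suc n. q ^ l) = (\<Prod>l<n. q ^ l) * q ^ n" by simp
  also have "\<dots> \<le> 1 * q ^ n"
    using q by (intro mult_right_mono prod_le_1) (auto intro: power_le_one)
  finally show ?thesis using n unfolding q_def by (intro exI[of _ "Suc n"]) auto
qed

text \<open>Accumulated loss up to stage \<open>i\<close>: \<open>KD / \<theta> l\<close> is
  geometric, and \<open>\<eta> ^ l\<close> bounds the normalising factor \<open>Zsum N l\<close> of
  the masses from below.\<close>

definition Acon :: "nat \<Rightarrow> real" where
  "Acon i = (\<Prod>l\<le>i. KD / (\<theta> l * \<eta> ^ l))"

lemma KD_theta_eta_ge_1: "KD / (\<theta> l * \<eta> ^ l) \<ge> 1"
proof -
  have "\<theta> l * \<eta> ^ l \<le> 1 * 1"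
    using theta_pos[of l] theta_le_1[of l] eta by (intro mult_mono power_le_one) auto
  then have "\<theta> l * \<eta> ^ l \<le> KD" using KD_ge_1 by simp
  moreover have "0 < \<theta> l * \<eta> ^ l" using theta_pos[of l] eta by simp
  ultimately show ?thesis by simp
qed

lemma prod_pmass_le_dist:
  assumes E: "E \<subseteq> codes N" and \<omega>0: "\<omega>0 \<in> E"
    and agree: "\<And>\<omega> l. \<omega> \<in> E \<Longrightarrow> l < i \<Longrightarrow> \<omega> l = \<omega>0 l"
    and differ: "\<exists>\<omega>\<in>E. \<omega> i \<noteq> \<omega>0 i"
    and d: "\<And>\<omega> \<omega>'. \<omega> \<in> E \<Longrightarrow> \<omega>' \<in> E \<Longrightarrow> \<bar>pt \<omega> - pt \<omega>'\<bar> \<le> d"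
  shows "(\<Prod>l<i. pmass N l (\<omega>0 l)) * sum (pmass N i) ((\<lambda>\<omega>. \<omega> i) ` E) \<le> Acon i * d"
proof -
  define S where "S = (\<lambda>\<omega>. \<omega> i) ` E"
  have d0: "d \<ge> 0" using d[OF \<omega>0 \<omega>0] by simp
  have "(\<Prod>l<i. pmass N l (\<omega>0 l)) * sum (pmass N i) S
      = ((\<Prod>l<i. clen (bwords (\<omega>0 l))) * (\<Sum>w\<in>S. clen (bwords w))) / (\<Prod>l\<le>i. Zsum N l)"
  proof -
    have 1: "sum (pmass N i) S = (\<Sum>w\<in>S. clen (bwords w)) / Zsum N i"
      unfolding pmass_def by (rule sum_divide_distrib[symmetric])
    have 2: "(\<Prod>l<i. pmass N l (\<omega>0 l)) = (\<Prod>l<i. clen (bwords (\<omega>0 l))) / (\<Prod>l<i. Zsum N l)"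
      unfolding pmass_def by (rule prod_dividef)
    show ?thesis
      unfolding 1 2 lessThan_Suc_atMost[symmetric] prod.lessThan_Suc by (rule times_divide_times_eq)
  qed
  also have "\<dots> \<le> ((\<Prod>l\<le>i. KD / \<theta> l) * d) / (\<Prod>l\<le>i. Zsum N l)"
  proof (intro divide_right_mono prod_nonneg ballI)
    show "(\<Prod>l<i. clen (bwords (\<omega>0 l))) * (\<Sum>w\<in>S. clen (bwords w)) \<le> (\<Prod>l\<le>i. KD / \<theta> l) * d"
      unfolding S_def
    proof (rule cylinder_mass_le)
      show "\<omega> l \<in> blists N l" if "\<omega> \<in> E" for \<omega> l using E that by (auto simp: codes_def)
    qed (fact \<omega>0 agree differ d)+
    show "0 \<le> Zsum N l" for l using Zsum_pos[of l] by simp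
  qed
  also have "\<dots> \<le> ((\<Prod>l\<le>i. KD / \<theta> l) * d) / (\<Prod>l\<le>i. \<eta> ^ l)"
  proof (intro divide_left_mono mult_nonneg_nonneg mult_pos_pos prod_pos prod_nonneg d0 ballI)
    show "(\<Prod>l\<le>i. \<eta> ^ l) \<le> (\<Prod>l\<le>i. Zsum N l)"
      using Z eta by (intro prod_mono) auto
    show "0 \<le> KD / \<theta> l" for l
      using KD_ge_1 theta_pos[of l] by (intro divide_nonneg_pos) auto
    show "0 < Zsum N l" "0 < \<eta> ^ l" for l
      using Zsum_pos eta by auto
  qed
  also have "\<dots> = Acon i * d"
    unfolding Acon_def by (simp add: prod_dividef prod.distrib)
  finally show ?thesis unfolding S_def .
qed

text \<open>The choice of \<eta> makes 2^(-\<beta>) equal to \<eta>^4, and (1/\<eta>)^\<beta> costs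
  at most 1/\<eta>, so the mass factor satisfies (1/(2\<eta>))^\<beta> \<le> \<eta>^3. One of these
  three powers pays for the normalisation in \<open>Acon\<close>; the other two beat the
  subexponential \<open>1 / \<theta>\<close>. Hence all but finitely many factors of the product are
  at most 1.\<close>

lemma Acon_bounded:
  assumes \<beta>: "0 < \<beta>" "\<beta> \<le> 1" and eta_eq: "\<eta> = 2 powr (- \<beta> / 4)"
  shows "\<exists>B\<ge>1. \<forall>i. Acon i * (\<Prod>l<i. (1 / (2 * \<eta>)) ^ l) powr \<beta> \<le> B"
proof -
  define q where "q = 1 / (2 * \<eta>)"
  \<comment> \<open>\<open>Acon i\<close> has one factor more than the product of masses: its factor
    \<open>Suc l\<close> is paired with the mass factor \<open>l\<close>, and its factor 0 is split
    off.\<close>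
  define b where "b l = KD / (\<theta> (Suc l) * \<eta> ^ Suc l) * (q ^ l) powr \<beta>" for l
  have q: "0 < q" "q < 1" unfolding q_def using eta by auto
  have b0: "b l > 0" for l
    unfolding b_def using KD_ge_1 theta_pos[of "Suc l"] eta q by simp
  have "q powr \<beta> = 2 powr (- \<beta>) * (1 / \<eta>) powr \<beta>"
    unfolding q_def using eta by (simp add: powr_divide powr_mult powr_minus field_simps)
  also have "2 powr (- \<beta>) = \<eta> ^ 4"
    unfolding eta_eq by (simp add: powr_power)
  also have "(1 / \<eta>) powr \<beta> \<le> (1 / \<eta>) powr 1"
    using eta \<beta> by (intro powr_mono) auto
  finally have "q powr \<beta> \<le> \<eta> ^ 4 * (1 / \<eta>)" using eta by simp
  also have "\<dots> = \<eta> ^ 3" using eta by (simp add: eval_nat_numeral)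
  finally have q\<beta>: "q powr \<beta> \<le> \<eta> ^ 3" .
  have b_le: "b l \<le> KD / \<eta> ^ 3 * ((\<eta>\<^sup>2) ^ Suc l / \<theta> (Suc l))" for l
  proof -
    have "(q ^ l) powr \<beta> = (q powr \<beta>) ^ l"
      using q by (simp add: powr_realpow[symmetric] powr_powr mult.commute)
    also have "\<dots> \<le> (\<eta> ^ 3) ^ l" using q\<beta> by (intro power_mono) auto
    finally have "b l \<le> KD / (\<theta> (Suc l) * \<eta> ^ Suc l) * (\<eta> ^ 3) ^ l"
      unfolding b_def using KD_ge_1 theta_pos[of "Suc l"] eta by (intro mult_left_mono) auto
    also have "\<dots> = KD / \<eta> ^ 3 * ((\<eta>\<^sup>2) ^ Suc l / \<theta> (Suc l))"
      using eta theta_pos[of "Suc l"]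
      by (simp add: field_simps power_mult[symmetric] power_add[symmetric] eval_nat_numeral)
    finally show ?thesis .
  qed
  have "(\<lambda>l. KD / \<eta> ^ 3 * ((\<eta>\<^sup>2) ^ Suc l / \<theta> (Suc l))) \<longlonglongrightarrow> KD / \<eta> ^ 3 * 0"
    using eta by (intro tendsto_mult tendsto_const LIMSEQ_Suc subexp) (auto simp: abs_square_less_1)
  then have "\<forall>\<^sub>F l in sequentially. KD / \<eta> ^ 3 * ((\<eta>\<^sup>2) ^ Suc l / \<theta> (Suc l)) < 1"
    by (intro order_tendstoD(2)) auto
  then obtain L where L: "\<And>l. l \<ge> L \<Longrightarrow> b l \<le> 1"
    unfolding eventually_sequentially using b_le by (meson less_imp_le order.trans)
  define B where "B = KD / \<theta> 0 * (\<Prod>l<L. max 1 (b l))"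
  have prod_b: "(\<Prod>l<i. b l) \<le> (\<Prod>l<L. max 1 (b l))" for i
  proof -
    have "(\<Prod>l<i. b l) \<le> (\<Prod>l<i. if l < L then max 1 (b l) else 1)"
      using b0 L by (intro prod_mono) (auto intro: less_imp_le)
    also have "\<dots> \<le> (\<Prod>l<max i L. if l < L then max 1 (b l) else 1)"
      by (intro prod_mono2) auto
    also have "\<dots> = (\<Prod>l<L. max 1 (b l))"
      by (intro prod.mono_neutral_cong_right) auto
    finally show ?thesis .
  qed
  have "Acon i * (\<Prod>l<i. q ^ l) powr \<beta> = KD / \<theta> 0 * (\<Prod>l<i. b l)" for i
  proof -
    have "(\<Prod>l<i. q ^ l) powr \<beta> = (\<Prod>l<i. (q ^ l) powr \<beta>)"
      using q by (induction i) (auto simp: powr_mult prod_nonneg)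
    then show ?thesis
      unfolding Acon_def lessThan_Suc_atMost[symmetric] prod.lessThan_Suc_shift b_def
      by (simp add: prod.distrib[symmetric])
  qed
  moreover have "KD / \<theta> 0 * (\<Prod>l<i. b l) \<le> B" for i
    unfolding B_def using prod_b KD_ge_1 theta_pos[of 0] by (intro mult_left_mono) auto
  moreover have "B \<ge> 1"
  proof -
    have "1 * 1 \<le> KD / \<theta> 0 * (\<Prod>l<L. max 1 (b l))"
      using KD_theta_eta_ge_1[of 0] by (intro mult_mono prod_ge_1) auto
    then show ?thesis unfolding B_def by simp
  qed
  ultimately show ?thesis unfolding q_def by metis
qed

text \<open>A measurable cylinder set stands in for the codes of points in \<open>U\<close>, whose
  measurability is not known. If these codes first differ at stage \<open>i\<close>, the mass
  \<open>p\<close> obeys both \<open>p \<le> Acon i * diameter U\<close> and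
  \<open>p \<le> Q\<close>; writing p = p^(1-\<beta>) p^\<beta> and using one bound for each factor
  yields the exponent \<open>1 - \<beta>\<close>. A single code says nothing about the diameter, so
  its small cylinder is charged to \<epsilon>.\<close>

lemma set_mass_le:
  assumes \<beta>: "0 < \<beta>" "\<beta> \<le> 1" and B: "B \<ge> 1" "\<And>i. Acon i * (\<Prod>l<i. (1 / (2 * \<eta>)) ^ l) powr \<beta> \<le> B"
    and U: "bounded U" and "\<epsilon> > 0"
  shows "\<exists>C\<in>sets (Pm N). {\<omega>\<in>codes N. pt \<omega> \<in> U} \<subseteq> C \<and>
    emeasure (Pm N) C \<le> ennreal B * hterm (1 - \<beta>) U + ennreal \<epsilon>"
proof -
  define E where "E = {\<omega>\<in>codes N. pt \<omega> \<in> U}"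
  have d: "\<bar>pt \<omega> - pt \<omega>'\<bar> \<le> diameter U" if "\<omega> \<in> E" "\<omega>' \<in> E" for \<omega> \<omega>'
    using diameter_bounded_bound[OF U, of "pt \<omega>" "pt \<omega>'"] that unfolding E_def dist_real_def by auto
  have Ec: "E \<subseteq> codes N" unfolding E_def by auto
  define Cy where "Cy \<omega>0 i S = {\<omega> \<in> codes N. (\<forall>l<i. \<omega> l = \<omega>0 l) \<and> \<omega> i \<in> S}" for \<omega>0 i and S :: "block list set"
  have "\<exists>C\<in>sets (Pm N). E \<subseteq> C \<and> emeasure (Pm N) C \<le> ennreal B * hterm (1 - \<beta>) U + ennreal \<epsilon>"
  proof (cases "\<exists>\<omega>\<in>E. \<exists>\<omega>'\<in>E. \<omega> \<noteq> \<omega>'")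
    case False
    show ?thesis
    proof (cases "E = {}")
      case True
      then show ?thesis by (intro bexI[of _ "{}"]) auto
    next
      case nonempty: False
      then obtain \<omega>0 where "\<omega>0 \<in> E" by auto
      then have 2: "E = {\<omega>0}" using False by auto
      obtain i where i: "(\<Prod>l<i. (1 / (2 * \<eta>)) ^ l) \<le> \<epsilon>" using small_cylinder[OF \<open>\<epsilon> > 0\<close>] by blast
      have w: "\<omega>0 \<in> codes N" using 2 Ec by auto
      then have S: "{\<omega>0 i} \<subseteq> blists N i" by (auto simp: codes_def)
      have "emeasure (Pm N) (Cy \<omega>0 i {\<omega>0 i}) \<le> ennreal \<epsilon>"
        unfolding Cy_def cylinder_emeasure[OF w S]
        using prod_pmass_le[OF w S] i by (intro ennreal_leI) auto
      then have "emeasure (Pm N) (Cy \<omega>0 i {\<omega>0 i}) \<le> ennreal B * hterm (1 - \<beta>) U + ennreal \<epsilon>"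
        by (rule order.trans) simp
      moreover have "E \<subseteq> Cy \<omega>0 i {\<omega>0 i}" using w 2 by (auto simp: Cy_def)
      ultimately show ?thesis using cylinder_sets[OF w S] unfolding Cy_def by blast
    qed
  next
    case 3: True
    define i where "i = (LEAST i. \<exists>\<omega>\<in>E. \<exists>\<omega>'\<in>E. \<omega> i \<noteq> \<omega>' i)"
    have "\<exists>i. \<exists>\<omega>\<in>E. \<exists>\<omega>'\<in>E. \<omega> i \<noteq> \<omega>' i" using 3 by (metis ext)
    then have "\<exists>\<omega>\<in>E. \<exists>\<omega>'\<in>E. \<omega> i \<noteq> \<omega>' i" unfolding i_def by (rule LeastI_ex)
    then obtain \<omega>0 where \<omega>0: "\<omega>0 \<in> E" and differ: "\<exists>\<omega>\<in>E. \<omega> i \<noteq> \<omega>0 i" by blast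
    have agree: "\<omega> l = \<omega>0 l" if "\<omega> \<in> E" "l < i" for \<omega> l
      using not_less_Least[of l "\<lambda>i. \<exists>\<omega>\<in>E. \<exists>\<omega>'\<in>E. \<omega> i \<noteq> \<omega>' i"] that \<omega>0 unfolding i_def by blast
    define S where "S = (\<lambda>\<omega>. \<omega> i) ` E"
    have w: "\<omega>0 \<in> codes N" using \<omega>0 Ec by auto
    have S: "S \<subseteq> blists N i" unfolding S_def using Ec by (auto simp: codes_def)
    define p where "p = (\<Prod>l<i. pmass N l (\<omega>0 l)) * sum (pmass N i) S"
    define Q where "Q = (\<Prod>l<i. (1 / (2 * \<eta>)) ^ l)"
    have pQ: "p \<le> Q" unfolding p_def Q_def by (rule prod_pmass_le[OF w S])
    have pA: "p \<le> Acon i * diameter U"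
      unfolding p_def S_def using Ec \<omega>0 agree differ d by (intro prod_pmass_le_dist)
    have p0: "p \<ge> 0" unfolding p_def by (intro mult_nonneg_nonneg prod_nonneg sum_nonneg pmass_nonneg)
    have A1: "Acon i \<ge> 1" unfolding Acon_def by (intro prod_ge_1 KD_theta_eta_ge_1)
    have D0: "diameter U \<ge> 0" using diameter_ge_0[OF U] .
    have p_le: "p \<le> B * diameter U powr (1 - \<beta>)"
    proof -
      have "p = p powr (1 - \<beta>) * p powr \<beta>"
        using p0 by (cases "p = 0") (auto simp: powr_add[symmetric])
      also have "\<dots> \<le> (Acon i * diameter U) powr (1 - \<beta>) * Q powr \<beta>"
        using p0 pQ pA \<beta> by (intro mult_mono powr_mono2) auto
      also have "\<dots> = Acon i powr (1 - \<beta>) * Q powr \<beta> * diameter U powr (1 - \<beta>)"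
        using A1 D0 by (simp add: powr_mult)
      also have "\<dots> \<le> Acon i powr 1 * Q powr \<beta> * diameter U powr (1 - \<beta>)"
        using A1 \<beta> by (intro mult_right_mono powr_mono) auto
      also have "\<dots> \<le> B * diameter U powr (1 - \<beta>)"
        using B(2)[of i] A1 unfolding Q_def by (intro mult_right_mono) auto
      finally show ?thesis .
    qed
    have "ennreal p \<le> ennreal B * hterm (1 - \<beta>) U"
    \<comment> \<open>For exponent 0, \<open>hterm\<close> is 1 on every nonempty set, while
      \<open>0 powr 0\<close> is 0; the bound \<open>p \<le> 1\<close> replaces the power estimate
      here.\<close>
    proof (cases "\<beta> = 1")
      case True
      have "p \<le> 1 * 1" unfolding p_def using sum_pmass_le_1[OF S] sum_pmass_le_1[of "{_}"] w
        by (intro mult_mono prod_le_1 sum_nonneg pmass_nonneg) (auto simp: codes_def pmass_nonneg)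
      moreover have "U \<noteq> {}" using \<omega>0 unfolding E_def by auto
      ultimately show ?thesis using True B by (simp add: hterm_def ennreal_leI)
    next
      case False
      moreover have "U \<noteq> {}" using \<omega>0 unfolding E_def by auto
      ultimately show ?thesis using p_le B by (simp add: hterm_def ennreal_mult[symmetric] ennreal_leI)
    qed
    then have "emeasure (Pm N) (Cy \<omega>0 i S) \<le> ennreal B * hterm (1 - \<beta>) U + ennreal \<epsilon>"
      unfolding Cy_def cylinder_emeasure[OF w S] p_def[symmetric] by (rule order.trans) simp
    moreover have "E \<subseteq> Cy \<omega>0 i S" using agree Ec by (auto simp: Cy_def S_def)
    ultimately show ?thesis using cylinder_sets[OF w S] unfolding Cy_def by blast
  qed
  then show ?thesis unfolding E_def .
qed

lemma hausdorff_measure_nonzero: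
  assumes \<beta>: "0 < \<beta>" "\<beta> \<le> 1" and eta_eq: "\<eta> = 2 powr (- \<beta> / 4)"
    and A: "pt ` codes N \<subseteq> A"
  shows "hausdorff_measure (1 - \<beta>) A \<noteq> 0"
proof
  assume 0: "hausdorff_measure (1 - \<beta>) A = 0"
  obtain B where B: "B \<ge> 1" "\<And>i. Acon i * (\<Prod>l<i. (1 / (2 * \<eta>)) ^ l) powr \<beta> \<le> B"
    using Acon_bounded[OF \<beta> eta_eq] by blast
  have "hausdorff_pre (1 - \<beta>) 1 A \<le> hausdorff_measure (1 - \<beta>) A"
    unfolding hausdorff_measure_def by (intro SUP_upper) auto
  then have "hausdorff_pre (1 - \<beta>) 1 A < ennreal (1 / (2 * B))"
    using 0 B(1) by (simp add: ennreal_zero_less_divide)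
  then obtain U :: "nat \<Rightarrow> real set" where cover: "A \<subseteq> (\<Union>i. U i)" and bdd: "\<And>i. bounded (U i)"
    and small: "(\<Sum>i. hterm (1 - \<beta>) (U i)) < ennreal (1 / (2 * B))"
    unfolding hausdorff_pre_def INF_less_iff by blast
  \<comment> \<open>These errors add up to 1/2, and the cover contributes less than
    \<open>B * (1 / (2 * B))\<close>, again 1/2, so the whole code space would have mass below
    1.\<close>
  define \<epsilon> where "\<epsilon> i = (1/2 :: real) ^ Suc i / 2" for i
  have "\<exists>C. C \<in> sets (Pm N) \<and> {\<omega>\<in>codes N. pt \<omega> \<in> U i} \<subseteq> C \<and>
      emeasure (Pm N) C \<le> ennreal B * hterm (1 - \<beta>) (U i) + ennreal (\<epsilon> i)" for i
    using set_mass_le[OF \<beta> B bdd[of i], of "\<epsilon> i"] by (auto simp: \<epsilon>_def)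
  then have "\<exists>C. \<forall>i. C i \<in> sets (Pm N) \<and> {\<omega>\<in>codes N. pt \<omega> \<in> U i} \<subseteq> C i \<and>
      emeasure (Pm N) (C i) \<le> ennreal B * hterm (1 - \<beta>) (U i) + ennreal (\<epsilon> i)"
    by (intro choice allI)
  then obtain C where C': "\<forall>i. C i \<in> sets (Pm N) \<and> {\<omega>\<in>codes N. pt \<omega> \<in> U i} \<subseteq> C i \<and>
      emeasure (Pm N) (C i) \<le> ennreal B * hterm (1 - \<beta>) (U i) + ennreal (\<epsilon> i)"
    by (elim exE)
  have C: "C i \<in> sets (Pm N)" "{\<omega>\<in>codes N. pt \<omega> \<in> U i} \<subseteq> C i"
    "emeasure (Pm N) (C i) \<le> ennreal B * hterm (1 - \<beta>) (U i) + ennreal (\<epsilon> i)" for i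
    using C'[rule_format, of i] by auto
  have "codes N \<subseteq> (\<Union>i. C i)"
  proof
    fix \<omega> assume \<omega>: "\<omega> \<in> codes N"
    then have "pt \<omega> \<in> A" using A by blast
    then obtain i where "pt \<omega> \<in> U i" using cover by blast
    then show "\<omega> \<in> (\<Union>i. C i)" using C(2)[of i] \<omega> by blast
  qed
  then have "emeasure (Pm N) (codes N) \<le> emeasure (Pm N) (\<Union>i. C i)"
    using C(1) by (intro emeasure_mono) auto
  also have "\<dots> \<le> (\<Sum>i. emeasure (Pm N) (C i))"
    using C(1) by (intro emeasure_subadditive_countably) auto
  also have "\<dots> \<le> (\<Sum>i. ennreal B * hterm (1 - \<beta>) (U i) + ennreal (\<epsilon> i))"
    using C(3) by (intro suminf_le) auto
  also have "\<dots> = ennreal B * (\<Sum>i. hterm (1 - \<beta>) (U i)) + (\<Sum>i. ennreal (\<epsilon> i))"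
    by (simp add: suminf_add[symmetric])
  also have "(\<Sum>i. ennreal (\<epsilon> i)) = ennreal (1 / 2)"
    using sums_divide[OF power_half_series, of 2]
    by (intro suminf_ennreal_eq) (auto simp: \<epsilon>_def)
  also have "ennreal B * (\<Sum>i. hterm (1 - \<beta>) (U i)) + ennreal (1/2) < 1"
  proof -
    have "ennreal B * (\<Sum>i. hterm (1 - \<beta>) (U i)) < ennreal B * ennreal (1 / (2 * B))"
      using small B(1) by (intro ennreal_mult_strict_left_mono) auto
    also have "\<dots> = ennreal (1/2)" using B(1) by (simp add: ennreal_mult[symmetric])
    finally have "ennreal B * (\<Sum>i. hterm (1 - \<beta>) (U i)) + ennreal (1/2) < ennreal (1/2) + ennreal (1/2)"
      by (subst (1 2) add.commute) (simp add: ennreal_add_left_cancel_less)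
    also have "\<dots> = ennreal (1/2 + 1/2)" by (rule ennreal_plus[symmetric]) simp_all
    also have "\<dots> = 1" by simp
    finally show ?thesis .
  qed
  finally have "emeasure (Pm N) (codes N) < 1" .
  moreover have "emeasure (Pm N) (codes N) = 1"
    using P.emeasure_space_1 space_Pm[of N] by (simp add: Pm_def)
  ultimately show False by simp
qed

end

section \<open>Empirical averages along coded orbits\<close>

text \<open>The end points must be excluded: 1/3 and 2/3 are each an end value of two branches, and
  \<open>fmap\<close> follows only one of them.\<close>

lemma fmap_br:
  assumes "0 < z" "z < 1"
  shows "fmap (br j z) = z"
proof (cases j)
  case Lf
  have "br Lf z < 1/3" using br_less_iff[of Lf z 1] assms by (simp add: br_ends del: br_less_iff)
  moreover have "br Lf z = icub z" by (simp add: br_def xi_def sc_def)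
  ultimately show ?thesis using cub_icub[of z] Lf by (simp add: fmap_def cub_def del: cub_icub)
next
  case Md
  have "1/3 < br Md z" "br Md z < 2/3"
    using br_less_iff[of Md 0 z] br_less_iff[of Md z 1] assms by (simp_all add: br_ends del: br_less_iff)
  moreover have "br Md z = 1/2 + icub (2 * (z - 1/2)) / 2" by (simp add: br_def xi_def sc_def)
  ultimately show ?thesis using cub_icub[of "2 * (z - 1/2)"] Md
    by (simp add: fmap_def cub_def power_divide del: cub_icub)
next
  case Rt
  have "2/3 < br Rt z" using br_less_iff[of Rt 0 z] assms by (simp add: br_ends del: br_less_iff)
  moreover have "br Rt z = 1 + icub (z - 1)" by (simp add: br_def xi_def sc_def)
  ultimately show ?thesis using cub_icub[of "z - 1"] Rt by (simp add: fmap_def cub_def del: cub_icub)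
qed

lemma psi_in_open: "z \<in> {0<..<1} \<Longrightarrow> psi w z \<in> {0<..<1}"
  using psi_01[of w] psi_less_iff[of w 0 z] psi_less_iff[of w z 1] by (auto simp del: psi_less_iff)

lemma fmap_psi: "z \<in> {0<..<1} \<Longrightarrow> (fmap ^^ length w) (psi w z) = z"
proof (induction w)
  case (Cons j w)
  then show ?case using psi_in_open[of z w] by (simp add: funpow_Suc_right fmap_br del: funpow.simps)
qed simp

definition birk :: "(real \<Rightarrow> real) \<Rightarrow> nat \<Rightarrow> real \<Rightarrow> real" where
  "birk g n x = (\<Sum>k<n. g ((fmap ^^ k) x))"

lemma birk_add: "birk g (m + n) x = birk g m x + birk g n ((fmap ^^ m) x)"
proof (induction n)
  case (Suc n)
  have "(fmap ^^ (m + n)) x = (fmap ^^ n) ((fmap ^^ m) x)"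
    by (metis add.commute comp_apply funpow_add)
  then show ?case using Suc by (simp add: birk_def)
qed (simp add: birk_def)

text \<open>The Birkhoff sum over the passage through a word, expressed by inverse branches and the
  exit point \<open>z\<close>, so that it splits along concatenations.\<close>

primrec wsum :: "(real \<Rightarrow> real) \<Rightarrow> sym list \<Rightarrow> real \<Rightarrow> real" where
  "wsum g [] z = 0"
| "wsum g (j # w) z = g (psi (j # w) z) + wsum g w z"

lemma wsum_append: "wsum g (u @ v) z = wsum g u (psi v z) + wsum g v z"
  by (induction u) auto

lemma birk_psi: "z \<in> {0<..<1} \<Longrightarrow> birk g (length w) (psi w z) = wsum g w z"
proof (induction w)
  case (Cons j w)
  have "birk g (1 + length w) (psi (j # w) z) = g (psi (j # w) z) + birk g (length w) (psi w z)"
    using psi_in_open[of z w] Cons.prems by (subst birk_add) (simp add: birk_def fmap_br)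
  then show ?case using Cons by simp
qed (simp add: birk_def)

lemma wsum_abs_le:
  assumes "\<And>x. x \<in> {0..1} \<Longrightarrow> \<bar>g x\<bar> \<le> B" "z \<in> {0..1}"
  shows "\<bar>wsum g w z\<bar> \<le> B * length w"
proof (induction w)
  case (Cons j w)
  have "\<bar>g (psi (j # w) z)\<bar> \<le> B" by (rule assms(1)[OF psi_in_01[OF assms(2)]])
  then show ?case using Cons by (simp add: algebra_simps del: psi.simps)
qed simp

lemma xi_in_01: "xi j \<in> {0..1}"
  by (auto simp: xi_def split: sym.splits)

text \<open>Only the final letters of the run, those with fewer than \<open>R\<close> letters left,
  can be far from \<open>xi j\<close>, and each costs at most \<open>2 * B\<close>. The induction
  carries \<open>min n R\<close>, because with \<open>R\<close> itself the step would fail for short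
  runs.\<close>

lemma wsum_replicate:
  fixes g :: "real \<Rightarrow> real" and R n :: nat and B \<epsilon> :: real
  assumes B: "\<And>x. x \<in> {0..1} \<Longrightarrow> \<bar>g x\<bar> \<le> B"
    and R: "\<And>n j z. R \<le> n \<Longrightarrow> z \<in> {0..1} \<Longrightarrow> \<bar>g (psi (replicate n j) z) - g (xi j)\<bar> \<le> \<epsilon>"
    and z: "z \<in> {0..1}"
  shows "\<bar>wsum g (replicate n j) z - n * g (xi j)\<bar> \<le> 2 * B * R + \<epsilon> * n"
proof -
  have "B \<ge> 0" using B[of 0] by auto
  have "\<epsilon> \<ge> 0" using R[of R 0 Lf] by auto
  have "\<bar>wsum g (replicate n j) z - n * g (xi j)\<bar> \<le> 2 * B * real (min n R) + \<epsilon> * n"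
  proof (induction n)
    case (Suc n)
    define y where "y = psi (replicate (Suc n) j) z"
    have y: "y \<in> {0..1}" unfolding y_def by (rule psi_in_01[OF z])
    have "wsum g (replicate (Suc n) j) z - (Suc n) * g (xi j)
        = (wsum g (replicate n j) z - n * g (xi j)) + (g y - g (xi j))"
      by (simp add: y_def algebra_simps)
    then have 1: "\<bar>wsum g (replicate (Suc n) j) z - (Suc n) * g (xi j)\<bar>
        \<le> 2 * B * real (min n R) + \<epsilon> * n + \<bar>g y - g (xi j)\<bar>"
      using Suc by linarith
    show ?case
    proof (cases "R \<le> Suc n")
      case True
      then have "\<bar>g y - g (xi j)\<bar> \<le> \<epsilon>" unfolding y_def using R z by blast
      moreover have "2 * B * real (min n R) \<le> 2 * B * real (min (Suc n) R)"
        using \<open>B \<ge> 0\<close> by (intro mult_left_mono) auto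
      ultimately show ?thesis using 1 by (simp add: algebra_simps)
    next
      case False
      have "\<bar>g y - g (xi j)\<bar> \<le> 2 * B" using B[OF y] B[OF xi_in_01[of j]] by linarith
      then have "\<bar>wsum g (replicate (Suc n) j) z - (Suc n) * g (xi j)\<bar> \<le> 2 * B * real n + \<epsilon> * n + 2 * B"
        using 1 False by (simp add: min_def)
      also have "\<dots> \<le> 2 * B * real (min (Suc n) R) + \<epsilon> * Suc n"
        using False \<open>\<epsilon> \<ge> 0\<close> by (simp add: min_def algebra_simps)
      finally show ?thesis .
    qed
  qed simp
  also have "\<dots> \<le> 2 * B * R + \<epsilon> * n" using \<open>B \<ge> 0\<close> by (intro add_right_mono mult_left_mono) auto
  finally show ?thesis .
qed

lemma runs_near_fixed_points:
  fixes g :: "real \<Rightarrow> real"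
  assumes "continuous_on UNIV g" "\<epsilon> > 0"
  obtains R :: nat where "\<And>n j z. R \<le> n \<Longrightarrow> z \<in> {0..1} \<Longrightarrow> \<bar>g (psi (replicate n j) z) - g (xi j)\<bar> \<le> \<epsilon>"
proof -
  have "\<exists>R. \<forall>n\<ge>R. \<forall>z\<in>{0..1}. \<bar>g (psi (replicate n j) z) - g (xi j)\<bar> \<le> \<epsilon>" for j
  proof -
    have "isCont g (xi j)" using assms(1) by (simp add: continuous_on_eq_continuous_at)
    then obtain d where d: "d > 0" "\<And>x. \<bar>x - xi j\<bar> < d \<Longrightarrow> \<bar>g x - g (xi j)\<bar> < \<epsilon>"
      using assms(2) unfolding continuous_at_eps_delta dist_real_def by blast
    have "\<forall>\<^sub>F n in sequentially. (icub ^^ n) 1 < d"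
      using order_tendstoD(2)[OF icub_pow_1_tendsto d(1)] .
    then obtain R where R: "\<And>n. n \<ge> R \<Longrightarrow> (icub ^^ n) 1 < d"
      unfolding eventually_sequentially by blast
    show ?thesis
    proof (intro exI allI impI ballI)
      fix n and z :: real assume "R \<le> n" "z \<in> {0..1}"
      then have "\<bar>psi (replicate n j) z - xi j\<bar> < d"
        using R[of n] psi_replicate_near_xi[of z n j] by linarith
      then show "\<bar>g (psi (replicate n j) z) - g (xi j)\<bar> \<le> \<epsilon>" using d(2) by (auto intro: less_imp_le)
    qed
  qed
  then obtain R where R: "\<And>j n z. n \<ge> R j \<Longrightarrow> z \<in> {0..1} \<Longrightarrow> \<bar>g (psi (replicate n j) z) - g (xi j)\<bar> \<le> \<epsilon>"
    using choice[of "\<lambda>j R. \<forall>n\<ge>R. \<forall>z\<in>{0..1}. \<bar>g (psi (replicate n j) z) - g (xi j)\<bar> \<le> \<epsilon>"] by blast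
  show ?thesis
  proof (rule that)
    fix n j and z :: real assume "Max (range R) \<le> n" "z \<in> {0..1}"
    then show "\<bar>g (psi (replicate n j) z) - g (xi j)\<bar> \<le> \<epsilon>"
      using R[of j n z] Max_ge[of "range R" "R j"] by simp
  qed
qed

section \<open>Inserted runs and weighted averages of frequencies\<close>

type_synonym vec3 = "real \<times> real \<times> real"

definition gbar :: "(real \<Rightarrow> real) \<Rightarrow> vec3 \<Rightarrow> real" where
  "gbar g p = fst p * g 0 + fst (snd p) * g (1/2) + snd (snd p) * g 1"

lemma linear_gbar: "linear (gbar g)"
  by (rule linearI) (simp_all add: gbar_def algebra_simps)

lemma simplexS_D:
  assumes "p \<in> simplexS"
  shows "0 \<le> fst p" "fst p \<le> 1" "0 \<le> fst (snd p)" "fst (snd p) \<le> 1" "0 \<le> snd (snd p)" "snd (snd p) \<le> 1"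
    "fst p + fst (snd p) + snd (snd p) = 1"
  using assms by (auto simp: simplexS_def)

lemma gbar_abs_le:
  assumes "\<And>x. x \<in> {0..1} \<Longrightarrow> \<bar>g x\<bar> \<le> B" "p \<in> simplexS"
  shows "\<bar>gbar g p\<bar> \<le> B"
proof -
  note p = simplexS_D[OF assms(2)]
  have "\<bar>gbar g p\<bar> \<le> \<bar>fst p * g 0\<bar> + \<bar>fst (snd p) * g (1/2)\<bar> + \<bar>snd (snd p) * g 1\<bar>"
    unfolding gbar_def by linarith
  also have "\<dots> = fst p * \<bar>g 0\<bar> + fst (snd p) * \<bar>g (1/2)\<bar> + snd (snd p) * \<bar>g 1\<bar>"
    using p by (simp add: abs_mult)
  also have "\<dots> \<le> fst p * B + fst (snd p) * B + snd (snd p) * B"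
    using p assms(1) by (intro add_mono mult_left_mono) auto
  also have "\<dots> = B" using p(7) by (simp add: distrib_right[symmetric])
  finally show ?thesis .
qed

definition cnt :: "nat \<Rightarrow> real \<Rightarrow> nat" where
  "cnt i p = nat \<lceil>real (i\<^sup>2) * p\<rceil>"

lemma cnt_bounds:
  assumes "0 \<le> p" "p \<le> 1"
  shows "real (i\<^sup>2) * p \<le> cnt i p" "cnt i p \<le> real (i\<^sup>2) * p + 1" "cnt i p \<le> i\<^sup>2 + 1"
proof -
  have "0 \<le> real (i\<^sup>2) * p" using assms by simp
  then show 1: "real (i\<^sup>2) * p \<le> cnt i p" "cnt i p \<le> real (i\<^sup>2) * p + 1" unfolding cnt_def by linarith+
  have "real (i\<^sup>2) * p \<le> real (i\<^sup>2) * 1" using assms by (intro mult_left_mono) auto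
  then show "cnt i p \<le> i\<^sup>2 + 1" using 1 by linarith
qed

text \<open>The final \<open>Md\<close> keeps the cylinder of the inserted word away from the end points of the unit interval.\<close>

definition rword :: "(nat \<Rightarrow> vec3) \<Rightarrow> nat \<Rightarrow> sym list" where
  "rword q i = replicate (cnt i (fst (q i))) Lf @ replicate (cnt i (fst (snd (q i)))) Md
    @ replicate (cnt i (snd (snd (q i)))) Rt @ [Md]"

text \<open>Each of the three runs has at most \<open>i\<^sup>2 + 1\<close> letters and loses a
  seventh power, hence the exponent 21. The factor 7 bounds the slope for the closing
  \<open>Md\<close>, and also covers the distance 1/3 of its cylinder from 0 and 1.\<close>

definition rtheta :: "nat \<Rightarrow> real" where
  "rtheta i = 1 / (7 * (real (i\<^sup>2) + 2) ^ 21)"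

lemma psi_runs_diff_ge:
  assumes "a \<le> i\<^sup>2 + 1" "b \<le> i\<^sup>2 + 1" "c \<le> i\<^sup>2 + 1" "0 \<le> x" "x \<le> y" "y \<le> 1"
  defines "w \<equiv> replicate a Lf @ replicate b Md @ replicate c Rt"
  shows "(y - x) / (real (i\<^sup>2) + 2) ^ 21 \<le> psi w y - psi w x"
proof -
  define M where "M = (real (i\<^sup>2) + 2) ^ 7"
  have pos: "real (i\<^sup>2) + 2 > 0" by (simp add: add_nonneg_pos)
  then have M: "M > 0" unfolding M_def by (intro zero_less_power)
  have step: "(v - u) / M \<le> psi (replicate n j) v - psi (replicate n j) u"
    if "n \<le> i\<^sup>2 + 1" "u \<in> {0..1}" "v \<in> {0..1}" "u \<le> v" for n j u v
  proof -
    have "real n \<le> real (i\<^sup>2 + 1)" using that(1) by (simp only: of_nat_le_iff)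
    then have "(real n + 1) ^ 7 \<le> M" unfolding M_def by (intro power_mono) auto
    then have "(v - u) / M \<le> (v - u) / (real n + 1) ^ 7"
      using that M by (intro divide_left_mono mult_pos_pos zero_less_power) auto
    also have "\<dots> \<le> psi (replicate n j) v - psi (replicate n j) u"
      using psi_replicate_diff_ge[of u v n j] that by (simp add: add.commute)
    finally show ?thesis .
  qed
  define x1 where "x1 = psi (replicate c Rt) x"
  define y1 where "y1 = psi (replicate c Rt) y"
  define x2 where "x2 = psi (replicate b Md) x1"
  define y2 where "y2 = psi (replicate b Md) y1"
  have i1: "x1 \<in> {0..1}" "y1 \<in> {0..1}" "x1 \<le> y1"
    unfolding x1_def y1_def using assms by (auto intro!: psi_in_01 simp del: atLeastAtMost_iff) (auto)
  have i2: "x2 \<in> {0..1}" "y2 \<in> {0..1}" "x2 \<le> y2"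
    unfolding x2_def y2_def using i1 by (auto intro!: psi_in_01 simp del: atLeastAtMost_iff)
  have "(y - x) / (real (i\<^sup>2) + 2) ^ 21 = (y - x) / M / M / M"
    unfolding M_def by (simp add: power_add[symmetric])
  also have "\<dots> \<le> (y1 - x1) / M / M"
    unfolding x1_def y1_def using assms M by (intro divide_right_mono step) auto
  also have "\<dots> \<le> (y2 - x2) / M"
    unfolding x2_def y2_def using assms M i1 by (intro divide_right_mono step) auto
  also have "\<dots> \<le> psi w y - psi w x"
    using step[OF assms(1) i2(1,2,3), of Lf] by (simp add: w_def x1_def x2_def y1_def y2_def)
  finally show ?thesis .
qed

lemma insertion_rword:
  assumes q: "\<And>i. q i \<in> simplexS"
  shows "insertion (rword q) rtheta"
proof
  fix i :: nat
  define w where "w = replicate (cnt i (fst (q i))) Lf @ replicate (cnt i (fst (snd (q i)))) Md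
    @ replicate (cnt i (snd (snd (q i)))) Rt"
  define M where "M = (real (i\<^sup>2) + 2) ^ 21"
  have M: "M \<ge> 1" unfolding M_def by (intro one_le_power) simp
  have th: "rtheta i = 1 / (7 * M)" unfolding rtheta_def M_def ..
  have rw: "rword q i = w @ [Md]" unfolding rword_def w_def by simp
  note p = simplexS_D[OF q[of i]]
  have wd: "(y - x) / M \<le> psi w y - psi w x" if "0 \<le> x" "x \<le> y" "y \<le> 1" for x y
    unfolding w_def M_def using that p by (intro psi_runs_diff_ge cnt_bounds)
  show "0 < rtheta i" "rtheta i \<le> 1" unfolding th using M by auto
  show "rtheta i * (y - x) \<le> psi (rword q i) y - psi (rword q i) x" if "0 \<le> x" "x \<le> y" "y \<le> 1" for x y
  proof -
    have "rtheta i * (y - x) = (y - x) / 7 / M" unfolding th by simp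
    also have "\<dots> \<le> (y - x) / brslope Md x y / M"
      using that M brslope_le_7[of x y Md] brslope_ge_1[of Md x y]
      by (intro divide_right_mono divide_left_mono) auto
    also have "\<dots> = (br Md y - br Md x) / M" by (simp add: br_diff)
    also have "\<dots> \<le> psi w (br Md y) - psi w (br Md x)"
      using psi_in_01[of x "[Md]"] psi_in_01[of y "[Md]"] that by (intro wd) auto
    finally show ?thesis by (simp add: rw)
  qed
  show "rtheta i \<le> psi (rword q i) x \<and> psi (rword q i) x \<le> 1 - rtheta i" if "x \<in> {0..1}" for x
  proof -
    define y where "y = br Md x"
    have y: "1/3 \<le> y" "y \<le> 2/3"
      using br_le_iff[of Md 0 x] br_le_iff[of Md x 1] that unfolding y_def br_ends by auto
    have "rtheta i \<le> 1/3 / M" unfolding th using M by (simp add: field_simps)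
    also have "\<dots> \<le> (y - 0) / M" using y M by (intro divide_right_mono) auto
    also have "\<dots> \<le> psi w y - psi w 0" using y by (intro wd) auto
    finally have 1: "rtheta i \<le> psi w y" using psi_01(1)[of w] by linarith
    have "rtheta i \<le> 1/3 / M" unfolding th using M by (simp add: field_simps)
    also have "\<dots> \<le> (1 - y) / M" using y M by (intro divide_right_mono) auto
    also have "\<dots> \<le> psi w 1 - psi w y" using y by (intro wd) auto
    finally have 2: "psi w y \<le> 1 - rtheta i" using psi_01(2)[of w] by linarith
    show ?thesis using 1 2 by (simp add: rw y_def)
  qed
  show "(\<lambda>i. c ^ i / rtheta i) \<longlonglongrightarrow> 0" if "0 < c" "c < 1" for c :: real
    unfolding rtheta_def using that by real_asymp
qed

definition Wt :: "nat \<Rightarrow> real" where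
  "Wt l = (\<Sum>i<l. real (i\<^sup>2))"

lemma Wt_eq: "Wt l = (real l - 1) * real l * (2 * real l - 1) / 6"
  unfolding Wt_def by (induction l) (auto simp: field_simps power2_eq_square)

text \<open>The weights start with 0, so \<open>Wt\<close> vanishes at 0 and 1 and division by zero
  makes the average the zero vector there, outside the simplex. This is why \<open>l \<ge> 2\<close>
  appears below.\<close>

definition wavg :: "(nat \<Rightarrow> vec3) \<Rightarrow> nat \<Rightarrow> vec3" where
  "wavg q l = (1 / Wt l) *\<^sub>R (\<Sum>i<l. real (i\<^sup>2) *\<^sub>R q i)"

lemma wavg_scaled: "Wt l *\<^sub>R wavg q l = (\<Sum>i<l. real (i\<^sup>2) *\<^sub>R q i)"
proof (cases "Wt l = 0")
  case True
  then have "\<forall>i\<in>{..<l}. real (i\<^sup>2) = 0"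
    unfolding Wt_def by (subst (asm) sum_nonneg_eq_0_iff) auto
  then have "(\<Sum>i<l. real (i\<^sup>2) *\<^sub>R q i) = 0"
    by (intro sum.neutral ballI) (simp only: scaleR_zero_left)
  then show ?thesis using True by simp
qed (simp add: wavg_def)

lemma gbar_wavg: "Wt l * gbar g (wavg q l) = (\<Sum>i<l. real (i\<^sup>2) * gbar g (q i))"
proof -
  have "Wt l * gbar g (wavg q l) = gbar g (Wt l *\<^sub>R wavg q l)"
    by (simp add: linear_scale[OF linear_gbar])
  then show ?thesis
    unfolding wavg_scaled by (simp add: linear_scale[OF linear_gbar] linear_sum[OF linear_gbar])
qed

lemma simplexS_iff: "p \<in> simplexS \<longleftrightarrow> 0 \<le> fst p \<and> 0 \<le> fst (snd p) \<and> 0 \<le> snd (snd p) \<and>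
    fst p + fst (snd p) + snd (snd p) = 1"
  by (auto simp: simplexS_def)

lemma simplexS_convex_comb:
  assumes "p \<in> simplexS" "p' \<in> simplexS" "0 \<le> t" "t \<le> 1"
  shows "(1 - t) *\<^sub>R p + t *\<^sub>R p' \<in> simplexS"
proof -
  have "fst ((1 - t) *\<^sub>R p + t *\<^sub>R p') + fst (snd ((1 - t) *\<^sub>R p + t *\<^sub>R p')) + snd (snd ((1 - t) *\<^sub>R p + t *\<^sub>R p'))
      = (1 - t) * (fst p + fst (snd p) + snd (snd p)) + t * (fst p' + fst (snd p') + snd (snd p'))"
    by (simp add: algebra_simps)
  then show ?thesis using assms unfolding simplexS_iff by simp
qed

lemma Wt_pos: "l \<ge> 2 \<Longrightarrow> Wt l > 0"
  unfolding Wt_eq by simp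

lemma wavg_Suc:
  assumes "l \<ge> 1"
  shows "wavg q (Suc l) = (1 - real (l\<^sup>2) / Wt (Suc l)) *\<^sub>R wavg q l + (real (l\<^sup>2) / Wt (Suc l)) *\<^sub>R q l"
proof -
  have pos: "Wt (Suc l) > 0" using assms by (intro Wt_pos) auto
  have "1 - real (l\<^sup>2) / Wt (Suc l) = Wt l / Wt (Suc l)"
    using pos by (simp add: field_simps) (simp add: Wt_def)
  moreover have "Wt l *\<^sub>R wavg q l = (\<Sum>i<l. real (i\<^sup>2) *\<^sub>R q i)" by (rule wavg_scaled)
  then have "(Wt l / Wt (Suc l)) *\<^sub>R wavg q l = (1 / Wt (Suc l)) *\<^sub>R (\<Sum>i<l. real (i\<^sup>2) *\<^sub>R q i)"
    by (metis scaleR_scaleR times_divide_eq_left mult_1)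
  moreover have "wavg q (Suc l) = (1 / Wt (Suc l)) *\<^sub>R (\<Sum>i<l. real (i\<^sup>2) *\<^sub>R q i)
      + (real (l\<^sup>2) / Wt (Suc l)) *\<^sub>R q l"
    unfolding wavg_def by (simp add: scaleR_add_right)
  ultimately show ?thesis by (simp only:)
qed

lemma wavg_in_simplexS:
  assumes q: "\<And>i. q i \<in> simplexS" and "l \<ge> 2"
  shows "wavg q l \<in> simplexS"
  using assms(2)
proof (induction l rule: dec_induct)
  case base
  have "wavg q 2 = q 1" by (simp add: wavg_def Wt_def numeral_2_eq_2)
  then show ?case using q by simp
next
  case (step l)
  have "real (l\<^sup>2) \<le> Wt (Suc l)" using step Wt_pos[of l] by (simp add: Wt_def)
  then show ?case using step q Wt_pos[of "Suc l"]
    by (subst wavg_Suc) (auto intro!: simplexS_convex_comb simp: divide_le_eq)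
qed

text \<open>The index of the stage containing time \<open>n\<close> when stages begin at the times
  \<open>T\<close>. It serves for orbit stages, for chains of points in \<open>C\<close>, and for
  rest periods of the frequencies.\<close>

definition lev :: "(nat \<Rightarrow> nat) \<Rightarrow> nat \<Rightarrow> nat" where
  "lev T n = (LEAST l. n < T (Suc l))"

lemma lev_bounds:
  assumes "strict_mono T" "T 0 = 0"
  shows "T (lev T n) \<le> n" "n < T (Suc (lev T n))"
proof -
  have "n < T (Suc n)" using strict_mono_imp_increasing[OF assms(1), of "Suc n"] by simp
  then show 1: "n < T (Suc (lev T n))" unfolding lev_def by (rule LeastI)
  show "T (lev T n) \<le> n"
  proof (cases "lev T n")
    case (Suc l)
    then have "\<not> n < T (Suc l)" using not_less_Least[of l "\<lambda>l. n < T (Suc l)"] unfolding lev_def by simp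
    then show ?thesis using Suc by simp
  qed (simp add: assms)
qed

lemma lev_eq:
  assumes "strict_mono T" "T 0 = 0" "T l \<le> n" "n < T (Suc l)"
  shows "lev T n = l"
proof -
  have "T l < T (Suc (lev T n))" "T (lev T n) < T (Suc l)"
    using lev_bounds[OF assms(1,2), of n] assms(3,4) by linarith+
  then show ?thesis using assms(1) by (simp add: strict_mono_less)
qed

lemma filterlim_lev:
  assumes "strict_mono T" "T 0 = 0"
  shows "filterlim (lev T) at_top sequentially"
  unfolding filterlim_at_top eventually_sequentially
proof (intro allI exI impI)
  fix Z n assume "T Z \<le> n"
  then have "T Z < T (Suc (lev T n))" using lev_bounds[OF assms, of n] by linarith
  then show "Z \<le> lev T n" using assms(1) by (simp add: strict_mono_less)
qed

lemma length_bwords_le: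
  assumes "bs \<in> blists N i"
  shows "length (bwords bs) \<le> (N + 1) * i"
proof -
  have "length (bwords bs) \<le> (N + 1) * length bs"
    using blistsD(1)[OF assms]
  proof (induction bs)
    case (Cons b bs)
    obtain j m k where b: "b = (j, m, k)" "m < N" using Cons.prems by (auto simp: blocks_def)
    then have "length (bword b) \<le> N + 1" by (auto simp: bword_def)
    then show ?case using Cons by auto
  qed simp
  then show ?thesis using blistsD(2)[OF assms] by simp
qed

section \<open>Clock and Birkhoff sums of a coded orbit\<close>

locale tracking = insertion "rword q" rtheta for q :: "nat \<Rightarrow> vec3" +
  fixes N :: nat and \<omega> :: "nat \<Rightarrow> block list"
  assumes q: "\<And>i. q i \<in> simplexS" and code: "\<omega> \<in> codes N"
begin

lemma in_blists: "\<omega> i \<in> blists N i"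
  using code by (simp add: codes_def)

definition T :: "nat \<Rightarrow> nat" where
  "T l = length (pre \<omega> l)"

lemma T_0 [simp]: "T 0 = 0" and T_Suc: "T (Suc l) = T l + length (stage \<omega> l)"
  by (simp_all add: T_def)

lemma length_stage:
  "real (length (stage \<omega> i)) = length (bwords (\<omega> i)) + cnt i (fst (q i)) + cnt i (fst (snd (q i)))
    + cnt i (snd (snd (q i))) + 1"
  by (simp add: stage_def rword_def)

lemma length_stage_bounds:
  "real (i\<^sup>2) \<le> length (stage \<omega> i)" "real (length (stage \<omega> i)) \<le> real (i\<^sup>2) + 4 + (real N + 1) * real i"
proof -
  note p = simplexS_D[OF q[of i]]
  have s: "real (i\<^sup>2) * fst (q i) + real (i\<^sup>2) * fst (snd (q i)) + real (i\<^sup>2) * snd (snd (q i)) = real (i\<^sup>2)"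
    using p(7) by (simp add: distrib_left[symmetric])
  have "real (length (bwords (\<omega> i))) \<le> real ((N + 1) * i)"
    using length_bwords_le[OF in_blists[of i]] by (simp only: of_nat_le_iff)
  then show "real (i\<^sup>2) \<le> length (stage \<omega> i)" "real (length (stage \<omega> i)) \<le> real (i\<^sup>2) + 4 + (real N + 1) * real i"
    unfolding length_stage using s cnt_bounds(1,2)[OF p(1,2), of i] cnt_bounds(1,2)[OF p(3,4), of i]
      cnt_bounds(1,2)[OF p(5,6), of i] by (auto simp: algebra_simps)
qed

lemma T_strict_mono: "strict_mono T"
proof (rule strict_monoI_Suc)
  fix l
  have "length (stage \<omega> l) > 0" by (simp add: stage_def rword_def)
  then show "T l < T (Suc l)" by (simp add: T_Suc)
qed

text \<open>The clock runs like \<open>Wt l\<close>, about l^3/3, up to an error of order l^2: in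
  stage \<open>i\<close> the free blocks take at most \<open>(N + 1) * i\<close> letters, rounding
  up three counts adds at most 3, and the closing \<open>Md\<close> adds 1.\<close>

lemma T_bounds: "Wt l \<le> T l" "T l \<le> Wt l + (real N + 5) * (real l)\<^sup>2"
proof -
  show "Wt l \<le> T l"
  proof (induction l)
    case (Suc l)
    then show ?case using length_stage_bounds(1)[of l]
      unfolding T_Suc Wt_def sum.lessThan_Suc of_nat_add by linarith
  qed (simp add: Wt_def)
  have "T l \<le> Wt l + real l * (4 + (real N + 1) * real l)"
  proof (induction l)
    case (Suc l)
    have "(real N + 1) * real l + (4 + real l * (4 + (real N + 1) * real l))
        \<le> real (Suc l) * (4 + (real N + 1) * real (Suc l))"
      by (simp add: algebra_simps)
    then show ?case using Suc length_stage_bounds(2)[of l]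
      unfolding T_Suc Wt_def sum.lessThan_Suc of_nat_add by linarith
  qed (simp add: Wt_def)
  also have "real l * (4 + (real N + 1) * real l) \<le> (real N + 5) * (real l)\<^sup>2"
  proof -
    have "real l \<le> (real l)\<^sup>2" by (cases l) (auto simp: power2_eq_square)
    then show ?thesis by (simp add: algebra_simps power2_eq_square)
  qed
  finally show "T l \<le> Wt l + (real N + 5) * (real l)\<^sup>2" by simp
qed

lemma tpt_open: "tpt \<omega> l \<in> {0<..<1}"
proof -
  define y where "y = psi (rword q l) (tpt \<omega> (Suc l))"
  have "y \<in> {0<..<1}"
    unfolding y_def using inner[OF tpt_in_01, of l \<omega> "Suc l"] theta_pos[of l] by auto
  then have "psi (bwords (\<omega> l)) y \<in> {0<..<1}" by (rule psi_in_open)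
  then show ?thesis using tpt_Suc[of \<omega> l] by (simp add: stage_def y_def)
qed

lemma pt_in_01: "pt \<omega> \<in> {0..1}"
  using tpt_in_01[of \<omega> 0] psi_tpt[of \<omega> 0] by simp

lemma fmap_pt: "(fmap ^^ T l) (pt \<omega>) = tpt \<omega> l"
  using fmap_psi[OF tpt_open[of l], of "pre \<omega> l"] unfolding T_def psi_tpt .

lemma birk_T_Suc: "birk g (T (Suc l)) (pt \<omega>) = birk g (T l) (pt \<omega>) + wsum g (stage \<omega> l) (tpt \<omega> (Suc l))"
  unfolding T_Suc birk_add fmap_pt tpt_Suc[of \<omega> l] by (subst birk_psi[OF tpt_open]) (rule refl)

lemma orbit_in_01: "(fmap ^^ k) (pt \<omega>) \<in> {0..1}"
proof -
  define v where "v = drop k (pre \<omega> (Suc k))"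
  define u where "u = take k (pre \<omega> (Suc k))"
  have uv: "pre \<omega> (Suc k) = u @ v" unfolding u_def v_def by (rule append_take_drop_id[symmetric])
  have "k < T (Suc k)" using strict_mono_imp_increasing[OF T_strict_mono, of "Suc k"] by simp
  then have len: "length u = k" unfolding u_def T_def by simp
  have "pt \<omega> = psi u (psi v (tpt \<omega> (Suc k)))" using psi_tpt[of \<omega> "Suc k"] unfolding uv psi_append by simp
  then have "(fmap ^^ k) (pt \<omega>) = psi v (tpt \<omega> (Suc k))"
    using fmap_psi[OF psi_in_open[OF tpt_open], of u v "Suc k"] len by simp
  then show ?thesis using psi_in_open[OF tpt_open, of v "Suc k"] by auto
qed

lemma birk_diff_le:
  assumes B: "\<And>x. x \<in> {0..1} \<Longrightarrow> \<bar>g x\<bar> \<le> B" and "m \<le> n"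
  shows "\<bar>birk g n (pt \<omega>) - birk g m (pt \<omega>)\<bar> \<le> B * (real n - real m)"
proof -
  have "birk g n (pt \<omega>) - birk g m (pt \<omega>) = (\<Sum>k\<in>{m..<n}. g ((fmap ^^ k) (pt \<omega>)))"
    unfolding birk_def using assms(2) sum_diff_nat_ivl[of 0 m n "\<lambda>k. g ((fmap ^^ k) (pt \<omega>))"]
    by (simp add: lessThan_atLeast0)
  also have "\<bar>\<dots>\<bar> \<le> (\<Sum>k\<in>{m..<n}. B)"
    by (rule order.trans[OF sum_abs]) (intro sum_mono B orbit_in_01)
  also have "\<dots> = B * (real n - real m)" using assms(2) by (simp add: of_nat_diff)
  finally show ?thesis .
qed

text \<open>The free blocks give the term linear in \<open>i\<close>. In the constant,
  \<open>6 * B * R\<close> comes from the ends of three runs, \<open>4 * B\<close> from three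
  roundings and the closing letter, and \<open>3 * \<epsilon>\<close> from the letters gained by
  rounding up.\<close>

lemma wsum_stage:
  fixes g :: "real \<Rightarrow> real" and R :: nat and B \<epsilon> :: real
  assumes B: "\<And>x. x \<in> {0..1} \<Longrightarrow> \<bar>g x\<bar> \<le> B"
    and R: "\<And>n j z. R \<le> n \<Longrightarrow> z \<in> {0..1} \<Longrightarrow> \<bar>g (psi (replicate n j) z) - g (xi j)\<bar> \<le> \<epsilon>"
    and z: "z \<in> {0..1}"
  shows "\<bar>wsum g (stage \<omega> i) z - real (i\<^sup>2) * gbar g (q i)\<bar>
    \<le> B * (real N + 1) * real i + (6 * B * R + 4 * B + 3 * \<epsilon>) + \<epsilon> * real (i\<^sup>2)"
proof -
  have B0: "B \<ge> 0" using B[of 0] by auto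
  have e0: "\<epsilon> \<ge> 0" using R[of R 0 Lf] by auto
  note p = simplexS_D[OF q[of i]]
  define a b c where "a = cnt i (fst (q i))" and "b = cnt i (fst (snd (q i)))" and "c = cnt i (snd (snd (q i)))"
  define z1 where "z1 = psi [Md] z"
  define z2 where "z2 = psi (replicate c Rt) z1"
  define z3 where "z3 = psi (replicate b Md) z2"
  define z4 where "z4 = psi (replicate a Lf) z3"
  have z1: "z1 \<in> {0..1}" unfolding z1_def by (rule psi_in_01[OF z])
  have z2: "z2 \<in> {0..1}" unfolding z2_def by (rule psi_in_01[OF z1])
  have z3: "z3 \<in> {0..1}" unfolding z3_def by (rule psi_in_01[OF z2])
  have z4: "z4 \<in> {0..1}" unfolding z4_def by (rule psi_in_01[OF z3])
  have eq: "wsum g (stage \<omega> i) z = wsum g (bwords (\<omega> i)) z4 + wsum g (replicate a Lf) z3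
      + wsum g (replicate b Md) z2 + wsum g (replicate c Rt) z1 + g z1"
    unfolding stage_def rword_def a_def[symmetric] b_def[symmetric] c_def[symmetric]
    by (simp add: wsum_append z1_def z2_def z3_def z4_def)
  have 0: "\<bar>wsum g (bwords (\<omega> i)) z4\<bar> \<le> B * ((real N + 1) * real i)"
  proof -
    have "\<bar>wsum g (bwords (\<omega> i)) z4\<bar> \<le> B * length (bwords (\<omega> i))"
      by (rule wsum_abs_le[OF B z4])
    also have "\<dots> \<le> B * real ((N + 1) * i)"
      using length_bwords_le[OF in_blists[of i]] B0 by (intro mult_left_mono) (simp_all only: of_nat_le_iff)
    finally show ?thesis by (simp add: algebra_simps)
  qed
  have wr: "\<bar>wsum g (replicate n j) y - n * g (xi j)\<bar> \<le> 2 * B * R + \<epsilon> * n" if "y \<in> {0..1}" for n j y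
    using B R that by (rule wsum_replicate)
  have xi: "xi Lf = 0" "xi Md = 1/2" "xi Rt = 1" by (simp_all add: xi_def)
  have 1: "\<bar>wsum g (replicate a Lf) z3 - a * g 0\<bar> \<le> 2 * B * R + \<epsilon> * a"
    using wr[OF z3, of a Lf] unfolding xi .
  have 2: "\<bar>wsum g (replicate b Md) z2 - b * g (1/2)\<bar> \<le> 2 * B * R + \<epsilon> * b"
    using wr[OF z2, of b Md] unfolding xi .
  have 3: "\<bar>wsum g (replicate c Rt) z1 - c * g 1\<bar> \<le> 2 * B * R + \<epsilon> * c"
    using wr[OF z1, of c Rt] unfolding xi .
  have 4: "\<bar>g z1\<bar> \<le> B" by (rule B[OF z1])
  have r: "\<bar>real (cnt i s) * g x - real (i\<^sup>2) * s * g x\<bar> \<le> B" if "0 \<le> s" "s \<le> 1" "x \<in> {0..1}" for s x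
  proof -
    have "\<bar>real (cnt i s) * g x - real (i\<^sup>2) * s * g x\<bar> = \<bar>real (cnt i s) - real (i\<^sup>2) * s\<bar> * \<bar>g x\<bar>"
      by (simp add: abs_mult[symmetric] algebra_simps)
    also have "\<dots> \<le> 1 * B"
      using cnt_bounds(1,2)[OF that(1,2), of i] B[OF that(3)] by (intro mult_mono) auto
    finally show ?thesis by simp
  qed
  have 5: "\<bar>a * g 0 - real (i\<^sup>2) * fst (q i) * g 0\<bar> \<le> B"
    unfolding a_def using p by (intro r) auto
  have 6: "\<bar>b * g (1/2) - real (i\<^sup>2) * fst (snd (q i)) * g (1/2)\<bar> \<le> B"
    unfolding b_def using p by (intro r) auto
  have 7: "\<bar>c * g 1 - real (i\<^sup>2) * snd (snd (q i)) * g 1\<bar> \<le> B"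
    unfolding c_def using p by (intro r) auto
  have gb: "real (i\<^sup>2) * gbar g (q i) = real (i\<^sup>2) * fst (q i) * g 0 + real (i\<^sup>2) * fst (snd (q i)) * g (1/2)
      + real (i\<^sup>2) * snd (snd (q i)) * g 1"
    unfolding gbar_def by (simp add: algebra_simps)
  have "real (i\<^sup>2) * fst (q i) + real (i\<^sup>2) * fst (snd (q i)) + real (i\<^sup>2) * snd (snd (q i)) = real (i\<^sup>2)"
    using p(7) by (simp add: distrib_left[symmetric])
  then have "real a + real b + real c \<le> real (i\<^sup>2) + 3"
    using cnt_bounds(2)[OF p(1,2), of i] cnt_bounds(2)[OF p(3,4), of i] cnt_bounds(2)[OF p(5,6), of i]
    unfolding a_def b_def c_def by linarith
  then have 8: "\<epsilon> * a + \<epsilon> * b + \<epsilon> * c \<le> \<epsilon> * (real (i\<^sup>2) + 3)"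
    using e0 by (simp add: distrib_left[symmetric] mult_left_mono)
  have "\<bar>wsum g (stage \<omega> i) z - real (i\<^sup>2) * gbar g (q i)\<bar>
      \<le> B * ((real N + 1) * real i) + (2 * B * R + \<epsilon> * a) + (2 * B * R + \<epsilon> * b) + (2 * B * R + \<epsilon> * c)
        + B + B + B + B"
    unfolding eq gb using 0 1 2 3 4 5 6 7 unfolding abs_le_iff by (intro conjI; elim conjE; linarith)
  also have "\<dots> \<le> B * (real N + 1) * real i + (6 * B * R + 4 * B + 3 * \<epsilon>) + \<epsilon> * real (i\<^sup>2)"
    using 8 by (simp add: algebra_simps)
  finally show ?thesis .
qed

text \<open>At a time in stage \<open>l\<close>, everything except the error \<epsilon> per step is
  of order l^2, while the elapsed time is at least \<open>Wt l\<close>, of order l^3.\<close>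

lemma emp_avg_tracks:
  assumes g: "continuous_on UNIV g"
  shows "(\<lambda>n. emp_avg g n (pt \<omega>) - gbar g (wavg q (lev T n))) \<longlonglongrightarrow> 0"
proof (rule LIMSEQ_I)
  fix e :: real assume e: "e > 0"
  define \<epsilon> where "\<epsilon> = e / 2"
  have \<epsilon>: "\<epsilon> > 0" using e by (simp add: \<epsilon>_def)
  have cpt: "compact (g ` {0..1})"
    using g by (intro compact_continuous_image) (auto intro: continuous_on_subset)
  then obtain B where "\<forall>y\<in>g ` {0..1}. norm y \<le> B"
    using compact_imp_bounded[OF cpt] unfolding bounded_iff by blast
  then have B: "\<bar>g x\<bar> \<le> B" if "x \<in> {0..1}" for x using that by simp
  have B0: "B \<ge> 0" using B[of 0] by auto
  obtain R :: nat where R: "\<And>n j z. R \<le> n \<Longrightarrow> z \<in> {0..1} \<Longrightarrow> \<bar>g (psi (replicate n j) z) - g (xi j)\<bar> \<le> \<epsilon>"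
    using runs_near_fixed_points[OF g \<epsilon>] by blast
  define C1 where "C1 = B * (real N + 1)"
  define C2 where "C2 = 6 * B * R + 4 * B + 3 * \<epsilon>"
  have C: "C1 \<ge> 0" "C2 \<ge> 0" unfolding C1_def C2_def using B0 \<epsilon> by auto
  have at_T: "\<bar>birk g (T l) (pt \<omega>) - Wt l * gbar g (wavg q l)\<bar> \<le> (C1 + C2) * (real l)\<^sup>2 + \<epsilon> * Wt l" for l
  proof -
    have "\<bar>birk g (T l) (pt \<omega>) - (\<Sum>i<l. real (i\<^sup>2) * gbar g (q i))\<bar> \<le> real l * (C1 * real l + C2) + \<epsilon> * Wt l"
    proof (induction l)
      case (Suc l)
      have "\<bar>wsum g (stage \<omega> l) (tpt \<omega> (Suc l)) - real (l\<^sup>2) * gbar g (q l)\<bar> \<le> C1 * real l + C2 + \<epsilon> * real (l\<^sup>2)"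
        unfolding C1_def C2_def by (rule wsum_stage[OF B R tpt_in_01])
      moreover have "real l * (C1 * real l + C2) + (C1 * real l + C2) \<le> real (Suc l) * (C1 * real (Suc l) + C2)"
        using C by (simp add: algebra_simps)
      ultimately show ?case
        using Suc unfolding birk_T_Suc Wt_def sum.lessThan_Suc distrib_left abs_le_iff
        by (intro conjI; elim conjE; linarith)
    qed (simp add: birk_def Wt_def)
    also have "real l * (C1 * real l + C2) \<le> (C1 + C2) * (real l)\<^sup>2"
    proof -
      have "C2 * real l \<le> C2 * (real l)\<^sup>2"
        using C by (intro mult_left_mono) (cases l, auto simp: power2_eq_square)
      then show ?thesis by (simp add: algebra_simps power2_eq_square)
    qed
    finally show ?thesis unfolding gbar_wavg by simp
  qed
  \<comment> \<open>The summands account for the completed stages, for the unfinished stage, and for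
    replacing \<open>Wt l\<close> by \<open>n\<close>, where 2N + 11 = (N + 5) + (N + 6).\<close>
  define K where "K = C1 + C2 + B * (real N + 6) + B * (2 * real N + 11)"
  have main: "\<bar>emp_avg g n (pt \<omega>) - gbar g (wavg q l)\<bar> \<le> K * (real l)\<^sup>2 / Wt l + \<epsilon>"
    if l: "l = lev T n" "l \<ge> 2" for n l
  proof -
    have Tn: "T l \<le> n" "n < T (Suc l)" unfolding l(1) using lev_bounds[OF T_strict_mono T_0] by auto
    have n_up: "real n \<le> T l + (real N + 6) * (real l)\<^sup>2"
    proof -
      have "real n \<le> real (T (Suc l))" using Tn(2) by simp
      also have "\<dots> \<le> T l + (real (l\<^sup>2) + 4 + (real N + 1) * real l)"
        using length_stage_bounds(2)[of l] by (simp add: T_Suc)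
      also have "\<dots> \<le> T l + (real N + 6) * (real l)\<^sup>2"
      proof -
        have "1 * 1 \<le> real l * real l" "1 * real l \<le> real l * real l"
          using l(2) by (intro mult_mono; simp)+
        moreover have "real N * real l \<le> real N * (real l * real l)" using l(2) by (intro mult_left_mono) auto
        ultimately show ?thesis by (simp add: power2_eq_square algebra_simps)
      qed
      finally show ?thesis .
    qed
    have W: "Wt l > 0" using l(2) by (rule Wt_pos)
    have nW: "Wt l \<le> n" using T_bounds(1)[of l] Tn(1) by linarith
    then have n0: "real n > 0" using W by linarith
    have gb: "\<bar>gbar g (wavg q l)\<bar> \<le> B"
      using B wavg_in_simplexS[OF q l(2)] by (rule gbar_abs_le)
    have "\<bar>birk g n (pt \<omega>) - birk g (T l) (pt \<omega>)\<bar> \<le> B * (real n - T l)"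
      by (rule birk_diff_le[OF B Tn(1)])
    also have "\<dots> \<le> B * ((real N + 6) * (real l)\<^sup>2)" using n_up B0 by (intro mult_left_mono) auto
    finally have 1: "\<bar>birk g n (pt \<omega>) - birk g (T l) (pt \<omega>)\<bar> \<le> B * (real N + 6) * (real l)\<^sup>2"
      by (simp add: mult.assoc)
    have "\<bar>(Wt l - n) * gbar g (wavg q l)\<bar> \<le> ((2 * real N + 11) * (real l)\<^sup>2) * B"
      unfolding abs_mult
    proof (intro mult_mono gb)
      show "\<bar>Wt l - n\<bar> \<le> (2 * real N + 11) * (real l)\<^sup>2"
        using nW n_up T_bounds(2)[of l] by (simp add: algebra_simps)
    qed auto
    then have 2: "\<bar>Wt l * gbar g (wavg q l) - n * gbar g (wavg q l)\<bar> \<le> B * (2 * real N + 11) * (real l)\<^sup>2"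
      by (simp add: algebra_simps)
    have 3: "\<bar>birk g n (pt \<omega>) - n * gbar g (wavg q l)\<bar> \<le> K * (real l)\<^sup>2 + \<epsilon> * Wt l"
    proof -
      have "\<bar>birk g n (pt \<omega>) - n * gbar g (wavg q l)\<bar> \<le> B * (real N + 6) * (real l)\<^sup>2
          + ((C1 + C2) * (real l)\<^sup>2 + \<epsilon> * Wt l) + B * (2 * real N + 11) * (real l)\<^sup>2"
        using 1 2 at_T[of l] by linarith
      then show ?thesis unfolding K_def by (simp add: algebra_simps)
    qed
    have "emp_avg g n (pt \<omega>) - gbar g (wavg q l) = (birk g n (pt \<omega>) - n * gbar g (wavg q l)) / n"
      using n0 by (simp add: emp_avg_def birk_def field_simps)
    then have "\<bar>emp_avg g n (pt \<omega>) - gbar g (wavg q l)\<bar> = \<bar>birk g n (pt \<omega>) - n * gbar g (wavg q l)\<bar> / n"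
      by simp
    also have "\<dots> \<le> (K * (real l)\<^sup>2 + \<epsilon> * Wt l) / Wt l"
      using 3 nW W by (intro frac_le) auto
    also have "\<dots> = K * (real l)\<^sup>2 / Wt l + \<epsilon>" using W by (simp add: field_simps)
    finally show ?thesis .
  qed
  have "(\<lambda>l. K * (real l)\<^sup>2 / Wt l) \<longlonglongrightarrow> 0" unfolding Wt_eq by real_asymp
  then have "\<forall>\<^sub>F l in sequentially. K * (real l)\<^sup>2 / Wt l < \<epsilon>"
    using \<epsilon> by (rule order_tendstoD(2))
  moreover have "\<forall>\<^sub>F l in sequentially. l \<ge> 2" by (rule eventually_ge_at_top)
  ultimately have "\<forall>\<^sub>F l in sequentially. K * (real l)\<^sup>2 / Wt l < \<epsilon> \<and> l \<ge> 2" by (rule eventually_conj)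
  then have "\<forall>\<^sub>F n in sequentially. K * (real (lev T n))\<^sup>2 / Wt (lev T n) < \<epsilon> \<and> lev T n \<ge> 2"
    using filterlim_lev[OF T_strict_mono T_0] by (rule eventually_compose_filterlim)
  then have "\<forall>\<^sub>F n in sequentially. norm (emp_avg g n (pt \<omega>) - gbar g (wavg q (lev T n)) - 0) < e"
  proof (rule eventually_mono)
    fix n assume a: "K * (real (lev T n))\<^sup>2 / Wt (lev T n) < \<epsilon> \<and> lev T n \<ge> 2"
    show "norm (emp_avg g n (pt \<omega>) - gbar g (wavg q (lev T n)) - 0) < e"
      using main[OF refl conjunct2[OF a]] conjunct1[OF a] unfolding \<epsilon>_def real_norm_def diff_zero by linarith
  qed
  then show "\<exists>no. \<forall>n\<ge>no. norm (emp_avg g n (pt \<omega>) - gbar g (wavg q (lev T n)) - 0) < e"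
    unfolding eventually_sequentially .
qed

end

section \<open>Point masses at the fixed points\<close>

definition wt :: "vec3 \<Rightarrow> sym \<Rightarrow> real" where
  "wt p j = (case j of Lf \<Rightarrow> fst p | Md \<Rightarrow> fst (snd p) | Rt \<Rightarrow> snd (snd p))"

lemma sum_sym: "(\<Sum>j\<in>(UNIV :: sym set). F j) = F Lf + F Md + (F Rt :: 'a :: comm_monoid_add)"
  unfolding UNIV_sym by (simp add: add.assoc)

lemma wt_nonneg: "p \<in> simplexS \<Longrightarrow> 0 \<le> wt p j"
  using simplexS_D[of p] by (cases j) (auto simp: wt_def)

text \<open>\<open>measure_of\<close> takes its function as the measure only if that function is
  countably additive. As the image of a measure on three points, \<open>nu p\<close> inherits this,
  and its integrals become finite sums.\<close>

lemma nu_eq_distr: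
  assumes "p \<in> simplexS"
  shows "nu p = distr (point_measure UNIV (\<lambda>j. ennreal (wt p j))) borel xi" (is "_ = ?M")
proof -
  let ?P = "point_measure UNIV (\<lambda>j. ennreal (wt p j))"
  have m: "xi \<in> measurable ?P borel" by (simp add: measurable_def space_point_measure sets_point_measure)
  have "emeasure ?M A = ennreal (fst p) * indicator A 0 + ennreal (fst (snd p)) * indicator A (1/2)
      + ennreal (snd (snd p)) * indicator A 1" if "A \<in> sets borel" for A
  proof -
    have "emeasure ?M A = emeasure ?P {j. xi j \<in> A}"
      using emeasure_distr[OF m that] by (simp add: space_point_measure vimage_def)
    also have "\<dots> = (\<Sum>j | xi j \<in> A. ennreal (wt p j))"
      by (rule emeasure_point_measure_finite) auto
    also have "\<dots> = (\<Sum>j\<in>UNIV. ennreal (wt p j) * indicator A (xi j))"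
      by (intro sum.mono_neutral_cong_left) (auto simp: indicator_def)
    finally show ?thesis by (simp add: sum_sym wt_def xi_def)
  qed
  then have "nu p = measure_of UNIV (sets borel) (emeasure ?M)"
    unfolding nu_def using sets.sigma_sets_eq[of "borel :: real measure"]
    by (intro measure_of_eq) auto
  also have "\<dots> = ?M" using measure_of_of_measure[of ?M] by simp
  finally show ?thesis .
qed

lemma integral_nu:
  fixes g :: "real \<Rightarrow> 'b :: {banach, second_countable_topology}"
  assumes "p \<in> simplexS" "g \<in> borel_measurable borel"
  shows "integral\<^sup>L (nu p) g = fst p *\<^sub>R g 0 + fst (snd p) *\<^sub>R g (1/2) + snd (snd p) *\<^sub>R g 1"
proof -
  have m: "xi \<in> measurable (point_measure UNIV (\<lambda>j. ennreal (wt p j))) borel"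
    by (simp add: measurable_def space_point_measure sets_point_measure)
  have "integral\<^sup>L (nu p) g = integral\<^sup>L (point_measure UNIV (\<lambda>j. ennreal (wt p j))) (\<lambda>j. g (xi j))"
    unfolding nu_eq_distr[OF assms(1)] by (rule integral_distr[OF m assms(2)])
  also have "\<dots> = (\<Sum>j\<in>UNIV. wt p j *\<^sub>R g (xi j))"
    by (rule lebesgue_integral_point_measure_finite) (auto intro: wt_nonneg[OF assms(1)])
  finally show ?thesis by (simp add: sum_sym wt_def xi_def)
qed

lemma integral_nu_gbar:
  "p \<in> simplexS \<Longrightarrow> continuous_on UNIV g \<Longrightarrow> integral\<^sup>L (nu p) g = gbar g p"
  by (simp add: integral_nu borel_measurable_continuous_onI gbar_def)

lemma prob_meas01_nu:
  assumes "p \<in> simplexS"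
  shows "prob_meas01 (nu p)"
proof -
  let ?P = "point_measure UNIV (\<lambda>j. ennreal (wt p j))"
  note p = simplexS_D[OF assms]
  have m: "xi \<in> measurable ?P borel" by (simp add: measurable_def space_point_measure sets_point_measure)
  have one: "emeasure ?P UNIV = 1"
  proof -
    have "emeasure ?P UNIV = (\<Sum>j\<in>UNIV. ennreal (wt p j))" by (rule emeasure_point_measure_finite) auto
    also have "\<dots> = ennreal (\<Sum>j\<in>UNIV. wt p j)" using wt_nonneg[OF assms] by (intro sum_ennreal) auto
    also have "(\<Sum>j\<in>UNIV. wt p j) = 1" using p(7) by (simp add: sum_sym wt_def)
    finally show ?thesis by simp
  qed
  then have "prob_space ?P" by (intro prob_spaceI) (simp add: space_point_measure)
  then have "prob_space (nu p)" unfolding nu_eq_distr[OF assms] using m by (rule prob_space.prob_space_distr)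
  moreover have "emeasure (nu p) {0..1} = 1"
  proof -
    have "xi -` {0..1} \<inter> space ?P = UNIV"
      using xi_in_01 by (auto simp: space_point_measure simp del: atLeastAtMost_iff)
    then show ?thesis unfolding nu_eq_distr[OF assms] using emeasure_distr[OF m, of "{0..1}"] one
      by (simp add: space_point_measure)
  qed
  ultimately show ?thesis unfolding prob_meas01_def by (simp add: nu_eq_distr[OF assms])
qed

text \<open>Real and imaginary part of the characteristic function are integrals of cosines and
  sines, which are continuous test functions; Levy's uniqueness theorem does the rest.\<close>

lemma measure_eq_nuI:
  assumes \<mu>: "prob_meas01 \<mu>" and p: "p \<in> simplexS"
    and eq: "\<And>g. continuous_on UNIV g \<Longrightarrow> integral\<^sup>L \<mu> g = gbar g p"
  shows "\<mu> = nu p"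
proof (rule Levy_uniqueness)
  have rd: "real_distribution M" if "prob_meas01 M" for M
    using that unfolding prob_meas01_def real_distribution_def real_distribution_axioms_def by blast
  show rdm: "real_distribution \<mu>" "real_distribution (nu p)"
    using rd \<mu> prob_meas01_nu[OF p] by auto
  have char_parts: "Re (char M t) = (\<integral>x. cos (t * x) \<partial>M)" "Im (char M t) = (\<integral>x. sin (t * x) \<partial>M)"
    if "real_distribution M" for M t
  proof -
    interpret real_distribution M by fact
    have i: "integrable M (\<lambda>x. iexp (t * x))" by (intro integrable_iexp) auto
    show "Re (char M t) = (\<integral>x. cos (t * x) \<partial>M)" "Im (char M t) = (\<integral>x. sin (t * x) \<partial>M)"
      unfolding char_def using integral_Re[OF i] integral_Im[OF i] by (simp_all add: Re_exp Im_exp)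
  qed
  show "char \<mu> = char (nu p)"
  proof
    fix t :: real
    have c1: "continuous_on UNIV (\<lambda>x :: real. cos (t * x))" by (intro continuous_intros)
    have c2: "continuous_on UNIV (\<lambda>x :: real. sin (t * x))" by (intro continuous_intros)
    show "char \<mu> t = char (nu p) t"
      using rdm by (intro complex_eqI) (simp_all add: char_parts eq c1 c2 integral_nu_gbar[OF p])
  qed
qed

section \<open>Frequency sequences with prescribed limit set\<close>

text \<open>Being joined by an \<open>e\<close>-chain is an equivalence relation with open classes,
  so a connected set is a single class.\<close>

lemma chain_connected:
  fixes C :: "'a :: metric_space set"
  assumes "connected C" "a \<in> C" "b \<in> C" "e > 0"
  shows "(a, b) \<in> {(x, y). x \<in> C \<and> y \<in> C \<and> dist x y < e}\<^sup>+"
proof -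
  define R where "R = {(x, y). x \<in> C \<and> y \<in> C \<and> dist x y < e}"
  have "sym R" unfolding R_def by (auto simp: sym_def dist_commute)
  show ?thesis unfolding R_def[symmetric] using assms(1-3)
  proof (rule connected_equivalence_relation)
    show "(y, x) \<in> R\<^sup>+" if "(x, y) \<in> R\<^sup>+" for x y
      using sym_trancl[OF \<open>sym R\<close>] that by (rule symD)
    show "(x, z) \<in> R\<^sup>+" if "(x, y) \<in> R\<^sup>+" "(y, z) \<in> R\<^sup>+" for x y z
      using that by (rule trancl_trans)
    show "\<exists>T. openin (top_of_set C) T \<and> x \<in> T \<and> (\<forall>y\<in>T. (x, y) \<in> R\<^sup>+)" if "x \<in> C" for x
    proof (intro exI conjI ballI)
      show "openin (top_of_set C) (C \<inter> ball x e)" by (intro openin_open_Int) auto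
      show "x \<in> C \<inter> ball x e" using that assms(4) by simp
      show "(x, y) \<in> R\<^sup>+" if "y \<in> C \<inter> ball x e" for y
        using that \<open>x \<in> C\<close> by (intro r_into_trancl) (auto simp: R_def)
    qed
  qed
qed

text \<open>Consecutive targets are joined by chains in \<open>C\<close> whose mesh tends to 0. The
  targets run through a countable dense set by way of \<open>prod_decode\<close>, which repeats each
  of its points infinitely often, so late targets are still dense.\<close>

lemma dense_slow_sequence:
  fixes C :: "'a :: {metric_space, second_countable_topology} set"
  assumes "connected C" "C \<noteq> {}"
  obtains t :: "nat \<Rightarrow> 'a" where "\<And>k. t k \<in> C" "(\<lambda>k. dist (t k) (t (Suc k))) \<longlonglongrightarrow> 0"
    "\<And>c e K. c \<in> C \<Longrightarrow> e > 0 \<Longrightarrow> \<exists>k\<ge>K. dist (t k) c < e"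
proof -
  obtain D where D: "countable D" "D \<subseteq> C" "C \<subseteq> closure D" using separable by metis
  have "D \<noteq> {}" using D assms(2) by auto
  then obtain d :: "nat \<Rightarrow> 'a" where d: "range d = D" using D(1) by (metis range_from_nat_into)
  define tgt where "tgt m = d (fst (prod_decode m))" for m
  have tgt_C: "tgt m \<in> C" for m unfolding tgt_def using d D(2) by auto
  have tgt_dense: "\<exists>m\<ge>K. dist (tgt m) c < e" if cC: "c \<in> C" and e0: "e > 0" for c e K
  proof -
    have "c \<in> closure D" using D(3) cC by blast
    then obtain y where "y \<in> D" "dist y c < e" using e0 unfolding closure_approachable by blast
    then obtain n where "dist (d n) c < e" using d by auto
    then show ?thesis
      by (intro exI[of _ "prod_encode (n, K)"]) (simp add: tgt_def le_prod_encode_2)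
  qed
  define R where "R m = {(x, y). x \<in> C \<and> y \<in> C \<and> dist x y < 1 / real (Suc m)}" for m
  have "\<exists>n f. n > 0 \<and> f 0 = tgt m \<and> f n = tgt (Suc m) \<and> (\<forall>i<n. (f i, f (Suc i)) \<in> R m)" for m
  proof -
    have "(tgt m, tgt (Suc m)) \<in> (R m)\<^sup>+"
      unfolding R_def using tgt_C assms(1) by (intro chain_connected) auto
    then obtain n where "n > 0" "(tgt m, tgt (Suc m)) \<in> R m ^^ n" unfolding trancl_power by blast
    then show ?thesis unfolding relpow_fun_conv by blast
  qed
  then obtain len f where lf: "\<And>m. len m > 0" "\<And>m. f m 0 = tgt m" "\<And>m. f m (len m) = tgt (Suc m)"
    "\<And>m i. i < len m \<Longrightarrow> (f m i, f m (Suc i)) \<in> R m"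
    by metis
  define S where "S m = (\<Sum>i<m. len i)" for m
  have S0: "S 0 = 0" and SSuc: "S (Suc m) = S m + len m" for m by (simp_all add: S_def)
  have S: "strict_mono S" by (intro strict_monoI_Suc) (simp add: SSuc lf(1))
  define t where "t k = f (lev S k) (k - S (lev S k))" for k
  have step: "(t k, t (Suc k)) \<in> R (lev S k)" for k
  proof -
    define m where "m = lev S k"
    have m: "S m \<le> k" "k < S (Suc m)" unfolding m_def using lev_bounds[OF S S0] by auto
    have tS: "t (Suc k) = f m (Suc (k - S m))"
    proof (cases "Suc k < S (Suc m)")
      case True
      then have "lev S (Suc k) = m" using m by (intro lev_eq[OF S S0]) auto
      then show ?thesis unfolding t_def using m by (simp add: Suc_diff_le)
    next
      \<comment> \<open>At the last step of chain \<open>m\<close> the next time already belongs to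
        chain \<open>Suc m\<close>, which starts where chain \<open>m\<close> ends.\<close>
      case False
      then have e: "Suc k = S (Suc m)" using m by simp
      then have "lev S (Suc k) = Suc m" using lf(1) by (intro lev_eq[OF S S0]) (auto simp: SSuc)
      then have "t (Suc k) = tgt (Suc m)" unfolding t_def using e lf(2) by simp
      moreover have "Suc (k - S m) = len m" using e m(1) SSuc[of m] by simp
      ultimately show ?thesis using lf(3)[of m] by simp
    qed
    have "k - S m < len m" using m SSuc[of m] by simp
    then show ?thesis using lf(4)[of "k - S m" m] tS unfolding t_def m_def[symmetric] by simp
  qed
  show ?thesis
  proof (rule that)
    show "t k \<in> C" for k using step[of k] unfolding R_def by auto
    show "(\<lambda>k. dist (t k) (t (Suc k))) \<longlonglongrightarrow> 0"
    proof (rule tendsto_sandwich[of "\<lambda>_. 0" _ _ "\<lambda>k. 1 / real (Suc (lev S k))"])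
      show "\<forall>\<^sub>F k in sequentially. dist (t k) (t (Suc k)) \<le> 1 / real (Suc (lev S k))"
      proof (rule always_eventually, rule allI)
        show "dist (t k) (t (Suc k)) \<le> 1 / real (Suc (lev S k))" for k
          using step[of k] unfolding R_def by simp
      qed
      show "(\<lambda>k. 1 / real (Suc (lev S k))) \<longlonglongrightarrow> 0"
        using LIMSEQ_Suc[OF lim_1_over_n] filterlim_lev[OF S S0] by (rule filterlim_compose)
    qed auto
    show "\<exists>k\<ge>K. dist (t k) c < e" if cC: "c \<in> C" and e0: "e > 0" for c e K
    proof -
      obtain m where m: "m \<ge> K" "dist (tgt m) c < e" using tgt_dense[OF cC e0] by blast
      have "lev S (S m) = m" using lf(1) by (intro lev_eq[OF S S0]) (auto simp: SSuc)
      then have "t (S m) = tgt m" unfolding t_def using lf(2) by simp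
      moreover have "S m \<ge> K" using strict_mono_imp_increasing[OF S, of m] m(1) by simp
      ultimately show ?thesis using m(2) by (intro exI[of _ "S m"]) simp
    qed
  qed
qed

text \<open>\<open>q\<close> rests at the \<open>k\<close>-th point of the slow sequence from
  \<open>hold k\<close> to \<open>hold (Suc k)\<close>. The factor makes \<open>Wt\<close> grow at
  least \<open>Suc k\<close> times during the rest, so the past is forgotten; the \<open>+ 1\<close>
  moves the sequence off 0.\<close>

primrec hold :: "nat \<Rightarrow> nat" where
  "hold 0 = 0"
| "hold (Suc k) = (k + 2) * (hold k + 1)"

lemma strict_mono_hold: "strict_mono hold"
  by (intro strict_monoI_Suc) simp

lemma Wt_mult_ge: "m \<ge> 1 \<Longrightarrow> n \<ge> 1 \<Longrightarrow> real m * Wt n \<le> Wt (m * n)"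
proof -
  assume m: "m \<ge> 1" and n: "n \<ge> 1"
  then have "1 * real n \<le> real m * real n" by (intro mult_right_mono) auto
  moreover from this have "1 \<le> real m * real n" using n by linarith
  ultimately have "(real n - 1) * (2 * real n - 1) \<le> (real m * real n - 1) * (2 * (real m * real n) - 1)"
    using n by (intro mult_mono) auto
  then have le: "real m * real n * ((real n - 1) * (2 * real n - 1))
      \<le> real m * real n * ((real m * real n - 1) * (2 * (real m * real n) - 1))"
    by (intro mult_left_mono) auto
  have "real m * Wt n = real m * real n * ((real n - 1) * (2 * real n - 1)) / 6"
    and "Wt (m * n) = real m * real n * ((real m * real n - 1) * (2 * (real m * real n) - 1)) / 6"
    unfolding Wt_eq by simp_all
  then show ?thesis using divide_right_mono[OF le, of 6] by linarith
qed

lemma Wt_mono: "m \<le> n \<Longrightarrow> Wt m \<le> Wt n"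
  unfolding Wt_def by (intro sum_mono2) auto

lemma Wt_hold_Suc: "real (Suc k) * Wt (hold k) \<le> Wt (hold (Suc k))"
proof -
  have "real (Suc k) * Wt (hold k) \<le> real (k + 2) * Wt (hold k + 1)"
    by (intro mult_mono Wt_mono) (auto simp: Wt_def sum_nonneg)
  also have "\<dots> \<le> Wt (hold (Suc k))" using Wt_mult_ge[of "k + 2" "hold k + 1"] by simp
  finally show ?thesis .
qed

lemma hold_ge_2: "k \<ge> 1 \<Longrightarrow> hold k \<ge> 2"
  by (cases k) auto

lemma norm_simplexS_le: "p \<in> simplexS \<Longrightarrow> norm p \<le> 1"
proof -
  assume "p \<in> simplexS"
  note p = simplexS_D[OF this]
  have "norm p \<le> norm (fst p) + norm (snd p)" using norm_Pair_le[of "fst p" "snd p"] by simp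
  also have "norm (snd p) \<le> norm (fst (snd p)) + norm (snd (snd p))"
    using norm_Pair_le[of "fst (snd p)" "snd (snd p)"] by simp
  finally show ?thesis using p by simp
qed

text \<open>While \<open>q\<close> rests at \<open>t k\<close>, each new term leaves
  \<open>Wt l *\<^sub>R (wavg q l - t k)\<close> unchanged, so the deviation shrinks as
  \<open>Wt\<close> grows.\<close>

lemma wavg_hold:
  assumes t: "\<And>k. t k \<in> simplexS" and k: "k \<ge> 1" and l: "hold k \<le> l" "l \<le> hold (Suc k)"
  defines "q \<equiv> \<lambda>i. t (lev hold i)"
  shows "norm (wavg q l - t k) = Wt (hold k) / Wt l * norm (wavg q (hold k) - t k)"
proof -
  have "Wt l *\<^sub>R (wavg q l - t k) = Wt (hold k) *\<^sub>R (wavg q (hold k) - t k)"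
    using l
  proof (induction l rule: dec_induct)
    case (step l)
    have "q l = t k" unfolding q_def using step by (subst lev_eq[OF strict_mono_hold, of k]) auto
    then have "Wt (Suc l) *\<^sub>R (wavg q (Suc l) - t k) = Wt l *\<^sub>R (wavg q l - t k)"
      unfolding scaleR_diff_right wavg_scaled by (simp add: Wt_def scaleR_add_left)
    then show ?case using step by simp
  qed simp
  then have "\<bar>Wt l\<bar> * norm (wavg q l - t k) = \<bar>Wt (hold k)\<bar> * norm (wavg q (hold k) - t k)"
    by (metis norm_scaleR)
  moreover have "Wt l > 0" "Wt (hold k) > 0" using l hold_ge_2[OF k] by (auto intro!: Wt_pos)
  ultimately show ?thesis by (simp add: field_simps)
qed

text \<open>\<open>\<delta> k\<close> is the deviation when the rest at \<open>t k\<close> begins.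
  By the end of that rest the average is within 2/(k + 1) of \<open>t k\<close>, and moving on to
  \<open>t (Suc k)\<close> adds one small step; so \<delta> tends to 0. During the rest the
  deviation never exceeds \<open>\<delta> k\<close>, hence the averages shadow the slow sequence and
  come as close to every point of \<open>C\<close>.\<close>

lemma exists_frequency_sequence:
  assumes C: "C \<subseteq> simplexS" "C \<noteq> {}" "connected C"
  obtains q c :: "nat \<Rightarrow> vec3" where "\<And>i. q i \<in> simplexS" "\<And>l. c l \<in> C"
    "(\<lambda>l. wavg q l - c l) \<longlonglongrightarrow> 0" "\<And>p e K. p \<in> C \<Longrightarrow> e > 0 \<Longrightarrow> \<exists>l\<ge>K. dist (wavg q l) p < e"
proof -
  obtain t where t: "\<And>k. t k \<in> C" "(\<lambda>k. dist (t k) (t (Suc k))) \<longlonglongrightarrow> 0"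
    "\<And>c e K. c \<in> C \<Longrightarrow> e > 0 \<Longrightarrow> \<exists>k\<ge>K. dist (t k) c < e"
    using dense_slow_sequence[OF C(3,2)] by blast
  have tS: "t k \<in> simplexS" for k using t(1) C(1) by auto
  define q where "q i = t (lev hold i)" for i
  have q: "q i \<in> simplexS" for i unfolding q_def by (rule tS)
  note hold_lev = lev_bounds[OF strict_mono_hold hold.simps(1)]
  define \<delta> where "\<delta> k = norm (wavg q (hold k) - t k)" for k
  have bound: "norm (wavg q l - t (lev hold l)) \<le> \<delta> (lev hold l)" if "lev hold l \<ge> 1" for l
  proof -
    define k where "k = lev hold l"
    have l: "hold k \<le> l" "l \<le> hold (Suc k)" and k: "k \<ge> 1"
      using hold_lev[of l] that unfolding k_def by auto
    have W: "Wt (hold k) > 0" "Wt (hold k) \<le> Wt l" using hold_ge_2[OF k] l by (auto intro!: Wt_pos Wt_mono)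
    then have "Wt (hold k) / Wt l * \<delta> k \<le> 1 * \<delta> k" by (intro mult_right_mono) (auto simp: \<delta>_def)
    then show ?thesis using wavg_hold[of t, OF tS k l] unfolding k_def[symmetric] \<delta>_def q_def by simp
  qed
  have \<delta>_Suc: "\<delta> (Suc k) \<le> 2 * (1 / real (Suc k)) + dist (t k) (t (Suc k))" if k: "k \<ge> 1" for k
  proof -
    have W: "Wt (hold k) > 0" "Wt (hold (Suc k)) > 0" using hold_ge_2[of k] hold_ge_2[of "Suc k"] k by (auto intro!: Wt_pos)
    have "norm (wavg q (hold (Suc k)) - t k) = Wt (hold k) / Wt (hold (Suc k)) * norm (wavg q (hold k) - t k)"
      unfolding q_def by (rule wavg_hold[of t, OF tS k]) (auto intro: strict_mono_leD[OF strict_mono_hold] simp del: hold.simps)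
    also have "\<dots> \<le> (1 / real (Suc k)) * 2"
    proof (intro mult_mono)
      show "Wt (hold k) / Wt (hold (Suc k)) \<le> 1 / real (Suc k)"
        using Wt_hold_Suc[of k] W by (simp add: field_simps del: hold.simps of_nat_Suc)
      show "norm (wavg q (hold k) - t k) \<le> 2"
        using norm_triangle_ineq4[of "wavg q (hold k)" "t k"] norm_simplexS_le[OF tS[of k]]
          norm_simplexS_le[OF wavg_in_simplexS[of q "hold k", OF q hold_ge_2[OF k]]] by linarith
    qed auto
    finally show ?thesis
      using norm_triangle_ineq[of "wavg q (hold (Suc k)) - t k" "t k - t (Suc k)"]
      unfolding \<delta>_def dist_norm by simp
  qed
  have "\<delta> \<longlonglongrightarrow> 0"
  proof (subst filterlim_sequentially_Suc[symmetric], rule tendsto_sandwich[of "\<lambda>_. 0"])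
    show "\<forall>\<^sub>F k in sequentially. \<delta> (Suc k) \<le> 2 * (1 / real (Suc k)) + dist (t k) (t (Suc k))"
      using eventually_ge_at_top[of 1] by (rule eventually_mono) (rule \<delta>_Suc)
    show "(\<lambda>k. 2 * (1 / real (Suc k)) + dist (t k) (t (Suc k))) \<longlonglongrightarrow> 0"
      using tendsto_add[OF tendsto_mult[OF tendsto_const LIMSEQ_Suc[OF lim_1_over_n]] t(2), of 2] by simp
  qed (auto simp: \<delta>_def)
  then have \<delta>_lev: "(\<lambda>l. \<delta> (lev hold l)) \<longlonglongrightarrow> 0"
    using filterlim_lev[OF strict_mono_hold hold.simps(1)] by (rule filterlim_compose)
  show ?thesis
  proof (rule that[of q "\<lambda>l. t (lev hold l)"])
    show "(\<lambda>l. wavg q l - t (lev hold l)) \<longlonglongrightarrow> 0"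
    proof (rule Lim_null_comparison[OF _ \<delta>_lev])
      have "\<forall>\<^sub>F l in sequentially. lev hold l \<ge> 1"
        using filterlim_lev[OF strict_mono_hold hold.simps(1)] unfolding filterlim_at_top by blast
      then show "\<forall>\<^sub>F l in sequentially. norm (wavg q l - t (lev hold l)) \<le> \<delta> (lev hold l)"
        by (rule eventually_mono) (rule bound)
    qed
    show "\<exists>l\<ge>K. dist (wavg q l) p < e" if p: "p \<in> C" "e > 0" for p e K
    proof -
      have "\<forall>\<^sub>F k in sequentially. \<delta> k < e / 2" using \<open>\<delta> \<longlonglongrightarrow> 0\<close> p(2) by (intro order_tendstoD(2)) auto
      then obtain K' where K': "\<And>k. k \<ge> K' \<Longrightarrow> \<delta> k < e / 2" unfolding eventually_sequentially by blast
      obtain k where k: "k \<ge> max K K'" "dist (t k) p < e / 2" using t(3)[OF p(1), of "e / 2" "max K K'"] p(2) by auto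
      have "dist (wavg q (hold k)) (t k) < e / 2" using K'[of k] k(1) unfolding \<delta>_def dist_norm by simp
      then have "dist (wavg q (hold k)) p < e" using k(2) dist_triangle[of "wavg q (hold k)" p "t k"] by linarith
      moreover have "hold k \<ge> K" using strict_mono_imp_increasing[OF strict_mono_hold, of k] k(1) by simp
      ultimately show ?thesis by blast
    qed
  qed (use q t(1) in auto)
qed

section \<open>Hausdorff dimension\<close>

text \<open>Covering the unit interval by \<open>n\<close> intervals of length 1/n costs n^(1-s),
  which tends to 0.\<close>

lemma hausdorff_measure_eq_0:
  assumes A: "A \<subseteq> {0..1}" and s: "s > 1"
  shows "hausdorff_measure s A = 0"
proof -
  have "hausdorff_pre s \<delta> A = 0" if \<delta>: "\<delta> > 0" for \<delta>
  proof -
    define U where "U n i = (if i < n then {real i / n..real (Suc i) / n} else {})" for n i :: nat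
    have pre_le: "hausdorff_pre s \<delta> A \<le> ennreal (real n * (1 / real n) powr s)" if n: "n > 0" "1 / real n \<le> \<delta>" for n
    proof -
      have diam: "diameter (U n i) = 1 / real n" if "i < n" for i
        using that by (simp add: U_def field_simps)
      have "A \<subseteq> (\<Union>i. U n i)"
      proof
        fix x assume "x \<in> A"
        then have x: "0 \<le> x" "x \<le> 1" using A by auto
        have "\<exists>i<n. real i / n \<le> x \<and> x \<le> real (Suc i) / n"
        proof (cases "x = 1")
          case True
          then show ?thesis using n by (intro exI[of _ "n - 1"]) (auto simp: field_simps of_nat_diff)
        next
          case False
          define i where "i = nat \<lfloor>x * n\<rfloor>"
          have "x * n < n" using False x n by (simp add: mult_less_cancel_right2)
          moreover have "0 \<le> x * n" using x by simp
          ultimately have "i < n" "real i \<le> x * n" "x * n \<le> real (Suc i)" unfolding i_def by linarith+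
          then show ?thesis using n by (intro exI[of _ i]) (auto simp: field_simps)
        qed
        then show "x \<in> (\<Union>i. U n i)" unfolding U_def by auto
      qed
      moreover have "bounded (U n i) \<and> diameter (U n i) \<le> \<delta>" for i
        using diam[of i] n \<delta> by (cases "i < n") (auto simp: U_def)
      ultimately have "hausdorff_pre s \<delta> A \<le> (\<Sum>i. hterm s (U n i))"
        unfolding hausdorff_pre_def by (intro INF_lower) auto
      also have "\<dots> = (\<Sum>i<n. hterm s (U n i))"
        by (intro suminf_finite) (auto simp: hterm_def U_def)
      also have "\<dots> = (\<Sum>i<n. ennreal ((1 / real n) powr s))"
      proof (intro sum.cong refl)
        fix i assume "i \<in> {..<n}"
        moreover from this have "U n i \<noteq> {}" by (auto simp: U_def divide_right_mono)
        ultimately show "hterm s (U n i) = ennreal ((1 / real n) powr s)"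
          using s diam[of i] by (simp add: hterm_def)
      qed
      also have "\<dots> = ennreal (real n * (1 / real n) powr s)"
        by (simp add: ennreal_of_nat_eq_real_of_nat ennreal_mult)
      finally show ?thesis .
    qed
    have "(\<lambda>n. ennreal (real n * (1 / real n) powr s)) \<longlonglongrightarrow> ennreal 0"
      using s by (intro tendsto_ennrealI) real_asymp
    moreover have "\<forall>\<^sub>F n in sequentially. hausdorff_pre s \<delta> A \<le> ennreal (real n * (1 / real n) powr s)"
    proof -
      have "\<forall>\<^sub>F n in sequentially. 1 / real n < \<delta>"
        using lim_1_over_n \<delta> by (rule order_tendstoD(2))
      then show ?thesis using eventually_gt_at_top[of 0]
        by eventually_elim (rule pre_le, auto)
    qed
    ultimately have "hausdorff_pre s \<delta> A \<le> ennreal 0"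
      by (intro tendsto_lowerbound[of _ _ sequentially]) auto
    then show ?thesis by simp
  qed
  then show ?thesis unfolding hausdorff_measure_def by simp
qed

lemma hausdorff_dim_eq_1:
  assumes A: "A \<subseteq> {0..1}" and pos: "\<And>s. 0 \<le> s \<Longrightarrow> s < 1 \<Longrightarrow> hausdorff_measure s A \<noteq> 0"
  shows "hausdorff_dim A = 1"
  unfolding hausdorff_dim_def
proof (rule cInf_eq)
  show "1 \<le> x" if "x \<in> {s. 0 \<le> s \<and> hausdorff_measure s A = 0}" for x
    using that pos[of x] by fastforce
  show "y \<le> 1" if "\<And>x. x \<in> {s. 0 \<le> s \<and> hausdorff_measure s A = 0} \<Longrightarrow> y \<le> x" for y
  proof (rule field_le_epsilon)
    fix e :: real assume "e > 0"
    then show "y \<le> 1 + e" using hausdorff_measure_eq_0[OF A, of "1 + e"] by (intro that) auto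
  qed
qed

text \<open>The run bound \<open>N\<close> is found only after \<open>s\<close>, so the inclusion is
  assumed for all \<open>N\<close>.\<close>

lemma hausdorff_dim_inserted_codes:
  assumes q: "\<And>i. q i \<in> simplexS" and A: "A \<subseteq> {0..1}"
    and sub: "\<And>N. insertion.pt (rword q) ` insertion.codes N \<subseteq> A"
  shows "hausdorff_dim A = 1"
proof (rule hausdorff_dim_eq_1[OF A])
  fix s :: real assume s: "0 \<le> s" "s < 1"
  define \<beta> where "\<beta> = 1 - s"
  define \<eta> where "\<eta> = 2 powr (- \<beta> / 4)"
  have \<beta>: "0 < \<beta>" "\<beta> \<le> 1" unfolding \<beta>_def using s by auto
  have "(2::real) powr (-1) < 2 powr (- \<beta> / 4)" "(2::real) powr (- \<beta> / 4) < 2 powr 0"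
    using \<beta> by (intro powr_less_mono; simp)+
  then have \<eta>: "1/2 < \<eta>" "\<eta> < 1" unfolding \<eta>_def by (auto simp: powr_minus_divide)
  obtain N where N: "\<And>n. Zsum N n \<ge> \<eta> ^ n"
    using exists_Zsum_ge[of "1 - \<eta>"] \<eta> by auto
  interpret weighted_insertion "rword q" rtheta N \<eta>
    using insertion_rword[OF q] N \<eta> by (simp add: weighted_insertion_def weighted_insertion_axioms_def)
  have "hausdorff_measure (1 - \<beta>) A \<noteq> 0"
    using \<beta> \<eta>_def sub by (rule hausdorff_measure_nonzero)
  then show "hausdorff_measure s A \<noteq> 0" unfolding \<beta>_def by simp
qed

lemma frequent_subsequence:
  fixes P :: "nat \<Rightarrow> 'a :: metric_space"
  assumes "\<And>e K. e > 0 \<Longrightarrow> \<exists>n\<ge>K. dist (P n) p < e"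
  obtains r :: "nat \<Rightarrow> nat" where "strict_mono r" "(\<lambda>k. P (r k)) \<longlonglongrightarrow> p"
proof -
  have "\<exists>r. \<forall>k. dist (P (r k)) p < 1 / real (Suc k) \<and> r k < r (Suc k)"
  proof (rule dependent_nat_choice)
    show "\<exists>n. dist (P n) p < 1 / real (Suc 0)" using assms[of 1 0] by auto
    show "\<exists>m. dist (P m) p < 1 / real (Suc (Suc k)) \<and> n < m" for n k
      using assms[of "1 / real (Suc (Suc k))" "Suc n"] by (auto simp: Suc_le_eq)
  qed
  then obtain r where r: "\<And>k. dist (P (r k)) p < 1 / real (Suc k)" "\<And>k. r k < r (Suc k)" by blast
  have "(\<lambda>k. dist (P (r k)) p) \<longlonglongrightarrow> 0"
  proof (rule tendsto_sandwich[of "\<lambda>_. 0"])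
    show "(\<lambda>k. 1 / real (Suc k)) \<longlonglongrightarrow> 0" by (rule LIMSEQ_Suc[OF lim_1_over_n])
    show "\<forall>\<^sub>F k in sequentially. dist (P (r k)) p \<le> 1 / real (Suc k)"
      using r(1) by (intro always_eventually allI less_imp_le)
  qed auto
  then have "(\<lambda>k. P (r k)) \<longlonglongrightarrow> p" by (rule tendsto_dist_iff[THEN iffD2])
  moreover have "strict_mono r" using r(2) by (simp add: strict_mono_Suc_iff)
  ultimately show ?thesis using that by blast
qed

context tracking
begin

lemma emp_avg_tendsto:
  assumes g: "continuous_on UNIV g" and s: "filterlim s at_top sequentially"
    and P: "(\<lambda>k. wavg q (lev T (s k))) \<longlonglongrightarrow> p"
  shows "(\<lambda>k. emp_avg g (s k) (pt \<omega>)) \<longlonglongrightarrow> gbar g p"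
proof -
  have "bounded_linear (gbar g)" using linear_gbar by (simp add: linear_conv_bounded_linear)
  then have "(\<lambda>k. gbar g (wavg q (lev T (s k)))) \<longlonglongrightarrow> gbar g p"
    using P by (rule bounded_linear.tendsto)
  moreover have "(\<lambda>k. emp_avg g (s k) (pt \<omega>) - gbar g (wavg q (lev T (s k)))) \<longlonglongrightarrow> 0"
    using emp_avg_tracks[OF g] s by (rule filterlim_compose)
  ultimately show ?thesis using tendsto_add by fastforce
qed

lemma emp_conv_pt:
  assumes p: "p \<in> simplexS" and P: "wavg q \<longlonglongrightarrow> p"
  shows "emp_conv (pt \<omega>) (nu p)"
  unfolding emp_conv_def
proof (intro allI impI)
  fix g :: "real \<Rightarrow> real" assume g: "continuous_on UNIV g"
  have "(\<lambda>n. wavg q (lev T n)) \<longlonglongrightarrow> p"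
    using P filterlim_lev[OF T_strict_mono T_0] by (rule filterlim_compose)
  then show "(\<lambda>n. emp_avg g n (pt \<omega>)) \<longlonglongrightarrow> integral\<^sup>L (nu p) g"
    unfolding integral_nu_gbar[OF p g] using emp_avg_tendsto[OF g filterlim_ident] by simp
qed

text \<open>That every point of \<open>C\<close> occurs is seen at the stage starts
  \<open>T l\<close>, where the averages approach it again and again. Conversely, along a sequence
  defining a limit measure the shadowing points \<open>c\<close> have a subsequence converging in
  \<open>C\<close> by compactness, and its limit fixes all test integrals.\<close>

lemma Vset_pt:
  assumes C: "C \<subseteq> simplexS" "compact C"
    and c: "\<And>l. c l \<in> C" "(\<lambda>l. wavg q l - c l) \<longlonglongrightarrow> 0"
    and dense: "\<And>p e K. p \<in> C \<Longrightarrow> e > 0 \<Longrightarrow> \<exists>l\<ge>K. dist (wavg q l) p < e"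
  shows "Vset (pt \<omega>) = nu ` C"
proof (intro equalityI subsetI)
  note lev_lim = filterlim_lev[OF T_strict_mono T_0]
  fix \<mu> assume "\<mu> \<in> nu ` C"
  then obtain p where p: "p \<in> C" "\<mu> = nu p" by blast
  then have pS: "p \<in> simplexS" using C by auto
  have "\<exists>n\<ge>K. dist (wavg q (lev T n)) p < e" if e0: "e > 0" for e K
  proof -
    obtain l where l: "l \<ge> K" "dist (wavg q l) p < e" using dense[OF p(1) e0] by blast
    have "lev T (T l) = l"
      using strict_monoD[OF T_strict_mono, of l "Suc l"] by (intro lev_eq[OF T_strict_mono T_0]) auto
    moreover have "T l \<ge> K" using strict_mono_imp_increasing[OF T_strict_mono, of l] l(1) by simp
    ultimately show ?thesis using l(2) by (intro exI[of _ "T l"]) simp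
  qed
  then obtain r where r: "strict_mono r" "(\<lambda>k. wavg q (lev T (r k))) \<longlonglongrightarrow> p"
    using frequent_subsequence[of "\<lambda>n. wavg q (lev T n)" p] by blast
  have "(\<lambda>k. emp_avg g (r k) (pt \<omega>)) \<longlonglongrightarrow> integral\<^sup>L \<mu> g" if g: "continuous_on UNIV g" for g
    unfolding p(2) integral_nu_gbar[OF pS g]
    using g filterlim_subseq[OF r(1)] r(2) by (rule emp_avg_tendsto)
  then show "\<mu> \<in> Vset (pt \<omega>)"
    unfolding Vset_def using r(1) prob_meas01_nu[OF pS] p(2) by blast
next
  fix \<mu> assume "\<mu> \<in> Vset (pt \<omega>)"
  then obtain r where \<mu>: "prob_meas01 \<mu>" and r: "strict_mono r"
    and lim: "\<And>g. continuous_on UNIV g \<Longrightarrow> (\<lambda>k. emp_avg g (r k) (pt \<omega>)) \<longlonglongrightarrow> integral\<^sup>L \<mu> g"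
    unfolding Vset_def by blast
  obtain p s where p: "p \<in> C" and s: "strict_mono s" "((\<lambda>k. c (lev T (r k))) \<circ> s) \<longlonglongrightarrow> p"
    using C(2) c(1) unfolding compact_def by meson
  have pS: "p \<in> simplexS" using p C by auto
  have rs: "filterlim (\<lambda>k. r (s k)) at_top sequentially"
    using filterlim_subseq[OF strict_mono_o[OF r s(1)]] by (simp add: comp_def)
  have "(\<lambda>k. wavg q (lev T (r (s k))) - c (lev T (r (s k)))) \<longlonglongrightarrow> 0"
    by (rule filterlim_compose[OF c(2)]) (rule filterlim_compose[OF filterlim_lev[OF T_strict_mono T_0] rs])
  from tendsto_add[OF this s(2)[unfolded comp_def]]
  have P: "(\<lambda>k. wavg q (lev T (r (s k)))) \<longlonglongrightarrow> p" by simp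
  have "integral\<^sup>L \<mu> g = gbar g p" if g: "continuous_on UNIV g" for g
  proof (rule LIMSEQ_unique)
    show "(\<lambda>k. emp_avg g (r (s k)) (pt \<omega>)) \<longlonglongrightarrow> integral\<^sup>L \<mu> g"
      using lim[OF g] filterlim_subseq[OF s(1)] by (rule filterlim_compose)
    show "(\<lambda>k. emp_avg g (r (s k)) (pt \<omega>)) \<longlonglongrightarrow> gbar g p"
      using g rs P by (rule emp_avg_tendsto)
  qed
  then show "\<mu> \<in> nu ` C" using measure_eq_nuI[OF \<mu> pS] p by blast
qed

end

lemma bounded_simplexS: "bounded simplexS"
  unfolding bounded_iff using norm_simplexS_le by blast

theorem theorem2:
  shows "(\<forall>C. C \<subseteq> simplexS \<and> C \<noteq> {} \<and> closed C \<and> connected C \<longrightarrow>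
            hausdorff_dim {x \<in> {0..1}. Vset x = nu ` C} = 1)
       \<and> (\<forall>p \<in> simplexS. hausdorff_dim {x \<in> {0..1}. emp_conv x (nu p)} = 1)"
proof (intro conjI allI impI ballI)
  fix C :: "vec3 set" assume C: "C \<subseteq> simplexS \<and> C \<noteq> {} \<and> closed C \<and> connected C"
  then have cpt: "compact C" using bounded_subset[OF bounded_simplexS] compact_eq_bounded_closed by blast
  have C': "C \<subseteq> simplexS" "C \<noteq> {}" "connected C" using C by auto
  obtain q c where q: "\<And>i. q i \<in> simplexS" and c: "\<And>l. c l \<in> C" "(\<lambda>l. wavg q l - c l) \<longlonglongrightarrow> 0"
    and dense: "\<And>p e K. p \<in> C \<Longrightarrow> e > 0 \<Longrightarrow> \<exists>l\<ge>K. dist (wavg q l) p < e"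
    using exists_frequency_sequence[OF C'] by blast
  show "hausdorff_dim {x \<in> {0..1}. Vset x = nu ` C} = 1"
  proof (rule hausdorff_dim_inserted_codes[of q, OF q])
    fix N
    show "insertion.pt (rword q) ` insertion.codes N \<subseteq> {x \<in> {0..1}. Vset x = nu ` C}"
    proof (intro subsetI, elim imageE)
      fix x \<omega> assume x: "x = insertion.pt (rword q) \<omega>" and \<omega>: "\<omega> \<in> insertion.codes N"
      interpret tracking q N \<omega>
        using insertion_rword[OF q] q \<omega> by (simp add: tracking_def tracking_axioms_def)
      have "Vset (pt \<omega>) = nu ` C"
        using conjunct1[OF C] cpt c dense by (rule Vset_pt)
      then show "x \<in> {x \<in> {0..1}. Vset x = nu ` C}" using pt_in_01 x by simp
    qed
  qed auto
next
  fix p :: vec3 assume p: "p \<in> simplexS"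
  \<comment> \<open>Constant frequencies have averages equal to \<open>p\<close> from
    \<open>l = 2\<close> on, which gives convergence of the whole sequence directly rather than
    through the singleton \<open>C = {p}\<close>.\<close>
  define q where "q = (\<lambda>i::nat. p)"
  have q: "q i \<in> simplexS" for i using p by (simp add: q_def)
  have "wavg q l = p" if "l \<ge> 2" for l
    using Wt_pos[OF that] by (simp add: wavg_def q_def Wt_def scaleR_sum_left[symmetric])
  then have "\<forall>\<^sub>F l in sequentially. wavg q l = p" using eventually_sequentially by blast
  then have P: "wavg q \<longlonglongrightarrow> p" by (rule tendsto_eventually)
  show "hausdorff_dim {x \<in> {0..1}. emp_conv x (nu p)} = 1"
  proof (rule hausdorff_dim_inserted_codes[of q, OF q])
    fix N
    show "insertion.pt (rword q) ` insertion.codes N \<subseteq> {x \<in> {0..1}. emp_conv x (nu p)}"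
    proof (intro subsetI, elim imageE)
      fix x \<omega> assume x: "x = insertion.pt (rword q) \<omega>" and \<omega>: "\<omega> \<in> insertion.codes N"
      interpret tracking q N \<omega>
        using insertion_rword[OF q] q \<omega> by (simp add: tracking_def tracking_axioms_def)
      show "x \<in> {x \<in> {0..1}. emp_conv x (nu p)}" using emp_conv_pt[OF p P] pt_in_01 x by simp
    qed
  qed auto
qed

end
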